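(* Let $F$ be a self-affine sponge satisfying the SPPC and $\nu_{\boldsymbol\mu}$ a self-affine measure on $F$ with a strictly positive probability vector $\boldsymbol\mu$. Then the $L^q$ spectrum $T(\nu_{\boldsymbol\mu},q)$ exists and $T(\nu_{\boldsymbol\mu},q)=P(\boldsymbol\psi_q^{\boldsymbol\mu})$ for all $q\in\mathbb R$. In particular the box dimension of $F$ exists and $\dim_{\mathrm B}F=\dim_{\mathrm P}F=P(\boldsymbol\psi_0^{\boldsymbol\mu})$.
   Context: Sponge setup: $d\ge1$, $\mathcal I=\{1,\dots,N\}$, $f_i(x)=A_ix+t_i$ on $\mathbb R^d$ with $A_i=\mathrm{diag}(a_i^{(1)},\dots,a_i^{(d)})$, $\lambda_i^{(n)}:=|a_i^{(n)}|\in(0,1)$, $f_i([0,1]^d)\subset[0,1]^d$, no two distinct $f_i$ agree on $[0,1]^d$, and there is $r_0>0$ such that for each $1\le n\le d$, $u\in\{0,1\}$ some $k\in\mathcal I$ has $\mathrm{dist}(\{x\in[0,1]^d:x_n=u\},f_k([0,1]^d))\ge r_0$. $F$ (the sponge) is the unique nonempty compact set with $F=\bigcup_if_i(F)$. $\Sigma=\mathcal I^{\mathbb N}$, $\pi(\mathbf i)=\lim_kf_{i_1}\circ\dots\circ f_{i_k}(0)$. Orderings and approximate cubes: for a permutation $\sigma=(\sigma_1,\dots,\sigma_d)$, $E_n^\sigma$ = span of coordinate axes $\sigma_1,\dots,\sigma_n$, $\Pi_n^\sigma$ the orthogonal projection onto it; $f_i,f_j$ overlap exactly on $E_n^\sigma$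 if $\Pi_n^\sigma f_i=\Pi_n^\sigma f_j$ on $[0,1]^d$; $\mathcal I_n^\sigma$ = set of smallest elements of the equivalence classes of this relation, $\Pi_n^\sigma j$ = smallest element of the class of $j$, extended coordinatewise to sequences. $L_\delta(\mathbf i,n)$ is the unique integer with $\prod_{\ell\le L_\delta(\mathbf i,n)}\lambda_{i_\ell}^{(n)}\le\delta<\prod_{\ell\le L_\delta(\mathbf i,n)-1}\lambda_{i_\ell}^{(n)}$; $\mathbf i$ is $\sigma$-ordered at scale $\delta$ if $L_\delta(\mathbf i,\sigma_d)\le\dots\le L_\delta(\mathbf i,\sigma_1)$ with ties broken by $\sigma_n>\sigma_{n-1}$; $\Sigma_\delta^\sigma$ the set of such $\mathbf i$; $\mathcal A_\delta=\{\sigma:\Sigma_\delta^\sigma\neq\emptyset\}$, $\mathcal A=\bigcup_\delta\mathcal A_\delta$; $L_\delta(\mathbf i,\sigma_{d+1})=0$; for $\mathbf i\in\Sigma_\delta^\sigma$, $B_\delta(\mathbf i)=\{\mathbf j:|\Pi_n^\sigma\mathbf j\wedge\Pi_n^\sigma\mathbf i|\ge L_\delta(\mathbf i,\sigma_n)\ \forall n\}$; $\mathcal B_\delta^\sigma$ the set of these cubes. Pressure: for potentials $\boldsymbol\varphi=\{\varphi_n^\sigma:\mathcal I_n^\sigma\to\mathbb R\}$, $\Phi(B_\delta(\mathbf i))=\sum_{n=1}^d\sum_{\ell=L_\delta(\mathbf i,\sigma_{n+1})+1}^{L_\delta(\mathbf i,\sigma_n)}\varphi_n^\sigma(\Pi_n^\sigma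 i_\ell)$ and $P(\boldsymbol\varphi)=\lim_{\delta\to0}\frac{-1}{\log\delta}\log\sum_{\sigma\in\mathcal A_\delta}\sum_{B\in\mathcal B_\delta^\sigma}e^{\Phi(B)}$ (this limit exists). Measures: $\boldsymbol\mu=(\mu(i))_{i\in\mathcal I}$ a probability vector with positive entries; $\nu_{\boldsymbol\mu}=\boldsymbol\mu^{\mathbb N}\circ\pi^{-1}$ is the self-affine measure. $\mu_n^\sigma(i)=\sum_{j:\Pi_n^\sigma j=i}\mu(j)$ for $i\in\mathcal I_n^\sigma$; $\boldsymbol\psi_q^{\boldsymbol\mu}=\{\psi_{q,n}^{\boldsymbol\mu,\sigma}\}$ with $\psi_{q,n}^{\boldsymbol\mu,\sigma}(i)=q\log\mu_n^\sigma(i)$. SPPC: $F$ satisfies the separation of principal projections condition if for every $\sigma\in\mathcal A$, $1\le n\le d$, $i,j\in\mathcal I$, either $f_i,f_j$ overlap exactly on $E_n^\sigma$ or $\Pi_n^\sigma(f_i((0,1)^d))\cap\Pi_n^\sigma(f_j((0,1)^d))=\emptyset$. $L^q$ spectrum: for a compactly supported probability measure $\nu$, $T_\delta(\nu,q)=\sup\sum_i\nu(B(x_i,\delta))^q$ over centred packings (disjoint closed balls $B(x_i,\delta)$ with $x_i\in\mathrm{supp}\,\nu$), and $T(\nu,q)=\lim_{\delta\to0}\log T_\delta(\nu,q)/(-\log\delta)$ when the limit exists. *)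

theory Defs
  imports "HOL-Probability.Probability"
begin

text \<open>Coordinates of \<open>\<real>^d\<close> are indexed by a finite linearly ordered type \<open>'n\<close>
 (so \<open>d = CARD('n)\<close>). The index set is \<open>{1..N}\<close>; the map \<open>f_i\<close> is given by
 its diagonal entries \<open>a i c\<close> and translation \<open>t i\<close>. Infinite words are maps
 \<open>nat \<Rightarrow> nat\<close>; position \<open>\<ell>\<close> of the paper (1-based) is \<open>w (\<ell>-1)\<close>.\<close>

definition Idx :: "nat \<Rightarrow> nat set" where
  "Idx N = {1..N}"

definition fmap :: "(nat \<Rightarrow> 'n::finite \<Rightarrow> real) \<Rightarrow> (nat \<Rightarrow> real^'n) \<Rightarrow> nat \<Rightarrow> real^'n \<Rightarrow> real^'n" where
  "fmap a t i x = (\<chi> c. a i c * x $ c + t i $ c)"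

definition unitcube :: "(real^'n::finite) set" where
  "unitcube = {x. \<forall>c. 0 \<le> x $ c \<and> x $ c \<le> 1}"

definition open_unitcube :: "(real^'n::finite) set" where
  "open_unitcube = {x. \<forall>c. 0 < x $ c \<and> x $ c < 1}"

definition sponge_system :: "nat \<Rightarrow> (nat \<Rightarrow> 'n::finite \<Rightarrow> real) \<Rightarrow> (nat \<Rightarrow> real^'n) \<Rightarrow> bool" where
  "sponge_system N a t \<longleftrightarrow>
     N \<ge> 1 \<and>
     (\<forall>i\<in>Idx N. \<forall>c. 0 < \<bar>a i c\<bar> \<and> \<bar>a i c\<bar> < 1) \<and>
     (\<forall>i\<in>Idx N. fmap a t i ` unitcube \<subseteq> unitcube) \<and>
     (\<forall>i\<in>Idx N. \<forall>j\<in>Idx N. i \<noteq> j \<longrightarrow> \<not> (\<forall>x\<in>unitcube. fmap a t i x = fmap a t j x)) \<and>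
     (\<exists>r0>0. \<forall>c. \<forall>u\<in>{0::real,1}. \<exists>k\<in>Idx N.
        setdist {x\<in>unitcube. x $ c = u} (fmap a t k ` unitcube) \<ge> r0)"

definition sponge :: "nat \<Rightarrow> (nat \<Rightarrow> 'n::finite \<Rightarrow> real) \<Rightarrow> (nat \<Rightarrow> real^'n) \<Rightarrow> (real^'n) set" where
  "sponge N a t = (THE F. F \<noteq> {} \<and> compact F \<and> F = (\<Union>i\<in>Idx N. fmap a t i ` F))"

definition words :: "nat \<Rightarrow> (nat \<Rightarrow> nat) set" where
  "words N = {w. \<forall>l. w l \<in> Idx N}"

fun comp_first :: "(nat \<Rightarrow> 'n::finite \<Rightarrow> real) \<Rightarrow> (nat \<Rightarrow> real^'n) \<Rightarrow> nat \<Rightarrow> (nat \<Rightarrow> nat) \<Rightarrow> real^'n \<Rightarrow> real^'n" where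
  "comp_first a t 0 w = id"
| "comp_first a t (Suc k) w = comp_first a t k w \<circ> fmap a t (w k)"

definition coding :: "(nat \<Rightarrow> 'n::finite \<Rightarrow> real) \<Rightarrow> (nat \<Rightarrow> real^'n) \<Rightarrow> (nat \<Rightarrow> nat) \<Rightarrow> real^'n" where
  "coding a t w = lim (\<lambda>k. comp_first a t k w 0)"

definition self_affine_measure :: "nat \<Rightarrow> (nat \<Rightarrow> 'n::finite \<Rightarrow> real) \<Rightarrow> (nat \<Rightarrow> real^'n) \<Rightarrow> (nat \<Rightarrow> real) \<Rightarrow> (real^'n) measure" where
  "self_affine_measure N a t \<mu> =
     distr (PiM UNIV (\<lambda>_::nat. point_measure (Idx N) (\<lambda>i. ennreal (\<mu> i)))) borel (coding a t)"

text \<open>A permutation \<open>\<sigma> = (\<sigma>_1,\<dots>,\<sigma>_d)\<close> is a list of all coordinates without repetition;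
 \<open>\<sigma>_n = \<sigma> ! (n-1)\<close>.\<close>
definition perms :: "'n::finite list set" where
  "perms = {\<sigma>. distinct \<sigma> \<and> set \<sigma> = UNIV}"

definition Ecoords :: "'n::finite list \<Rightarrow> nat \<Rightarrow> 'n set" where
  "Ecoords \<sigma> n = set (take n \<sigma>)"

definition proj :: "'n::finite list \<Rightarrow> nat \<Rightarrow> real^'n \<Rightarrow> real^'n" where
  "proj \<sigma> n x = (\<chi> c. if c \<in> Ecoords \<sigma> n then x $ c else 0)"

definition overlap_exactly :: "(nat \<Rightarrow> 'n::finite \<Rightarrow> real) \<Rightarrow> (nat \<Rightarrow> real^'n) \<Rightarrow> 'n list \<Rightarrow> nat \<Rightarrow> nat \<Rightarrow> nat \<Rightarrow> bool" where
  "overlap_exactly a t \<sigma> n i j \<longleftrightarrow> (\<forall>x\<in>unitcube. proj \<sigma> n (fmap a t i x) = proj \<sigma> n (fmap a t j x))"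

definition proj_idx :: "nat \<Rightarrow> (nat \<Rightarrow> 'n::finite \<Rightarrow> real) \<Rightarrow> (nat \<Rightarrow> real^'n) \<Rightarrow> 'n list \<Rightarrow> nat \<Rightarrow> nat \<Rightarrow> nat" where
  "proj_idx N a t \<sigma> n j = (LEAST k. k \<in> Idx N \<and> overlap_exactly a t \<sigma> n k j)"

definition Idx_proj :: "nat \<Rightarrow> (nat \<Rightarrow> 'n::finite \<Rightarrow> real) \<Rightarrow> (nat \<Rightarrow> real^'n) \<Rightarrow> 'n list \<Rightarrow> nat \<Rightarrow> nat set" where
  "Idx_proj N a t \<sigma> n = proj_idx N a t \<sigma> n ` Idx N"

text \<open>\<open>L_\<delta>(w,c)\<close>: the least \<open>L\<close> with \<open>\<Prod>_{\<ell>\<le>L} \<lambda>^{(c)}_{i_\<ell>} \<le> \<delta>\<close>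
 (for \<open>0<\<delta><1\<close> this is the unique integer in the paper's definition).\<close>
definition Ldelta :: "(nat \<Rightarrow> 'n::finite \<Rightarrow> real) \<Rightarrow> real \<Rightarrow> (nat \<Rightarrow> nat) \<Rightarrow> 'n \<Rightarrow> nat" where
  "Ldelta a \<delta> w c = (LEAST L. (\<Prod>l<L. \<bar>a (w l) c\<bar>) \<le> \<delta>)"

definition ordered_at :: "(nat \<Rightarrow> 'n::{finite,linorder} \<Rightarrow> real) \<Rightarrow> 'n::{finite,linorder} list \<Rightarrow> real \<Rightarrow> (nat \<Rightarrow> nat) \<Rightarrow> bool" where
  "ordered_at a \<sigma> \<delta> w \<longleftrightarrow>
     (\<forall>k. Suc k < length \<sigma> \<longrightarrow>
        Ldelta a \<delta> w (\<sigma> ! Suc k) \<le> Ldelta a \<delta> w (\<sigma> ! k) \<and>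
        (Ldelta a \<delta> w (\<sigma> ! Suc k) = Ldelta a \<delta> w (\<sigma> ! k) \<longrightarrow> \<sigma> ! Suc k > \<sigma> ! k))"

definition Sigma_ord :: "nat \<Rightarrow> (nat \<Rightarrow> 'n::{finite,linorder} \<Rightarrow> real) \<Rightarrow> 'n::{finite,linorder} list \<Rightarrow> real \<Rightarrow> (nat \<Rightarrow> nat) set" where
  "Sigma_ord N a \<sigma> \<delta> = {w \<in> words N. ordered_at a \<sigma> \<delta> w}"

definition Adelta :: "nat \<Rightarrow> (nat \<Rightarrow> 'n::{finite,linorder} \<Rightarrow> real) \<Rightarrow> real \<Rightarrow> 'n::{finite,linorder} list set" where
  "Adelta N a \<delta> = {\<sigma> \<in> perms. Sigma_ord N a \<sigma> \<delta> \<noteq> {}}"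

definition Aall :: "nat \<Rightarrow> (nat \<Rightarrow> 'n::{finite,linorder} \<Rightarrow> real) \<Rightarrow> 'n::{finite,linorder} list set" where
  "Aall N a = (\<Union>\<delta>\<in>{0<..<1}. Adelta N a \<delta>)"

text \<open>Approximate cube \<open>B_\<delta>(i)\<close>: \<open>|\<Pi>_n^\<sigma> j \<wedge> \<Pi>_n^\<sigma> i| \<ge> L_\<delta>(i,\<sigma>_n)\<close> means
 the projected words agree on the first \<open>L_\<delta>(i,\<sigma>_n)\<close> positions.\<close>
definition Bcube :: "nat \<Rightarrow> (nat \<Rightarrow> 'n::{finite,linorder} \<Rightarrow> real) \<Rightarrow> (nat \<Rightarrow> real^'n::{finite,linorder}) \<Rightarrow> 'n::{finite,linorder} list \<Rightarrow> real \<Rightarrow> (nat \<Rightarrow> nat) \<Rightarrow> (nat \<Rightarrow> nat) set" where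
  "Bcube N a t \<sigma> \<delta> w = {v \<in> words N. \<forall>n\<in>{1..length \<sigma>}. \<forall>l < Ldelta a \<delta> w (\<sigma> ! (n - 1)).
      proj_idx N a t \<sigma> n (v l) = proj_idx N a t \<sigma> n (w l)}"

definition Bcubes :: "nat \<Rightarrow> (nat \<Rightarrow> 'n::{finite,linorder} \<Rightarrow> real) \<Rightarrow> (nat \<Rightarrow> real^'n::{finite,linorder}) \<Rightarrow> 'n::{finite,linorder} list \<Rightarrow> real \<Rightarrow> (nat \<Rightarrow> nat) set set" where
  "Bcubes N a t \<sigma> \<delta> = Bcube N a t \<sigma> \<delta> ` Sigma_ord N a \<sigma> \<delta>"

text \<open>\<open>L_\<delta>(w,\<sigma>_{n})\<close> with the convention \<open>L_\<delta>(w,\<sigma>_{d+1}) = 0\<close> (n is 1-based).\<close>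
definition Lsig :: "(nat \<Rightarrow> 'n::finite \<Rightarrow> real) \<Rightarrow> 'n list \<Rightarrow> real \<Rightarrow> (nat \<Rightarrow> nat) \<Rightarrow> nat \<Rightarrow> nat" where
  "Lsig a \<sigma> \<delta> w n = (if n \<le> length \<sigma> then Ldelta a \<delta> w (\<sigma> ! (n - 1)) else 0)"

text \<open>Potentials: \<open>\<phi> \<sigma> n\<close> is \<open>\<phi>_n^\<sigma>\<close> (only its values on \<open>\<I>_n^\<sigma>\<close> matter).\<close>
definition Phi_word :: "nat \<Rightarrow> (nat \<Rightarrow> 'n::{finite,linorder} \<Rightarrow> real) \<Rightarrow> (nat \<Rightarrow> real^'n::{finite,linorder}) \<Rightarrow> ('n::{finite,linorder} list \<Rightarrow> nat \<Rightarrow> nat \<Rightarrow> real)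
      \<Rightarrow> 'n::{finite,linorder} list \<Rightarrow> real \<Rightarrow> (nat \<Rightarrow> nat) \<Rightarrow> real" where
  "Phi_word N a t \<phi> \<sigma> \<delta> w =
     (\<Sum>n=1..length \<sigma>. \<Sum>l\<in>{Lsig a \<sigma> \<delta> w (Suc n)..<Lsig a \<sigma> \<delta> w n}. \<phi> \<sigma> n (proj_idx N a t \<sigma> n (w l)))"

definition Phi_cube :: "nat \<Rightarrow> (nat \<Rightarrow> 'n::{finite,linorder} \<Rightarrow> real) \<Rightarrow> (nat \<Rightarrow> real^'n::{finite,linorder}) \<Rightarrow> ('n::{finite,linorder} list \<Rightarrow> nat \<Rightarrow> nat \<Rightarrow> real)
      \<Rightarrow> 'n::{finite,linorder} list \<Rightarrow> real \<Rightarrow> (nat \<Rightarrow> nat) set \<Rightarrow> real" where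
  "Phi_cube N a t \<phi> \<sigma> \<delta> B =
     Phi_word N a t \<phi> \<sigma> \<delta> (SOME w. w \<in> Sigma_ord N a \<sigma> \<delta> \<and> B = Bcube N a t \<sigma> \<delta> w)"

definition pressure :: "nat \<Rightarrow> (nat \<Rightarrow> 'n::{finite,linorder} \<Rightarrow> real) \<Rightarrow> (nat \<Rightarrow> real^'n::{finite,linorder}) \<Rightarrow> ('n::{finite,linorder} list \<Rightarrow> nat \<Rightarrow> nat \<Rightarrow> real) \<Rightarrow> real" where
  "pressure N a t \<phi> = Lim (at_right 0) (\<lambda>\<delta>::real.
      ln (\<Sum>\<sigma>\<in>Adelta N a \<delta>. \<Sum>B\<in>Bcubes N a t \<sigma> \<delta>. exp (Phi_cube N a t \<phi> \<sigma> \<delta> B)) / (- ln \<delta>))"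

definition mu_proj :: "nat \<Rightarrow> (nat \<Rightarrow> 'n::finite \<Rightarrow> real) \<Rightarrow> (nat \<Rightarrow> real^'n) \<Rightarrow> (nat \<Rightarrow> real) \<Rightarrow> 'n list \<Rightarrow> nat \<Rightarrow> nat \<Rightarrow> real" where
  "mu_proj N a t \<mu> \<sigma> n i = (\<Sum>j\<in>{j\<in>Idx N. proj_idx N a t \<sigma> n j = i}. \<mu> j)"

definition psi :: "nat \<Rightarrow> (nat \<Rightarrow> 'n::finite \<Rightarrow> real) \<Rightarrow> (nat \<Rightarrow> real^'n) \<Rightarrow> (nat \<Rightarrow> real) \<Rightarrow> real \<Rightarrow> 'n list \<Rightarrow> nat \<Rightarrow> nat \<Rightarrow> real" where
  "psi N a t \<mu> q \<sigma> n i = q * ln (mu_proj N a t \<mu> \<sigma> n i)"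

definition SPPC :: "nat \<Rightarrow> (nat \<Rightarrow> 'n::{finite,linorder} \<Rightarrow> real) \<Rightarrow> (nat \<Rightarrow> real^'n::{finite,linorder}) \<Rightarrow> bool" where
  "SPPC N a t \<longleftrightarrow>
     (\<forall>\<sigma>\<in>Aall N a. \<forall>n\<in>{1..CARD('n)}. \<forall>i\<in>Idx N. \<forall>j\<in>Idx N.
        overlap_exactly a t \<sigma> n i j \<or>
        proj \<sigma> n ` fmap a t i ` open_unitcube \<inter> proj \<sigma> n ` fmap a t j ` open_unitcube = {})"

definition msupport :: "('a::metric_space) measure \<Rightarrow> 'a set" where
  "msupport \<nu> = {x. \<forall>e>0. emeasure \<nu> (ball x e) \<noteq> 0}"

definition centred_packing :: "('a::metric_space) measure \<Rightarrow> real \<Rightarrow> 'a set \<Rightarrow> bool" where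
  "centred_packing \<nu> \<delta> X \<longleftrightarrow> finite X \<and> X \<subseteq> msupport \<nu> \<and>
     (\<forall>x\<in>X. \<forall>y\<in>X. x \<noteq> y \<longrightarrow> cball x \<delta> \<inter> cball y \<delta> = {})"

definition Tdelta :: "('a::metric_space) measure \<Rightarrow> real \<Rightarrow> real \<Rightarrow> real" where
  "Tdelta \<nu> q \<delta> = (SUP X\<in>{X. centred_packing \<nu> \<delta> X}. \<Sum>x\<in>X. measure \<nu> (cball x \<delta>) powr q)"

definition Lq_spectrum_is :: "('a::metric_space) measure \<Rightarrow> real \<Rightarrow> real \<Rightarrow> bool" where
  "Lq_spectrum_is \<nu> q T \<longleftrightarrow> ((\<lambda>\<delta>. ln (Tdelta \<nu> q \<delta>) / (- ln \<delta>)) \<longlongrightarrow> T) (at_right 0)"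

definition covnum :: "('a::metric_space) set \<Rightarrow> real \<Rightarrow> nat" where
  "covnum E \<delta> = (LEAST k. \<exists>C. finite C \<and> card C = k \<and> E \<subseteq> \<Union>C \<and> (\<forall>U\<in>C. bounded U \<and> diameter U \<le> \<delta>))"

definition box_dim_is :: "('a::metric_space) set \<Rightarrow> real \<Rightarrow> bool" where
  "box_dim_is E s \<longleftrightarrow> ((\<lambda>\<delta>. ln (real (covnum E \<delta>)) / (- ln \<delta>)) \<longlongrightarrow> s) (at_right 0)"

text \<open>Packing premeasure, packing measure and packing dimension (Falconer, 3.4).\<close>
definition packing_sum_delta :: "real \<Rightarrow> real \<Rightarrow> ('a::metric_space) set \<Rightarrow> ennreal" where
  "packing_sum_delta s \<delta> E =
     (SUP (X, r)\<in>{(X, r). countable X \<and> X \<subseteq> E \<and> (\<forall>x\<in>X. 0 < r x \<and> r x \<le> \<delta>) \<and>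
                     (\<forall>x\<in>X. \<forall>y\<in>X. x \<noteq> y \<longrightarrow> cball x (r x) \<inter> cball y (r y) = {})}.
        \<integral>\<^sup>+ x. ennreal ((2 * r x) powr s) \<partial>count_space X)"

definition packing_premeasure :: "real \<Rightarrow> ('a::metric_space) set \<Rightarrow> ennreal" where
  "packing_premeasure s E = (INF \<delta>\<in>{0<..}. packing_sum_delta s \<delta> E)"

definition packing_measure :: "real \<Rightarrow> ('a::metric_space) set \<Rightarrow> ennreal" where
  "packing_measure s F = (INF E\<in>{E :: nat \<Rightarrow> 'a set. F \<subseteq> (\<Union>i. E i)}. \<Sum>i. packing_premeasure s (E i))"

definition packing_dim :: "('a::metric_space) set \<Rightarrow> real" where
  "packing_dim F = Inf {s. 0 \<le> s \<and> packing_measure s F = 0}"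

end

theory Submission
  imports Defs
begin

text \<open>At scale \<open>e\<^sup>-\<^sup>s\<close> the approximate cube of a word \<open>w\<close> consists of the words that agree with \<open>w\<close> in
  every coordinate \<open>c\<close> on the first \<open>lev s w c\<close> letters. In this form no ordering of the coordinates
  is mentioned, the cubes partition the words, and the Bernoulli measure of a cube is a product over
  positions, each factor depending only on the set of coordinates that are still active there.

  Existence of the pressure: words with the same profile of levels can be interleaved letter by
  letter. This multiplies the weights and keeps different tuples in different cubes. There are only
  polynomially many profiles in \<open>s\<close>, so the logarithm of the sum over cubes is superadditive up to
  an error \<open>o(s)\<close>.

  The spectrum: by the SPPC, boxes of different cubes with the same profile have disjoint interiors.
  Hence a ball meets at most polynomially (in \<open>s\<close>) many cubes, which gives the upper bound. For the lower bound,
  a bounded number of letters of each word is overwritten by a block that maps the unit cube into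
  its interior. The coded point then lies deep inside its box, so that a ball around it has, up to
  constants, the mass of the cube. This estimate is two-sided and serves all \<open>q\<close> at once.

  The case \<open>q = 0\<close> counts packings and gives the box dimension. Every relatively open piece of the
  sponge contains an affine copy of the sponge, so the packing dimension follows from the Baire
  category theorem.\<close>

section \<open>Limits, packings and coverings\<close>

text \<open>Concatenation cannot prove superadditivity: along a cube the set of active coordinates
  only shrinks, whereas a second word would start again with all of them active. Interleaving keeps
  the set decreasing, provided that all words have the same profile. The level of the interleaved
  word at scale \<open>k * s\<close> misses \<open>k * M c\<close> by at most a constant times
  \<open>k\<close>, an error that is small against \<open>k * s\<close> once \<open>s\<close> is
  large.

  For the lower bound, a point of the sponge may lie on the boundary of its box, and a ball around
  it then also collects mass from neighbouring boxes. For negative \<open>q\<close> this extra mass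
  would spoil the estimate, so the mass of the ball must be controlled from above as well. The
  coordinates reach their levels at different positions, so a block is written behind every level. A
  block written for one coordinate can change letters that count for another one, and different
  words can become equal. Both losses are bounded by constants: the first costs a power of
  \<open>mumin\<close>, the second is removed by sorting the words by their overwritten
  letters.\<close>

lemma powr_compare:
  fixes x y \<eta> q :: real
  assumes "0 < x" "0 < y" "0 < \<eta>" "\<eta> * x \<le> y" "\<eta> * y \<le> x"
  shows "x powr q \<le> \<eta> powr (-\<bar>q\<bar>) * y powr q"
\<comment> \<open>The two inequalities between \<open>x\<close> and \<open>y\<close> serve one sign
  of the exponent each.\<close>
proof (cases "q \<ge> 0")
  case True
  have "x powr q \<le> (y / \<eta>) powr q"
    using assms True by (intro powr_mono2) (auto simp: field_simps)
  also have "\<dots> = \<eta> powr (-\<bar>q\<bar>) * y powr q"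
    using assms True by (simp add: powr_divide powr_minus field_simps)
  finally show ?thesis .
next
  case False
  have "x powr q \<le> (\<eta> * y) powr q"
    using assms False by (intro powr_mono2') auto
  also have "\<dots> = \<eta> powr (-\<bar>q\<bar>) * y powr q"
    using assms False by (simp add: powr_mult)
  finally show ?thesis .
qed

text \<open>A Fekete lemma for a real parameter: the limit is the supremum of
  \<open>(g s - H s) / s\<close>. Superadditivity is given only along integer multiples
  \<open>k * s\<close>; the coarse Lipschitz bound, whose summand 1 admits jumps, bridges the gaps
  between multiples.\<close>

lemma almost_superadditive_limit:
  fixes g H :: "real \<Rightarrow> real" and A :: real
  assumes lip: "\<And>s s'. 0 \<le> s \<Longrightarrow> 0 \<le> s' \<Longrightarrow> \<bar>g s - g s'\<bar> \<le> A * (\<bar>s - s'\<bar> + 1)"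
    and sup: "\<And>s k. 1 \<le> s \<Longrightarrow> 1 \<le> k \<Longrightarrow> real k * g s \<le> g (real k * s) + real k * H s"
    and H: "((\<lambda>s. H s / s) \<longlongrightarrow> 0) at_top"
  shows "\<exists>P. ((\<lambda>s. g s / s) \<longlongrightarrow> P) at_top"
proof -
  define X where "X = (\<lambda>s. (g s - H s) / s) ` {1..}"
  have A: "0 \<le> A" using lip[of 0 0] by simp
  \<comment> \<open>This is the case \<open>k = 1\<close> of the second hypothesis.\<close>
  have H0: "0 \<le> H s" if "1 \<le> s" for s using sup[OF that, of 1] by simp
  have bdd: "bdd_above X"
  proof (rule bdd_aboveI)
    fix x assume "x \<in> X"
    then obtain s where s: "1 \<le> s" "x = (g s - H s) / s" by (auto simp: X_def)
    have "g s \<le> \<bar>g 0\<bar> + A * (s + 1)" using lip[of s 0] s by auto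
    then have "g s - H s \<le> \<bar>g 0\<bar> * s + A * (2 * s)"
      using H0[OF s(1)] s(1) A mult_left_mono[of 1 s "\<bar>g 0\<bar>"] mult_left_mono[of "s + 1" "2 * s" A] by simp
    then show "x \<le> \<bar>g 0\<bar> + 2 * A" using s by (simp add: pos_divide_le_eq algebra_simps)
  qed
  define P where "P = Sup X"
  have up: "(g s - H s) / s \<le> P" if "1 \<le> s" for s
    unfolding P_def by (rule cSup_upper[OF _ bdd]) (use that in \<open>auto simp: X_def\<close>)
  have "((\<lambda>s. g s / s) \<longlongrightarrow> P) at_top"
  proof (rule order_tendstoI)
    fix x assume "P < x"
    then have "\<forall>\<^sub>F s in at_top. H s / s < x - P" using order_tendstoD(2)[OF H, of "x - P"] by simp
    then show "\<forall>\<^sub>F s in at_top. g s / s < x" using eventually_ge_at_top[of 1]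
    proof eventually_elim
      case (elim s)
      then show ?case using up[of s] by (simp add: diff_divide_distrib)
    qed
  next
    fix x assume "x < P"
    then obtain s0 where s0: "1 \<le> s0" "x < (g s0 - H s0) / s0"
      using less_cSup_iff[of X x] bdd by (auto simp: P_def X_def)
    define v where "v = (g s0 - H s0) / s0"
    \<comment> \<open>\<open>C\<close> collects what is lost in passing from \<open>s\<close> to the
      largest multiple of \<open>s0\<close> below it: the remainder times the slope
      \<open>v\<close>, which may be negative, and the Lipschitz error.\<close>
    define C where "C = s0 * \<bar>v\<bar> + A * (s0 + 1)"
    have "((\<lambda>s. C / s) \<longlongrightarrow> 0) at_top" by (intro tendsto_divide_0[OF tendsto_const] filterlim_at_top_imp_at_infinity filterlim_ident)
    then have "\<forall>\<^sub>F s in at_top. C / s < v - x" using order_tendstoD(2)[of _ 0 at_top "v - x"] s0 by (simp add: v_def)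
    then show "\<forall>\<^sub>F s in at_top. x < g s / s" using eventually_ge_at_top[of s0]
    proof eventually_elim
      case (elim s)
      have s: "1 \<le> s" using elim s0 by linarith
      define k where "k = nat \<lfloor>s / s0\<rfloor>"
      have "1 \<le> s / s0" using elim s0 by simp
      then have sk: "real k \<le> s / s0" "s / s0 < real k + 1" "1 \<le> k" unfolding k_def by linarith+
      have d: "0 \<le> s - real k * s0" "s - real k * s0 \<le> s0" using sk s0 by (auto simp: field_simps)
      have "g (real k * s0) - A * (s0 + 1) \<le> g s"
        using lip[of "real k * s0" s] d s s0 mult_left_mono[of "\<bar>real k * s0 - s\<bar> + 1" "s0 + 1" A] A
        by (smt (verit) mult_nonneg_nonneg of_nat_0_le_iff)
      moreover have "real k * (g s0 - H s0) \<le> g (real k * s0)"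
        using sup[OF s0(1) sk(3)] by (simp add: algebra_simps)
      moreover have "real k * (g s0 - H s0) = (real k * s0) * v" using s0 by (simp add: v_def)
      moreover have "s * v - s0 * \<bar>v\<bar> \<le> (real k * s0) * v"
      proof -
        have "(s - real k * s0) * v \<le> s0 * \<bar>v\<bar>"
          using mult_mono[of "s - real k * s0" s0 "\<bar>v\<bar>" "\<bar>v\<bar>"] mult_left_mono[OF abs_ge_self[of v], of "s - real k * s0"] d s0 by linarith
        then show ?thesis by (simp add: algebra_simps)
      qed
      ultimately have "s * v - C \<le> g s" unfolding C_def by linarith
      then have "(s * v - C) / s \<le> g s / s" using s by (intro divide_right_mono) auto
      then have "v - C / s \<le> g s / s" using s by (simp add: diff_divide_distrib)
      with elim show ?case by linarith
    qed
  qed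
  then show ?thesis by blast
qed

text \<open>Sums and products along an interleaved word split by residue class into the
  contributions of the component words.\<close>

lemma (in comm_monoid_set) nat_group_mod:
  fixes m k :: nat
  shows "F g {..<m * k} = F (\<lambda>j. F (\<lambda>i. g (i * k + j)) {..<m}) {..<k}"
proof -
  have "F g {..<m * k} = F (\<lambda>i. F g {i * k..<i * k + k}) {..<m}" by (rule nat_group[symmetric])
  also have "\<dots> = F (\<lambda>i. F (\<lambda>j. g (i * k + j)) {..<k}) {..<m}"
  proof (rule cong[OF refl])
    fix i
    show "F g {i * k..<i * k + k} = F (\<lambda>j. g (i * k + j)) {..<k}"
      using shift_bounds_nat_ivl[of g 0 "i * k" k] by (simp add: atLeast0LessThan add.commute)
  qed
  also have "\<dots> = F (\<lambda>j. F (\<lambda>i. g (i * k + j)) {..<m}) {..<k}" by (rule swap)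
  finally show ?thesis .
qed

lemma tendsto_neg_ln_at_right_0:
  fixes f :: "real \<Rightarrow> 'a::topological_space"
  assumes "(f \<longlongrightarrow> l) at_top"
  shows "((\<lambda>\<delta>. f (- ln \<delta>)) \<longlongrightarrow> l) (at_right 0)"
proof (rule filterlim_compose[OF assms])
  show "filterlim (\<lambda>\<delta>::real. - ln \<delta>) at_top (at_right 0)"
    using ln_at_0 by (simp add: filterlim_uminus_at_top)
qed

text \<open>Applied to the levels along an ordering, which decrease, so that the intervals in the
  definition of the potential tile all positions. The comparison of the end points is carried along
  for the induction.\<close>

lemma sum_telescope_intervals:
  fixes L :: "nat \<Rightarrow> nat" and F :: "nat \<Rightarrow> 'a::comm_monoid_add"
  assumes "\<And>n. 1 \<le> n \<Longrightarrow> n \<le> d \<Longrightarrow> L (Suc n) \<le> L n"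
  shows "(\<Sum>n=1..d. \<Sum>l\<in>{L (Suc n)..<L n}. F l) = (\<Sum>l\<in>{L (Suc d)..<L 1}. F l) \<and> L (Suc d) \<le> L 1"
  using assms
proof (induction d)
  case (Suc d)
  then have IH: "(\<Sum>n=1..d. \<Sum>l\<in>{L (Suc n)..<L n}. F l) = (\<Sum>l\<in>{L (Suc d)..<L 1}. F l)" "L (Suc d) \<le> L 1" by auto
  have le: "L (Suc (Suc d)) \<le> L (Suc d)" using Suc.prems[of "Suc d"] by simp
  have "(\<Sum>n=1..Suc d. \<Sum>l\<in>{L (Suc n)..<L n}. F l) = (\<Sum>l\<in>{L (Suc d)..<L 1}. F l) + (\<Sum>l\<in>{L (Suc (Suc d))..<L (Suc d)}. F l)"
    using IH(1) by simp
  also have "\<dots> = (\<Sum>l\<in>{L (Suc (Suc d))..<L 1}. F l)"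
    using sum.atLeastLessThan_concat[OF le IH(2), of F] by (simp add: add.commute)
  finally show ?case using le IH(2) by simp
qed simp

lemma sum_UN_le:
  fixes f :: "'b \<Rightarrow> real"
  assumes "finite I" "\<And>i. i \<in> I \<Longrightarrow> finite (A i)" "\<And>x. 0 \<le> f x"
  shows "sum f (\<Union>i\<in>I. A i) \<le> (\<Sum>i\<in>I. sum f (A i))"
  using assms(1,2)
proof (induction I rule: finite_induct)
  case (insert i I)
  have "sum f (\<Union>j\<in>insert i I. A j) + sum f (A i \<inter> (\<Union>j\<in>I. A j)) = sum f (A i) + sum f (\<Union>j\<in>I. A j)"
    using insert by (simp add: sum.union_inter)
  moreover have "0 \<le> sum f (A i \<inter> (\<Union>j\<in>I. A j))" by (rule sum_nonneg) (rule assms(3))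
  ultimately show ?case using insert by simp
qed simp

lemma finite_perms: "finite (perms :: 'n::finite list set)"
proof -
  have "perms \<subseteq> {xs :: 'n list. set xs \<subseteq> UNIV \<and> length xs = CARD('n)}"
    by (auto simp: perms_def) (metis distinct_card)
  then show ?thesis by (rule finite_subset) (rule finite_lists_length_eq, simp)
qed

lemma perms_length: "\<sigma> \<in> perms \<Longrightarrow> length (\<sigma> :: 'n::finite list) = CARD('n)"
  by (auto simp: perms_def) (metis distinct_card)

lemma dist_vec_le:
  fixes x y :: "real^'n::finite"
  assumes "\<And>c. \<bar>x $ c - y $ c\<bar> \<le> r"
  shows "dist x y \<le> real CARD('n) * r"
proof -
  have "dist x y \<le> (\<Sum>c\<in>UNIV. \<bar>(x - y) $ c\<bar>)" unfolding dist_norm by (rule norm_le_l1_cart)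
  also have "\<dots> \<le> (\<Sum>c\<in>(UNIV::'n set). r)" by (rule sum_mono) (use assms in simp)
  finally show ?thesis by simp
qed

lemma nth_dist_le: "\<bar>x $ c - y $ c\<bar> \<le> dist x (y :: real^'n::finite)"
  using component_le_norm_cart[of "x - y" c] by (simp add: dist_norm)

text \<open>Rounding to a grid of mesh \<epsilon> is injective on separated points, and only
  boundedly many cells come near \<open>z\<close>. The map \<open>f\<close> allows counting objects
  other than points, such as cubes through the centres of their boxes.\<close>

lemma grid_count:
  fixes f :: "'a \<Rightarrow> real^'n::finite"
  assumes \<epsilon>: "0 < \<epsilon>" and R: "0 \<le> R"
    and sep: "\<And>x x'. x \<in> X \<Longrightarrow> x' \<in> X \<Longrightarrow> x \<noteq> x' \<Longrightarrow> \<exists>c. \<epsilon> \<le> \<bar>f x $ c - f x' $ c\<bar>"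
    and near: "\<And>x c. x \<in> X \<Longrightarrow> \<bar>f x $ c - z $ c\<bar> \<le> R"
  shows "finite X" "real (card X) \<le> (2 * R / \<epsilon> + 2) ^ CARD('n)"
proof -
  define g where "g x = (\<lambda>c. \<lfloor>f x $ c / \<epsilon>\<rfloor>)" for x
  define I where "I c = {\<lfloor>(z $ c - R) / \<epsilon>\<rfloor>..\<lfloor>(z $ c + R) / \<epsilon>\<rfloor>}" for c
  have inj: "inj_on g X"
  proof (rule inj_onI, rule ccontr)
    fix x x' assume x: "x \<in> X" "x' \<in> X" "g x = g x'" "x \<noteq> x'"
    obtain c where c: "\<epsilon> \<le> \<bar>f x $ c - f x' $ c\<bar>" using sep[OF x(1,2,4)] by blast
    have "\<lfloor>f x $ c / \<epsilon>\<rfloor> = \<lfloor>f x' $ c / \<epsilon>\<rfloor>" using x(3) by (simp add: g_def fun_eq_iff)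
    then have "\<bar>f x $ c / \<epsilon> - f x' $ c / \<epsilon>\<bar> < 1" by linarith
    then have "\<bar>f x $ c - f x' $ c\<bar> / \<epsilon> < 1" using \<epsilon> by (simp add: diff_divide_distrib[symmetric])
    then show False using c \<epsilon> by simp
  qed
  have sub: "g ` X \<subseteq> PiE UNIV I"
  proof
    fix h assume "h \<in> g ` X"
    then obtain x where x: "x \<in> X" "h = g x" by blast
    have "\<lfloor>(z $ c - R) / \<epsilon>\<rfloor> \<le> \<lfloor>f x $ c / \<epsilon>\<rfloor> \<and> \<lfloor>f x $ c / \<epsilon>\<rfloor> \<le> \<lfloor>(z $ c + R) / \<epsilon>\<rfloor>" for c
      using near[OF x(1), of c] \<epsilon> by (intro conjI floor_mono divide_right_mono) linarith+
    then show "h \<in> PiE UNIV I" by (auto simp: x g_def I_def)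
  qed
  have fin: "finite (PiE UNIV I)" by (rule finite_PiE) (auto simp: I_def)
  then have "finite (g ` X)" using sub by (rule finite_subset[rotated])
  then show fX: "finite X" using inj by (rule finite_imageD)
  have cI: "real (card (I c)) \<le> 2 * R / \<epsilon> + 2" for c
  proof -
    have "(z $ c + R) / \<epsilon> - (z $ c - R) / \<epsilon> = 2 * R / \<epsilon>" by (simp add: diff_divide_distrib[symmetric])
    moreover have "0 \<le> 2 * R / \<epsilon>" using \<epsilon> R by simp
    ultimately show ?thesis unfolding I_def by (simp only: card_atLeastAtMost_int) linarith
  qed
  have "card X = card (g ` X)" by (simp add: card_image[OF inj])
  also have "\<dots> \<le> card (PiE UNIV I)" by (rule card_mono[OF fin sub])
  also have "\<dots> = (\<Prod>c\<in>UNIV. card (I c))" by (simp add: card_PiE)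
  finally have "real (card X) \<le> real (\<Prod>c\<in>UNIV. card (I c))" by (rule of_nat_mono)
  also have "\<dots> = (\<Prod>c\<in>UNIV. real (card (I c)))" by simp
  also have "\<dots> \<le> (\<Prod>c\<in>(UNIV::'n set). 2 * R / \<epsilon> + 2)" by (rule prod_mono) (use cI in auto)
  finally show "real (card X) \<le> (2 * R / \<epsilon> + 2) ^ CARD('n)" by simp
qed

text \<open>The sum is at most the number of terms times the largest one, and the power of the
  largest term is itself a summand. This treats exponents above and below 1 alike.\<close>

lemma sum_powr_le:
  fixes p :: "'a \<Rightarrow> real"
  assumes "finite A" "\<And>x. x \<in> A \<Longrightarrow> 0 \<le> p x" "0 \<le> q"
  shows "sum p A powr q \<le> real (card A) powr q * (\<Sum>x\<in>A. p x powr q)"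
proof (cases "A = {}")
  case False
  define m where "m = Max (p ` A)"
  have "m \<in> p ` A" unfolding m_def using assms(1) False by (intro Max_in) auto
  then obtain y where y: "y \<in> A" "m = p y" by blast
  have "sum p A \<le> real (card A) * m" by (rule sum_bounded_above) (simp add: m_def assms(1))
  then have "sum p A powr q \<le> (real (card A) * m) powr q" using assms by (intro powr_mono2) (auto intro: sum_nonneg)
  also have "\<dots> = real (card A) powr q * p y powr q" using y assms(2) by (simp add: powr_mult)
  also have "\<dots> \<le> real (card A) powr q * (\<Sum>x\<in>A. p x powr q)"
    using y assms(1) by (intro mult_left_mono member_le_sum) auto
  finally show ?thesis .
qed simp

lemma cball_disjoint_dist:
  fixes x y :: "'a::real_normed_vector"
  assumes "cball x r \<inter> cball y r = {}"
  shows "2 * r < dist x y"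
proof (rule ccontr)
  assume "\<not> ?thesis"
  then have "midpoint x y \<in> cball x r \<inter> cball y r" by (simp add: dist_midpoint dist_commute)
  then show False using assms by blast
qed

lemma centred_packing_dist:
  fixes x y :: "'a::real_normed_vector"
  assumes "centred_packing M r X" "x \<in> X" "y \<in> X" "x \<noteq> y"
  shows "2 * r < dist x y"
  using assms by (intro cball_disjoint_dist) (auto simp: centred_packing_def)

lemma tendsto_const_add_ln_over:
  fixes K1 K2 :: real
  shows "((\<lambda>s. (K1 + K2 * ln s) / s) \<longlongrightarrow> 0) at_top"
proof -
  have "((\<lambda>s. K1 / s + K2 * (ln s / s)) \<longlongrightarrow> 0 + K2 * 0) at_top"
    by (intro tendsto_add tendsto_mult tendsto_const ln_x_over_x_tendsto_0 tendsto_divide_0[OF tendsto_const]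
        filterlim_at_top_imp_at_infinity filterlim_ident)
  then show ?thesis by (simp add: add_divide_distrib)
qed

lemma tendsto_ratio_shift:
  fixes g :: "real \<Rightarrow> real"
  assumes "((\<lambda>s. g s / s) \<longlongrightarrow> P) at_top"
  shows "((\<lambda>s. g (s + b) / s) \<longlongrightarrow> P) at_top"
proof -
  have sh: "filterlim (\<lambda>s::real. s + b) at_top at_top"
    using filterlim_tendsto_add_at_top[OF tendsto_const[of b] filterlim_ident] by (simp add: add.commute)
  have "((\<lambda>s::real. 1 + b / s) \<longlongrightarrow> 1 + 0) at_top"
    by (intro tendsto_add tendsto_const tendsto_divide_0[OF tendsto_const] filterlim_at_top_imp_at_infinity filterlim_ident)
  from tendsto_mult[OF filterlim_compose[OF assms sh] this]
  have "((\<lambda>s. g (s + b) / (s + b) * (1 + b / s)) \<longlongrightarrow> P) at_top" by simp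
  moreover have "\<forall>\<^sub>F s in at_top. g (s + b) / (s + b) * (1 + b / s) = g (s + b) / s"
    using eventually_gt_at_top[of "max 0 (- b)"]
  proof eventually_elim
    case (elim s)
    then have "1 + b / s = (s + b) / s" by (simp add: add_divide_distrib)
    then show ?case using elim by simp
  qed
  ultimately show ?thesis by (rule Lim_transform_eventually)
qed

section \<open>Packings with a common radius, packing premeasures, and a Baire category
  argument\<close>

definition packs :: "'a::metric_space set \<Rightarrow> real \<Rightarrow> 'a set \<Rightarrow> bool" where
  "packs E \<delta> Y \<longleftrightarrow> finite Y \<and> Y \<subseteq> E \<and> (\<forall>x\<in>Y. \<forall>y\<in>Y. x \<noteq> y \<longrightarrow> cball x \<delta> \<inter> cball y \<delta> = {})"

lemma centred_packing_packs: "centred_packing \<nu> \<delta> Y \<longleftrightarrow> packs (msupport \<nu>) \<delta> Y"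
  by (simp add: centred_packing_def packs_def)

lemma cball_disjointI:
  fixes x y :: "'a::metric_space"
  shows "2 * r < dist x y \<Longrightarrow> cball x r \<inter> cball y r = {}"
proof (rule ccontr)
  assume d: "2 * r < dist x y" and "cball x r \<inter> cball y r \<noteq> {}"
  then obtain z where "dist x z \<le> r" "dist y z \<le> r" by auto
  then show False using d dist_triangle2[of x y z] by linarith
qed

text \<open>The radii are sorted into classes between consecutive powers of 1/e. Shrinking the balls
  of a class to the lower end gives a packing with a common radius, to which \<open>cards\<close>
  applies; the classes contribute a geometric series with ratio
  \<open>exp (- (u - t))\<close>.\<close>

lemma packing_premeasure_zero:
  fixes E :: "'a::metric_space set"
  assumes tu: "0 \<le> t" "t < u"
    and cards: "\<And>s Y. s0 \<le> s \<Longrightarrow> packs E (exp (- s)) Y \<Longrightarrow> real (card Y) \<le> exp (t * s)"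
  shows "packing_premeasure u E = 0"
proof -
  define \<rho> where "\<rho> = exp (- (u - t))"
  define K where "K = 2 powr u * exp t"
  have \<rho>: "0 < \<rho>" "\<rho> < 1" using tu by (auto simp: \<rho>_def)
  have K: "0 < K" by (simp add: K_def)
  have bound: "packing_sum_delta u (exp (- real J)) E \<le> ennreal (K * \<rho> ^ J / (1 - \<rho>))" if J: "s0 \<le> real J" for J
    unfolding packing_sum_delta_def
  proof (rule SUP_least, clarify)
    fix X :: "'a set" and r :: "'a \<Rightarrow> real"
    assume X: "X \<subseteq> E" and r: "\<forall>x\<in>X. 0 < r x \<and> r x \<le> exp (- real J)"
      and dis: "\<forall>x\<in>X. \<forall>y\<in>X. x \<noteq> y \<longrightarrow> cball x (r x) \<inter> cball y (r y) = {}"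
    define A where "A i = {x\<in>X. exp (- (real (J + i) + 1)) < r x \<and> r x \<le> exp (- real (J + i))}" for i
    \<comment> \<open>Finiteness of the class is not known beforehand, so the bound is shown for its
      finite subsets.\<close>
    have cardA: "finite (A i) \<and> card (A i) \<le> nat \<lfloor>exp (t * (real (J + i) + 1))\<rfloor>" for i
    proof (rule finite_if_finite_subsets_card_bdd)
      fix Y assume Y: "Y \<subseteq> A i" "finite Y"
      have "packs E (exp (- (real (J + i) + 1))) Y"
        unfolding packs_def
      proof (intro conjI ballI impI)
        show "finite Y" by (rule Y(2))
        show "Y \<subseteq> E" using Y(1) X by (auto simp: A_def)
        fix x y assume xy: "x \<in> Y" "y \<in> Y" "x \<noteq> y"
        have "x \<in> A i" "y \<in> A i" using xy Y by auto
        then have "cball x (exp (- (real (J + i) + 1))) \<subseteq> cball x (r x)" "cball y (exp (- (real (J + i) + 1))) \<subseteq> cball y (r y)"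
          "x \<in> X" "y \<in> X" by (auto simp: A_def)
        then show "cball x (exp (- (real (J + i) + 1))) \<inter> cball y (exp (- (real (J + i) + 1))) = {}" using dis xy(3) by blast
      qed
      from cards[OF _ this] J have "real (card Y) \<le> exp (t * (real (J + i) + 1))" by simp
      then show "card Y \<le> nat \<lfloor>exp (t * (real (J + i) + 1))\<rfloor>" by (simp add: le_nat_floor)
    qed
    define cc where "cc i = (2 * exp (- real (J + i))) powr u" for i
    have pt: "ennreal ((2 * r x) powr u) \<le> (\<Sum>i. ennreal (cc i) * indicator (A i) x)" if x: "x \<in> X" for x
    proof -
      have rx: "0 < r x" "r x \<le> exp (- real J)" using r x by auto
      then have lnr: "real J \<le> - ln (r x)" using ln_le_cancel_iff[of "r x" "exp (- real J)"] by simp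
      \<comment> \<open>The class of \<open>x\<close> is read off from the integer part of
        \<open>- ln (r x)\<close>.\<close>
      define i where "i = nat \<lfloor>- ln (r x)\<rfloor> - J"
      have i: "real (J + i) \<le> - ln (r x)" "- ln (r x) < real (J + i) + 1"
        unfolding i_def using lnr by linarith+
      have e: "r x = exp (- (- ln (r x)))" using rx by simp
      have "r x \<le> exp (- real (J + i))" by (subst e) (use i in simp)
      moreover have "exp (- (real (J + i) + 1)) < r x" by (subst e) (use i in simp)
      ultimately have xA: "x \<in> A i" using x by (simp add: A_def)
      have "(2 * r x) powr u \<le> cc i" unfolding cc_def using \<open>r x \<le> exp (- real (J + i))\<close> rx tu by (intro powr_mono2) auto
      then have "ennreal ((2 * r x) powr u) \<le> ennreal (cc i) * indicator (A i) x" using xA by (simp add: ennreal_leI)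
      also have "\<dots> \<le> (\<Sum>i. ennreal (cc i) * indicator (A i) x)"
        using sum_le_suminf[of "\<lambda>i. ennreal (cc i) * indicator (A i) x" "{i}"]
        by (simp only: sum.insert sum.empty finite.intros summableI zero_le simp_thms empty_iff add_0_right)
      finally show ?thesis .
    qed
    have "(\<integral>\<^sup>+ x. ennreal ((2 * r x) powr u) \<partial>count_space X) \<le> (\<integral>\<^sup>+ x. (\<Sum>i. ennreal (cc i) * indicator (A i) x) \<partial>count_space X)"
      by (rule nn_integral_mono) (use pt in simp)
    also have "\<dots> = (\<Sum>i. \<integral>\<^sup>+ x. ennreal (cc i) * indicator (A i) x \<partial>count_space X)"
      by (rule nn_integral_suminf) simp
    also have "\<dots> = (\<Sum>i. ennreal (cc i) * emeasure (count_space X) (A i))"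
      by (subst nn_integral_cmult_indicator) (auto simp: A_def)
    also have "\<dots> = (\<Sum>i. ennreal (cc i * real (card (A i))))"
    proof (rule arg_cong[where f = suminf], rule ext)
      fix i
      have "emeasure (count_space X) (A i) = ennreal (real (card (A i)))"
        using cardA[of i] by (subst emeasure_count_space) (auto simp: A_def ennreal_of_nat_eq_real_of_nat)
      then show "ennreal (cc i) * emeasure (count_space X) (A i) = ennreal (cc i * real (card (A i)))"
        by (simp add: ennreal_mult cc_def)
    qed
    also have "\<dots> \<le> (\<Sum>i. ennreal (K * \<rho> ^ J * \<rho> ^ i))"
    proof (intro suminf_le ennreal_leI)
      fix i
      have "real (card (A i)) \<le> real (nat \<lfloor>exp (t * (real (J + i) + 1))\<rfloor>)" using cardA[of i] by (intro of_nat_mono) blast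
      also have "\<dots> \<le> exp (t * (real (J + i) + 1))" by simp
      finally have "cc i * real (card (A i)) \<le> cc i * exp (t * (real (J + i) + 1))" by (intro mult_left_mono) (auto simp: cc_def)
      also have "\<dots> = 2 powr u * exp (- (u * real (J + i))) * exp (t * (real (J + i) + 1))"
        by (simp add: cc_def powr_mult exp_powr_real algebra_simps)
      also have "\<dots> = K * exp (real (J + i) * (- (u - t)))"
        by (simp add: K_def exp_add[symmetric] algebra_simps)
      also have "\<dots> = K * \<rho> ^ J * \<rho> ^ i" by (simp only: exp_of_nat_mult \<rho>_def[symmetric] power_add mult.assoc)
      finally show "cc i * real (card (A i)) \<le> K * \<rho> ^ J * \<rho> ^ i" .
    qed auto
    also have "\<dots> = ennreal (K * \<rho> ^ J * (1 / (1 - \<rho>)))"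
      using \<rho> K by (intro suminf_ennreal_eq sums_mult geometric_sums) auto
    finally show "(\<integral>\<^sup>+ x. ennreal ((2 * r x) powr u) \<partial>count_space X) \<le> ennreal (K * \<rho> ^ J / (1 - \<rho>))" by simp
  qed
  have "packing_premeasure u E \<le> 0"
  proof (rule ennreal_le_epsilon)
    fix e :: real assume e: "0 < e"
    have "(\<lambda>J. K * \<rho> ^ J / (1 - \<rho>)) \<longlonglongrightarrow> K * 0 / (1 - \<rho>)"
      using \<rho> by (intro tendsto_intros LIMSEQ_realpow_zero) auto
    then have "\<forall>\<^sub>F J in sequentially. K * \<rho> ^ J / (1 - \<rho>) < e" using order_tendstoD(2) e by fastforce
    moreover have "\<forall>\<^sub>F J in sequentially. s0 \<le> real J"
      using eventually_ge_at_top[of "nat \<lceil>s0\<rceil>"] by eventually_elim linarith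
    ultimately have "\<forall>\<^sub>F J in sequentially. K * \<rho> ^ J / (1 - \<rho>) < e \<and> s0 \<le> real J" by (rule eventually_conj)
    then obtain J where J: "K * \<rho> ^ J / (1 - \<rho>) < e" "s0 \<le> real J" using eventually_happens'[OF sequentially_bot] by blast
    have "packing_premeasure u E \<le> packing_sum_delta u (exp (- real J)) E"
      unfolding packing_premeasure_def by (rule INF_lower) simp
    also have "\<dots> \<le> ennreal (K * \<rho> ^ J / (1 - \<rho>))" by (rule bound[OF J(2)])
    also have "\<dots> \<le> 0 + ennreal e" using J(1) by (simp add: ennreal_leI)
    finally show "packing_premeasure u E \<le> 0 + ennreal e" .
  qed
  then show ?thesis by simp
qed

lemma packing_measure_zero:
  assumes "packing_premeasure u E = 0"
  shows "packing_measure u E = 0"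
proof -
  have e: "packing_premeasure u ({} :: 'a set) = 0"
  proof -
    have "packing_sum_delta u 1 ({} :: 'a set) \<le> 0"
      unfolding packing_sum_delta_def by (rule SUP_least) (auto simp: nn_integral_count_space_finite)
    moreover have "packing_premeasure u ({} :: 'a set) \<le> packing_sum_delta u 1 ({} :: 'a set)"
      unfolding packing_premeasure_def by (rule INF_lower) simp
    ultimately show ?thesis by (metis le_zero_eq)
  qed
  have "packing_measure u E \<le> (\<Sum>i. packing_premeasure u (if i = (0::nat) then E else {}))"
    unfolding packing_measure_def by (rule INF_lower2[of "\<lambda>i. if i = 0 then E else {}"]) auto
  also have "(\<lambda>i::nat. packing_premeasure u (if i = 0 then E else {})) = (\<lambda>_. 0)" using assms e by auto
  finally show ?thesis by simp
qed

text \<open>Otherwise every \<open>F - closure (E i)\<close> would be relatively open and dense in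
  \<open>F\<close>; their intersection would be dense by Baire, but it is empty because the
  \<open>E i\<close> cover \<open>F\<close>.\<close>

lemma Baire_cover:
  fixes F :: "'a::{real_normed_vector,heine_borel} set" and E :: "nat \<Rightarrow> 'a set"
  assumes "closed F" "F \<noteq> {}" "F \<subseteq> (\<Union>i. E i)"
  obtains i x e where "x \<in> F" "0 < e" "ball x e \<inter> F \<subseteq> closure (E i)"
proof (rule ccontr)
  assume no: "\<not> thesis"
  have "F \<subseteq> closure (\<Inter>(range (\<lambda>i. F - closure (E i))))"
  proof (rule Baire[OF assms(1)])
    show "countable (range (\<lambda>i. F - closure (E i)))" by simp
    fix T assume "T \<in> range (\<lambda>i. F - closure (E i))"
    then obtain i where T: "T = F - closure (E i)" by blast
    have "openin (top_of_set F) T"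
      unfolding T by (auto simp: openin_open intro!: exI[of _ "- closure (E i)"])
    moreover have "F \<subseteq> closure T"
    proof
      fix x assume x: "x \<in> F"
      show "x \<in> closure T" unfolding closure_approachable
      proof (intro allI impI)
        fix e :: real assume e: "0 < e"
        have "\<not> ball x e \<inter> F \<subseteq> closure (E i)" using that x e no by blast
        then show "\<exists>y\<in>T. dist y x < e" by (auto simp: T dist_commute)
      qed
    qed
    ultimately show "openin (top_of_set F) T \<and> F \<subseteq> closure T" by blast
  qed
  moreover have "\<Inter>(range (\<lambda>i. F - closure (E i))) = {}"
  proof (rule ccontr)
    assume "\<not> ?thesis"
    then obtain y where y: "\<And>i. y \<in> F - closure (E i)" by auto
    then obtain i where "y \<in> E i" using assms(3) by blast
    then show False using y[of i] closure_subset[of "E i"] by blast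
  qed
  ultimately show False using assms(2) by (metis closure_empty subset_empty)
qed

section \<open>Levels, cylinders and the coding map\<close>

locale self_affine_sponge =
  fixes N :: nat
    and a :: "nat \<Rightarrow> 'n::{finite,linorder} \<Rightarrow> real"
    and t :: "nat \<Rightarrow> real^'n::{finite,linorder}"
    and \<mu> :: "nat \<Rightarrow> real"
  assumes sponge: "sponge_system N a t"
    and sppc: "SPPC N a t"
    and mu_pos: "\<forall>i\<in>Idx N. \<mu> i > 0"
    and mu_sum: "(\<Sum>i\<in>Idx N. \<mu> i) = 1"
begin

text \<open>Equality of the one-dimensional maps. Exact overlap on a span of axes is agreement in
  all its coordinates, see \<open>overlap_iff\<close>.\<close>

definition agree :: "'n \<Rightarrow> nat \<Rightarrow> nat \<Rightarrow> bool" where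
  "agree c i j \<longleftrightarrow> a i c = a j c \<and> t i $ c = t j $ c"

definition h :: "nat \<Rightarrow> 'n \<Rightarrow> real" where
  "h i c = - ln \<bar>a i c\<bar>"

definition hmin :: real where "hmin = Min ((\<lambda>(i,c). h i c) ` (Idx N \<times> UNIV))"
definition hmax :: real where "hmax = Max ((\<lambda>(i,c). h i c) ` (Idx N \<times> UNIV))"
definition mumin :: real where "mumin = Min (\<mu> ` Idx N)"

text \<open>Minus the logarithm of the contraction ratio of the first \<open>k\<close> letters in
  coordinate \<open>c\<close>, hence additive in the letters.\<close>

definition tau :: "(nat \<Rightarrow> nat) \<Rightarrow> 'n \<Rightarrow> nat \<Rightarrow> real" where
  "tau w c k = (\<Sum>l<k. h (w l) c)"

text \<open>The scale is \<open>\<delta> = e\<^sup>-\<^sup>s\<close>, so \<open>lev s w c\<close> is \<open>L\<^sub>\<delta>(w, c)\<close>.\<close>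
definition lev :: "real \<Rightarrow> (nat \<Rightarrow> nat) \<Rightarrow> 'n \<Rightarrow> nat" where
  "lev s w c = (LEAST k. s \<le> tau w c k)"

text \<open>The depth may vary with the coordinate: cubes, their intersections with other cylinders,
  and cylinders with rounded depths are all of this form.\<close>

definition cyl :: "(nat \<Rightarrow> nat) \<Rightarrow> ('n \<Rightarrow> nat) \<Rightarrow> (nat \<Rightarrow> nat) set" where
  "cyl w M = {v \<in> words N. \<forall>c. \<forall>l<M c. agree c (v l) (w l)}"

lemma agree_refl [simp]: "agree c i i"
  by (simp add: agree_def)

lemma agree_sym: "agree c i j \<Longrightarrow> agree c j i"
  by (simp add: agree_def)

lemma agree_trans: "agree c i j \<Longrightarrow> agree c j k \<Longrightarrow> agree c i k"
  by (simp add: agree_def)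

lemma h_agree: "agree c i j \<Longrightarrow> h i c = h j c"
  by (simp add: agree_def h_def)

lemma N_pos: "N \<ge> 1"
  using sponge by (simp add: sponge_system_def)

lemma finite_Idx [simp]: "finite (Idx N)"
  by (simp add: Idx_def)

lemma Idx_nonempty: "Idx N \<noteq> {}"
  using N_pos by (simp add: Idx_def)

lemma card_Idx [simp]: "card (Idx N) = N"
  by (simp add: Idx_def)

lemma abs_a: "i \<in> Idx N \<Longrightarrow> 0 < \<bar>a i c\<bar> \<and> \<bar>a i c\<bar> < 1"
  using sponge by (simp add: sponge_system_def)

lemma a_nz: "i \<in> Idx N \<Longrightarrow> a i c \<noteq> 0"
  using abs_a[of i c] by auto

lemma h_pos: "i \<in> Idx N \<Longrightarrow> h i c > 0"
  using abs_a[of i c] by (simp add: h_def)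

lemma exp_minus_h: "i \<in> Idx N \<Longrightarrow> exp (- h i c) = \<bar>a i c\<bar>"
  using abs_a[of i c] by (simp add: h_def)

lemma hmin_le: "i \<in> Idx N \<Longrightarrow> hmin \<le> h i c"
  unfolding hmin_def by (rule Min_le) (auto simp: image_iff intro!: bexI[of _ "(i,c)"])

lemma hmax_ge: "i \<in> Idx N \<Longrightarrow> h i c \<le> hmax"
  unfolding hmax_def by (rule Max_ge) (auto simp: image_iff intro!: bexI[of _ "(i,c)"])

lemma hmin_pos: "hmin > 0"
proof -
  have "hmin \<in> ((\<lambda>(i,c). h i c) ` (Idx N \<times> UNIV))"
    unfolding hmin_def by (rule Min_in) (use Idx_nonempty in auto)
  then show ?thesis using h_pos by auto
qed

lemma hmin_le_hmax: "hmin \<le> hmax"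
proof -
  obtain i where "i \<in> Idx N" using Idx_nonempty by auto
  then show ?thesis using hmin_le[of i undefined] hmax_ge[of i undefined] by linarith
qed

lemma hmax_pos: "hmax > 0"
  using hmin_pos hmin_le_hmax by linarith

lemma mumin_le: "i \<in> Idx N \<Longrightarrow> mumin \<le> \<mu> i"
  unfolding mumin_def by (rule Min_le) auto

lemma mumin_pos: "mumin > 0"
proof -
  have "mumin \<in> \<mu> ` Idx N" unfolding mumin_def by (rule Min_in) (use Idx_nonempty in auto)
  then show ?thesis using mu_pos by auto
qed

lemma mu_le_1: "i \<in> Idx N \<Longrightarrow> \<mu> i \<le> 1"
  using member_le_sum[of i "Idx N" \<mu>] mu_pos mu_sum by (simp add: less_imp_le)

lemma mumin_le_1: "mumin \<le> 1"
proof -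
  obtain i where "i \<in> Idx N" using Idx_nonempty by auto
  then show ?thesis using mumin_le mu_le_1 by force
qed

lemma wordsD: "w \<in> words N \<Longrightarrow> w l \<in> Idx N"
  by (simp add: words_def)

lemma tau_0 [simp]: "tau w c 0 = 0"
  by (simp add: tau_def)

lemma tau_Suc: "tau w c (Suc k) = tau w c k + h (w k) c"
  by (simp add: tau_def)

lemma tau_cong: "(\<And>l. l < k \<Longrightarrow> agree c (v l) (w l)) \<Longrightarrow> tau v c k = tau w c k"
  unfolding tau_def by (rule sum.cong) (auto intro: h_agree)

lemma tau_diff:
  assumes "w \<in> words N" "k \<le> k'"
  shows "real (k' - k) * hmin \<le> tau w c k' - tau w c k" "tau w c k' - tau w c k \<le> real (k' - k) * hmax"
proof -
  have eq: "tau w c k' - tau w c k = (\<Sum>l=k..<k'. h (w l) c)"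
    unfolding tau_def using assms(2) sum_diff_nat_ivl[of 0 k k' "\<lambda>l. h (w l) c"]
    by (simp add: atLeast0LessThan)
  show "real (k' - k) * hmin \<le> tau w c k' - tau w c k"
    unfolding eq using sum_bounded_below[of "{k..<k'}" hmin "\<lambda>l. h (w l) c"] hmin_le wordsD[OF assms(1)] by simp
  show "tau w c k' - tau w c k \<le> real (k' - k) * hmax"
    unfolding eq using sum_bounded_above[of "{k..<k'}" "\<lambda>l. h (w l) c" hmax] hmax_ge wordsD[OF assms(1)] by simp
qed

lemma tau_bounds:
  assumes "w \<in> words N"
  shows "real k * hmin \<le> tau w c k" "tau w c k \<le> real k * hmax"
  using tau_diff[OF assms, of 0 k c] by auto

text \<open>Every letter adds at least \<open>hmin\<close>, so control of \<open>tau\<close> is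
  control of positions.\<close>

lemma tau_index_dist:
  assumes "w \<in> words N" "\<bar>tau w c k - tau w c k'\<bar> \<le> D"
  shows "\<bar>real k - real k'\<bar> \<le> D / hmin"
proof (cases "k \<le> k'")
  case True
  then show ?thesis using tau_diff(1)[OF assms(1) True, of c] assms(2) hmin_pos
    by (simp add: field_simps of_nat_diff)
next
  case False
  then have "k' \<le> k" by simp
  then show ?thesis using tau_diff(1)[OF assms(1) \<open>k' \<le> k\<close>, of c] assms(2) hmin_pos
    by (simp add: field_simps of_nat_diff)
qed

lemma tau_unbounded: assumes "w \<in> words N" shows "\<exists>k. s \<le> tau w c k"
proof -
  obtain k :: nat where "s / hmin \<le> real k" using real_arch_simple by blast
  then have "s \<le> real k * hmin" using hmin_pos by (simp add: field_simps)
  then show ?thesis using tau_bounds(1)[OF assms, of k c] by (intro exI[of _ k]) linarith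
qed

lemma lev_ge: "w \<in> words N \<Longrightarrow> s \<le> tau w c (lev s w c)"
  unfolding lev_def by (rule LeastI_ex[OF tau_unbounded])

lemma lev_le: "s \<le> tau w c k \<Longrightarrow> lev s w c \<le> k"
  unfolding lev_def by (rule Least_le)

lemma lev_less: "k < lev s w c \<Longrightarrow> tau w c k < s"
  using lev_le[of s w c k] by (meson leD leI)

lemma lev_tau_upper:
  assumes "w \<in> words N" "0 \<le> s"
  shows "tau w c (lev s w c) \<le> s + hmax"
proof (cases "lev s w c")
  case 0
  then show ?thesis using assms hmax_pos by simp
next
  case (Suc k)
  then have "tau w c k < s" by (intro lev_less) simp
  moreover have "h (w k) c \<le> hmax" by (rule hmax_ge[OF wordsD[OF assms(1)]])
  ultimately show ?thesis by (simp add: Suc tau_Suc)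
qed

text \<open>The level is a stopping time: whether \<open>tau\<close> has reached \<open>s\<close> is
  decided by the letters read so far. This is why cubes at one scale are equal or disjoint.\<close>

lemma lev_cong:
  assumes w: "w \<in> words N" and ag: "\<And>l. l < lev s w c \<Longrightarrow> agree c (v l) (w l)"
  shows "lev s v c = lev s w c"
proof -
  have eq: "tau v c k = tau w c k" if "k \<le> lev s w c" for k
    by (rule tau_cong) (use that ag in auto)
  have "lev s v c \<le> lev s w c" using lev_ge[OF w, of s c] eq[of "lev s w c"] by (intro lev_le) simp
  moreover have "\<not> s \<le> tau v c k" if "k < lev s w c" for k
    using eq[of k] that lev_less[OF that] by simp
  ultimately show ?thesis
    by (metis antisym_conv2 eq le_refl lev_def LeastI lev_ge[OF w])
qed

lemma lev_upper:
  assumes "w \<in> words N" "0 \<le> s"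
  shows "real (lev s w c) \<le> (s + hmax) / hmin"
  using tau_bounds(1)[OF assms(1), of "lev s w c" c] lev_tau_upper[OF assms, of c] hmin_pos
  by (simp add: field_simps)

text \<open>The device for locating the level of a modified word: guess a position, estimate
  \<open>tau\<close> there, and the level is close to the guess.\<close>

lemma lev_dist:
  assumes "w \<in> words N" "0 \<le> s" "\<bar>tau w c k - s\<bar> \<le> D"
  shows "\<bar>real k - real (lev s w c)\<bar> \<le> (D + hmax) / hmin"
  using lev_ge[OF assms(1), of s c] lev_tau_upper[OF assms(1,2), of c] assms(3)
  by (intro tau_index_dist[OF assms(1), where c = c]) linarith

lemma cyl_refl [simp]: "w \<in> words N \<Longrightarrow> w \<in> cyl w M"
  by (simp add: cyl_def)

lemma cyl_words: "v \<in> cyl w M \<Longrightarrow> v \<in> words N"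
  by (simp add: cyl_def)

lemma cyl_eq: "v \<in> cyl w M \<Longrightarrow> cyl v M = cyl w M"
  unfolding cyl_def using agree_sym agree_trans by blast

lemma cyl_lev: "w \<in> words N \<Longrightarrow> v \<in> cyl w (lev s w) \<Longrightarrow> lev s v = lev s w"
  by (rule ext, rule lev_cong) (auto simp: cyl_def)

section \<open>The one-dimensional coordinate maps and the coding map\<close>

primrec cmap :: "(nat \<Rightarrow> nat) \<Rightarrow> 'n \<Rightarrow> nat \<Rightarrow> real \<Rightarrow> real" where
  "cmap w c 0 x = x"
| "cmap w c (Suc k) x = cmap w c k (a (w k) c * x + t (w k) $ c)"

definition slope :: "(nat \<Rightarrow> nat) \<Rightarrow> 'n \<Rightarrow> nat \<Rightarrow> real" where
  "slope w c k = (\<Prod>l<k. a (w l) c)"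

definition shift :: "nat \<Rightarrow> (nat \<Rightarrow> nat) \<Rightarrow> nat \<Rightarrow> nat" where
  "shift k w = (\<lambda>l. w (k + l))"

lemma shift_words: "w \<in> words N \<Longrightarrow> shift k w \<in> words N"
  by (simp add: words_def shift_def)

lemma comp_first_nth: "comp_first a t k w x $ c = cmap w c k (x $ c)"
  by (induction k arbitrary: x) (auto simp: fmap_def)

lemma cmap_affine: "cmap w c k x = cmap w c k 0 + slope w c k * x"
proof (induction k arbitrary: x)
  case (Suc k)
  have "cmap w c (Suc k) x = cmap w c k 0 + slope w c k * (a (w k) c * x + t (w k) $ c)"
    by (simp add: Suc[of "a (w k) c * x + t (w k) $ c"])
  moreover have "cmap w c (Suc k) 0 = cmap w c k 0 + slope w c k * t (w k) $ c"
    by (simp add: Suc[of "t (w k) $ c"])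
  ultimately show ?case by (simp add: slope_def algebra_simps)
qed (simp add: slope_def)

lemma abs_slope: "w \<in> words N \<Longrightarrow> \<bar>slope w c k\<bar> = exp (- tau w c k)"
  by (induction k) (auto simp: slope_def tau_Suc exp_add exp_diff abs_mult exp_minus_h[OF wordsD, symmetric] exp_minus field_simps)

lemma slope_nz: "w \<in> words N \<Longrightarrow> slope w c k \<noteq> 0"
  using abs_slope[of w c k] by auto

lemma cmap_diff: "cmap w c k x - cmap w c k y = slope w c k * (x - y)"
  using cmap_affine[of w c k x] cmap_affine[of w c k y] by (simp add: algebra_simps)

lemma cmap_cong: "(\<And>l. l < k \<Longrightarrow> agree c (v l) (w l)) \<Longrightarrow> cmap v c k x = cmap w c k x"
  by (induction k arbitrary: x) (auto simp: agree_def)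

lemma cmap_add: "cmap w c (k + j) x = cmap w c k (cmap (shift k w) c j x)"
  by (induction j arbitrary: x) (auto simp: shift_def)

text \<open>Since the matrices are diagonal, the inclusion of cubes can be tested on vectors with
  equal entries.\<close>

lemma fmap_interval:
  assumes "i \<in> Idx N" "0 \<le> x" "x \<le> 1"
  shows "0 \<le> a i c * x + t i $ c \<and> a i c * x + t i $ c \<le> 1"
proof -
  have "fmap a t i ` unitcube \<subseteq> unitcube" using sponge assms(1) by (simp add: sponge_system_def)
  moreover have "(\<chi> c. x) \<in> unitcube" using assms by (simp add: unitcube_def)
  ultimately have "fmap a t i (\<chi> c. x) \<in> unitcube" by blast
  then show ?thesis by (simp add: unitcube_def fmap_def)
qed

lemma fmap_open_interval:
  assumes "i \<in> Idx N" "0 < x" "x < 1"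
  shows "0 < a i c * x + t i $ c \<and> a i c * x + t i $ c < 1"
proof -
  have 0: "0 \<le> t i $ c" "t i $ c \<le> 1" using fmap_interval[OF assms(1), of 0 c] by auto
  have 1: "0 \<le> a i c + t i $ c" "a i c + t i $ c \<le> 1" using fmap_interval[OF assms(1), of 1 c] by auto
  show ?thesis
  proof (cases "a i c > 0")
    case True
    then have "0 < a i c * x" "a i c * x < a i c" using assms by (auto simp: mult_less_cancel_left2)
    then show ?thesis using 0 1 by linarith
  next
    case False
    then have "a i c < 0" using a_nz[OF assms(1), of c] by simp
    then have "a i c * x < 0" "a i c < a i c * x" using assms by (auto simp: mult_less_0_iff mult_less_cancel_left1)
    then show ?thesis using 0 1 by linarith
  qed
qed

lemma cmap_interval:
  assumes "w \<in> words N" "0 \<le> x" "x \<le> 1"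
  shows "0 \<le> cmap w c k x \<and> cmap w c k x \<le> 1"
  using assms(2,3) by (induction k arbitrary: x) (auto simp: fmap_interval[OF wordsD[OF assms(1)]])

lemma cmap_open_interval:
  assumes "w \<in> words N" "0 < x" "x < 1"
  shows "0 < cmap w c k x \<and> cmap w c k x < 1"
  using assms(2,3) by (induction k arbitrary: x) (auto simp: fmap_open_interval[OF wordsD[OF assms(1)]])

lemma cmap_convergent:
  assumes "w \<in> words N"
  shows "convergent (\<lambda>k. cmap w c k 0)"
proof -
  have sum: "cmap w c k 0 = (\<Sum>l<k. slope w c l * t (w l) $ c)" for k
  proof (induction k)
    case (Suc k)
    have "cmap w c (Suc k) 0 = cmap w c k (t (w k) $ c)" by simp
    also have "\<dots> = cmap w c k 0 + slope w c k * t (w k) $ c" by (rule cmap_affine)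
    finally show ?case using Suc by simp
  qed simp
  have "summable (\<lambda>l. slope w c l * t (w l) $ c)"
  proof (rule summable_comparison_test')
    show "summable (\<lambda>l. exp (- hmin) ^ l)" using hmin_pos by (intro summable_geometric) simp
    fix l :: nat
    have "\<bar>t (w l) $ c\<bar> \<le> 1" using fmap_interval[OF wordsD[OF assms], of 0 l c] by auto
    moreover have "\<bar>slope w c l\<bar> \<le> exp (- hmin) ^ l"
      using tau_bounds(1)[OF assms, of l c] by (simp add: abs_slope[OF assms] exp_of_nat_mult[symmetric])
    ultimately show "norm (slope w c l * t (w l) $ c) \<le> exp (- hmin) ^ l"
      using mult_mono[of "\<bar>slope w c l\<bar>" "exp (- hmin) ^ l" "\<bar>t (w l) $ c\<bar>" 1] by (simp add: abs_mult)
  qed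
  then show ?thesis unfolding sum by (rule summable_iff_convergent[THEN iffD1])
qed

lemma cmap_tendsto_coding:
  assumes "w \<in> words N"
  shows "(\<lambda>k. cmap w c k 0) \<longlonglongrightarrow> coding a t w $ c"
proof -
  have "(\<lambda>k. comp_first a t k w 0) \<longlonglongrightarrow> (\<chi> c. lim (\<lambda>k. cmap w c k 0))"
    by (rule vec_tendstoI) (use cmap_convergent[OF assms] in \<open>simp add: comp_first_nth convergent_LIMSEQ_iff\<close>)
  then have "(\<lambda>k. comp_first a t k w 0) \<longlonglongrightarrow> coding a t w" unfolding coding_def by (metis limI)
  from tendsto_vec_nth[OF this, of c] show ?thesis by (simp add: comp_first_nth)
qed

text \<open>The first \<open>k\<close> maps compose to an affine, hence continuous map, so the limit
  may be taken inside.\<close>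

lemma coding_shift:
  assumes "w \<in> words N"
  shows "coding a t w $ c = cmap w c k (coding a t (shift k w) $ c)"
proof (rule LIMSEQ_unique)
  show "(\<lambda>j. cmap w c (j + k) 0) \<longlonglongrightarrow> coding a t w $ c"
    by (rule LIMSEQ_ignore_initial_segment[OF cmap_tendsto_coding[OF assms]])
  have "(\<lambda>j. cmap w c k 0 + slope w c k * cmap (shift k w) c j 0) \<longlonglongrightarrow> cmap w c k 0 + slope w c k * coding a t (shift k w) $ c"
    by (intro tendsto_intros cmap_tendsto_coding shift_words assms)
  then show "(\<lambda>j. cmap w c (j + k) 0) \<longlonglongrightarrow> cmap w c k (coding a t (shift k w) $ c)"
    by (simp add: cmap_affine[of w c k, symmetric] cmap_add add.commute[of _ k])
qed

lemma coding_interval: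
  assumes "w \<in> words N"
  shows "0 \<le> coding a t w $ c \<and> coding a t w $ c \<le> 1"
  using LIMSEQ_le_const[OF cmap_tendsto_coding[OF assms], of 0 c]
    LIMSEQ_le_const2[OF cmap_tendsto_coding[OF assms], of c 1] cmap_interval[OF assms, of 0 c] by auto

lemma coding_dist:
  assumes "v \<in> words N" "w \<in> words N" "\<And>l. l < k \<Longrightarrow> agree c (v l) (w l)"
  shows "\<bar>coding a t v $ c - coding a t w $ c\<bar> \<le> exp (- tau w c k)"
proof -
  have "coding a t v $ c - coding a t w $ c = cmap w c k (coding a t (shift k v) $ c) - cmap w c k (coding a t (shift k w) $ c)"
    using coding_shift[OF assms(1), of c k] coding_shift[OF assms(2), of c k] cmap_cong[of k c v w] assms(3) by simp
  also have "\<dots> = slope w c k * (coding a t (shift k v) $ c - coding a t (shift k w) $ c)" by (rule cmap_diff)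
  finally have "\<bar>coding a t v $ c - coding a t w $ c\<bar> = exp (- tau w c k) * \<bar>coding a t (shift k v) $ c - coding a t (shift k w) $ c\<bar>"
    by (simp add: abs_mult abs_slope[OF assms(2)])
  also have "\<dots> \<le> exp (- tau w c k) * 1"
    using coding_interval[OF shift_words[OF assms(1)], of k c] coding_interval[OF shift_words[OF assms(2)], of k c]
    by (intro mult_left_mono) auto
  finally show ?thesis by simp
qed

section \<open>Cylinder weights and approximate cubes\<close>

definition Bern :: "(nat \<Rightarrow> nat) measure" where
  "Bern = PiM UNIV (\<lambda>_::nat. point_measure (Idx N) (\<lambda>i. ennreal (\<mu> i)))"

definition weight :: "(nat \<Rightarrow> nat) \<Rightarrow> ('n \<Rightarrow> nat) \<Rightarrow> real" where
  "weight w M = measure Bern (cyl w M)"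

text \<open>For \<open>A\<close> the first \<open>n\<close> coordinates of an ordering this is the
  projected weight, see \<open>mu_proj_mass\<close>. Indexing by sets of coordinates makes the
  product formula for weights independent of orderings.\<close>

definition mass :: "'n set \<Rightarrow> nat \<Rightarrow> real" where
  "mass A i = (\<Sum>j\<in>{j\<in>Idx N. \<forall>c\<in>A. agree c j i}. \<mu> j)"

lemma prob_space_letter: "prob_space (point_measure (Idx N) (\<lambda>i. ennreal (\<mu> i)))"
proof
  have "emeasure (point_measure (Idx N) (\<lambda>i. ennreal (\<mu> i))) (Idx N) = ennreal (\<Sum>i\<in>Idx N. \<mu> i)"
    using mu_pos by (subst emeasure_point_measure_finite) (auto intro!: sum_ennreal less_imp_le)
  then show "emeasure (point_measure (Idx N) (\<lambda>i. ennreal (\<mu> i)))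
     (space (point_measure (Idx N) (\<lambda>i. ennreal (\<mu> i)))) = 1"
    by (simp add: space_point_measure mu_sum)
qed

lemma product_prob_space_words:
  "product_prob_space (\<lambda>_::nat. point_measure (Idx N) (\<lambda>i. ennreal (\<mu> i)))"
  by (rule product_prob_spaceI) (rule prob_space_letter)

lemma prob_space_Bern: "prob_space Bern"
  unfolding Bern_def by (rule prob_space_PiM) (rule prob_space_letter)

sublocale Bern: prob_space Bern
  by (rule prob_space_Bern)

lemma space_Bern: "space Bern = words N"
  by (auto simp: Bern_def space_PiM space_point_measure words_def PiE_def Pi_def)

lemma cyl_eq_emb:
  assumes "\<And>c. M c \<le> K"
  shows "cyl w M = {v\<in>space Bern. \<forall>l\<in>{..<K}. v l \<in> {j\<in>Idx N. \<forall>c\<in>{c. l < M c}. agree c j (w l)}}"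
proof -
  have "l < K" if "l < M c" for l c using assms[of c] that by simp
  then show ?thesis by (auto simp: space_Bern cyl_def words_def)
qed

lemma M_le_sum: "M c \<le> (\<Sum>c\<in>(UNIV::'n set). M c :: nat)"
  by (rule member_le_sum) auto

lemma sets_letter: "sets (point_measure (Idx N) f) = Pow (Idx N)"
  by (simp add: sets_point_measure)

text \<open>A cylinder restricts the letter at each position separately, by agreement in the
  coordinates still active there. Any common bound \<open>K\<close> of the depths will do, since a
  position with no active coordinate contributes the factor 1.\<close>

lemma weight_prod:
  assumes "\<And>c. M c \<le> K"
  shows "weight w M = (\<Prod>l<K. mass {c. l < M c} (w l))"
proof -
  interpret product_prob_space "\<lambda>_::nat. point_measure (Idx N) (\<lambda>i. ennreal (\<mu> i))" "UNIV :: nat set"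
    by (rule product_prob_space_words)
  define X where "X l = {j\<in>Idx N. \<forall>c\<in>{c. l < M c}. agree c j (w l)}" for l
  have "emeasure Bern (cyl w M) = emeasure Bern {v\<in>space Bern. \<forall>l\<in>{..<K}. v l \<in> X l}"
    unfolding X_def using cyl_eq_emb[of M K w] assms by simp
  also have "\<dots> = (\<Prod>l<K. emeasure (point_measure (Idx N) (\<lambda>i. ennreal (\<mu> i))) (X l))"
    unfolding Bern_def by (rule emeasure_PiM_Collect) (auto simp: sets_letter X_def)
  also have "\<dots> = (\<Prod>l<K. ennreal (mass {c. l < M c} (w l)))"
  proof (rule prod.cong[OF refl])
    fix l
    have "emeasure (point_measure (Idx N) (\<lambda>i. ennreal (\<mu> i))) (X l) = (\<Sum>j\<in>X l. ennreal (\<mu> j))"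
      by (rule emeasure_point_measure_finite) (auto simp: X_def)
    also have "\<dots> = ennreal (\<Sum>j\<in>X l. \<mu> j)" by (rule sum_ennreal) (use mu_pos in \<open>auto simp: X_def intro: less_imp_le\<close>)
    finally show "emeasure (point_measure (Idx N) (\<lambda>i. ennreal (\<mu> i))) (X l) = ennreal (mass {c. l < M c} (w l))"
      by (simp add: mass_def X_def)
  qed
  also have "\<dots> = ennreal (\<Prod>l<K. mass {c. l < M c} (w l))"
    by (rule prod_ennreal) (use mu_pos in \<open>auto simp: mass_def intro!: sum_nonneg intro: less_imp_le\<close>)
  finally have "emeasure Bern (cyl w M) = ennreal (\<Prod>l<K. mass {c. l < M c} (w l))" .
  moreover have "0 \<le> (\<Prod>l<K. mass {c. l < M c} (w l))"
    using mu_pos by (auto simp: mass_def intro!: prod_nonneg sum_nonneg intro: less_imp_le)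
  ultimately show ?thesis unfolding weight_def measure_def by simp
qed

lemma cyl_sets [measurable]: "cyl w M \<in> sets Bern"
proof -
  have "cyl w M = {v\<in>space Bern. \<forall>l\<in>{..<sum M UNIV}. v l \<in> {j\<in>Idx N. \<forall>c\<in>{c. l < M c}. agree c j (w l)}}"
    by (rule cyl_eq_emb) (rule M_le_sum)
  also have "\<dots> \<in> sets Bern" unfolding Bern_def
    by (rule sets.sets_Collect_finite_All, rule sets_Collect_single) (auto simp: sets_letter)
  finally show ?thesis .
qed

lemma mass_empty [simp]: "mass {} i = 1"
  by (simp add: mass_def mu_sum)

lemma mass_ge: "i \<in> Idx N \<Longrightarrow> mumin \<le> mass A i"
proof -
  assume i: "i \<in> Idx N"
  have "\<mu> i \<le> mass A i" unfolding mass_def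
    using mu_pos i by (intro member_le_sum) (auto intro: less_imp_le)
  then show ?thesis using mumin_le[OF i] by linarith
qed

lemma mass_pos: "i \<in> Idx N \<Longrightarrow> 0 < mass A i"
  using mass_ge[of i A] mumin_pos by linarith

lemma mass_le_1: "mass A i \<le> 1"
  unfolding mass_def mu_sum[symmetric] using mu_pos by (intro sum_mono2) (auto intro: less_imp_le)

text \<open>All factors of a weight lie between \<open>mumin\<close> and 1, so every position where
  a letter or the active set changes costs at most one factor \<open>mumin\<close>. Later
  comparisons of weights reduce to counting such positions.\<close>

lemma weight_compare:
  assumes "u \<in> words N" "w \<in> words N" "finite D"
    and "\<And>l c. l \<notin> D \<Longrightarrow> u l = w l \<and> (l < M c \<longleftrightarrow> l < M' c)"
  shows "mumin ^ card D * weight w M \<le> weight u M'"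
proof -
  define K where "K = (\<Sum>c\<in>UNIV. M c) + (\<Sum>c\<in>UNIV. M' c)"
  have K: "M c \<le> K" "M' c \<le> K" for c using M_le_sum[of M c] M_le_sum[of M' c] by (auto simp: K_def)
  have "(\<Prod>l<K. (if l \<in> D then mumin else 1) * mass {c. l < M c} (w l)) \<le> (\<Prod>l<K. mass {c. l < M' c} (u l))"
  proof (rule prod_mono, intro conjI)
    fix l
    show "0 \<le> (if l \<in> D then mumin else 1) * mass {c. l < M c} (w l)"
      using mumin_pos mass_pos[OF wordsD[OF assms(2)]] by (auto intro: less_imp_le)
    show "(if l \<in> D then mumin else 1) * mass {c. l < M c} (w l) \<le> mass {c. l < M' c} (u l)"
    proof (cases "l \<in> D")
      case True
      have "mumin * mass {c. l < M c} (w l) \<le> mumin * 1"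
        using mass_le_1 mumin_pos by (intro mult_left_mono) auto
      also have "\<dots> \<le> mass {c. l < M' c} (u l)" using mass_ge[OF wordsD[OF assms(1)]] by simp
      finally show ?thesis using True by simp
    next
      case False
      then show ?thesis using assms(4)[OF False] by simp
    qed
  qed
  also have "\<dots> = weight u M'" by (rule weight_prod[symmetric]) (rule K)
  finally have 1: "(\<Prod>l<K. if l \<in> D then mumin else 1) * weight w M \<le> weight u M'"
    using weight_prod[of M K w] K by (simp add: prod.distrib)
  \<comment> \<open>Positions of \<open>D\<close> beyond \<open>K\<close> do not occur in the
    product; counting them only makes the left side smaller.\<close>
  have "mumin ^ card D \<le> mumin ^ card ({..<K} \<inter> D)"
    using assms(3) mumin_pos mumin_le_1 by (intro power_decreasing card_mono) auto
  also have "\<dots> = (\<Prod>l<K. if l \<in> D then mumin else 1)"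
    by (subst prod.If_cases) auto
  finally have "mumin ^ card D * weight w M \<le> (\<Prod>l<K. if l \<in> D then mumin else 1) * weight w M"
    by (intro mult_right_mono) (auto simp: weight_def)
  with 1 show ?thesis by linarith
qed

lemma weight_pos: "w \<in> words N \<Longrightarrow> 0 < weight w M"
  by (subst weight_prod[of M "sum M UNIV" w]) (auto intro: M_le_sum prod_pos mass_pos wordsD)

definition profile_diff :: "('n \<Rightarrow> nat) \<Rightarrow> ('n \<Rightarrow> nat) \<Rightarrow> nat set" where
  "profile_diff M M' = (\<Union>c. {M c..<M' c} \<union> {M' c..<M c})"

lemma finite_profile_diff [simp]: "finite (profile_diff M M')"
  by (simp add: profile_diff_def)

lemma card_profile_diff:
  assumes "\<And>c. M c \<le> M' c + E" "\<And>c. M' c \<le> M c + E"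
  shows "card (profile_diff M M') \<le> CARD('n) * E"
proof -
  have "card (profile_diff M M') \<le> (\<Sum>c\<in>UNIV. card ({M c..<M' c} \<union> {M' c..<M c}))"
    unfolding profile_diff_def by (rule card_UN_le) simp
  also have "\<dots> \<le> (\<Sum>c\<in>(UNIV::'n set). E)"
  proof (rule sum_mono)
    fix c :: 'n
    have "card ({M c..<M' c} \<union> {M' c..<M c}) \<le> (M' c - M c) + (M c - M' c)"
      using card_Un_le[of "{M c..<M' c}" "{M' c..<M c}"] by simp
    then show "card ({M c..<M' c} \<union> {M' c..<M c}) \<le> E" using assms[of c] by linarith
  qed
  finally show ?thesis by simp
qed

lemma profile_diff_notin: "l \<notin> profile_diff M M' \<Longrightarrow> l < M c \<longleftrightarrow> l < M' c"
  unfolding profile_diff_def by (auto simp: not_le not_less)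

lemma weight_profile:
  assumes "w \<in> words N" "\<And>c. M c \<le> M' c + E" "\<And>c. M' c \<le> M c + E"
  shows "mumin ^ (CARD('n) * E) * weight w M \<le> weight w M'"
proof -
  have "mumin ^ (CARD('n) * E) * weight w M \<le> mumin ^ card (profile_diff M M') * weight w M"
    using card_profile_diff[OF assms(2,3)] mumin_pos mumin_le_1
    by (intro mult_right_mono power_decreasing) (auto simp: weight_def)
  also have "\<dots> \<le> weight w M'"
    by (rule weight_compare) (use assms(1) profile_diff_notin in auto)
  finally show ?thesis .
qed

section \<open>Approximate cubes and their partition sums\<close>

definition cube :: "real \<Rightarrow> (nat \<Rightarrow> nat) \<Rightarrow> (nat \<Rightarrow> nat) set" where
  "cube s w = cyl w (lev s w)"

definition cubes :: "real \<Rightarrow> (nat \<Rightarrow> nat) set set" where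
  "cubes s = cube s ` words N"

text \<open>The partition function of the potential \<open>psi\<close> at scale
  \<open>exp (- s)\<close>, up to a bounded factor that comes from the orderings.\<close>

definition cube_sum :: "real \<Rightarrow> real \<Rightarrow> real" where
  "cube_sum q s = (\<Sum>B\<in>cubes s. measure Bern B powr q)"

lemma cube_eq: "w \<in> words N \<Longrightarrow> v \<in> cube s w \<Longrightarrow> cube s v = cube s w"
  unfolding cube_def using cyl_lev cyl_eq by metis

lemma cube_self: "w \<in> words N \<Longrightarrow> w \<in> cube s w"
  by (simp add: cube_def)

lemma cubes_disjoint: "B \<in> cubes s \<Longrightarrow> B' \<in> cubes s \<Longrightarrow> B \<inter> B' \<noteq> {} \<Longrightarrow> B = B'"
  unfolding cubes_def using cube_eq by blast

lemma cubes_sets: "B \<in> cubes s \<Longrightarrow> B \<in> sets Bern"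
  by (auto simp: cubes_def cube_def)

lemma words_nonempty: "words N \<noteq> {}"
proof -
  obtain i where "i \<in> Idx N" using Idx_nonempty by auto
  then have "(\<lambda>_. i) \<in> words N" by (simp add: words_def)
  then show ?thesis by auto
qed

lemma cubes_nonempty: "cubes s \<noteq> {}"
  using words_nonempty by (simp add: cubes_def)

lemma cubes_pos: "B \<in> cubes s \<Longrightarrow> 0 < measure Bern B"
  using weight_pos by (auto simp: cubes_def cube_def weight_def)

lemma finite_words_restr:
  "finite {w \<in> words N. \<forall>l\<ge>K. w l = i}"
proof (rule finite_subset)
  show "{w \<in> words N. \<forall>l\<ge>K. w l = i} \<subseteq> {w. \<forall>l. (l \<in> {..<K} \<longrightarrow> w l \<in> Idx N) \<and> (l \<notin> {..<K} \<longrightarrow> w l = i)}"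
    by (auto simp: words_def)
qed (rule finite_set_of_finite_funs; simp)

text \<open>A cube does not see the letters behind its largest level, which is bounded in terms of
  \<open>s\<close>; these letters can be set to one fixed value.\<close>

lemma finite_cubes: assumes "0 \<le> s" shows "finite (cubes s)"
proof -
  obtain i where i: "i \<in> Idx N" using Idx_nonempty by auto
  define K where "K = nat \<lceil>(s + hmax) / hmin\<rceil>"
  have levK: "lev s w c \<le> K" if "w \<in> words N" for w c
    using lev_upper[OF that assms, of c] unfolding K_def by linarith
  have "cubes s \<subseteq> cube s ` {w \<in> words N. \<forall>l\<ge>K. w l = i}"
  proof
    fix B assume "B \<in> cubes s"
    then obtain w where w: "w \<in> words N" "B = cube s w" by (auto simp: cubes_def)
    define v where "v = (\<lambda>l. if l < K then w l else i)"
    have v: "v \<in> words N" using w i by (simp add: v_def words_def)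
    have "v \<in> cube s w" unfolding cube_def cyl_def using v levK[OF w(1)]
      by (auto simp: v_def) (metis agree_refl leD le_less_trans not_less)
    then have "B = cube s v" using cube_eq w by simp
    moreover have "v \<in> {w \<in> words N. \<forall>l\<ge>K. w l = i}" using v by (simp add: v_def)
    ultimately show "B \<in> cube s ` {w \<in> words N. \<forall>l\<ge>K. w l = i}" by blast
  qed
  then show ?thesis by (rule finite_subset) (rule finite_imageI, rule finite_words_restr)
qed

lemma cube_sum_pos: assumes "0 \<le> s" shows "0 < cube_sum q s"
  unfolding cube_sum_def
proof (rule sum_pos[OF finite_cubes[OF assms] cubes_nonempty])
  show "0 < measure Bern B powr q" if "B \<in> cubes s" for B
    using cubes_pos[OF that] by (simp only: powr_gt_zero)
qed

text \<open>Words are grouped by the cube they belong to. Each weight agrees with that of its cube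
  up to the factor \<eta>, and a cube contains at most \<open>1 / \<eta>\<close> of the words,
  because disjoint pieces of it each carry at least the share \<eta>. This explains the exponent: 1
  for the count and \<open>\<bar>q\<bar>\<close> for the comparison.\<close>

lemma sum_weight_le_cube_sum:
  assumes s: "0 \<le> s" and U: "finite U" "U \<subseteq> words N"
    and disj: "\<And>u u'. u \<in> U \<Longrightarrow> u' \<in> U \<Longrightarrow> u \<noteq> u' \<Longrightarrow> cyl u (M u) \<inter> cyl u' (M u') = {}"
    and E: "\<And>u c. u \<in> U \<Longrightarrow> M u c \<le> lev s u c + E" "\<And>u c. u \<in> U \<Longrightarrow> lev s u c \<le> M u c + E"
  shows "(\<Sum>u\<in>U. weight u (M u) powr q) \<le> (mumin ^ (CARD('n) * E)) powr (-(1+\<bar>q\<bar>)) * cube_sum q s"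
proof -
  define \<eta> where "\<eta> = mumin ^ (CARD('n) * E)"
  have \<eta>: "0 < \<eta>" using mumin_pos by (simp add: \<eta>_def)
  have fib: "(\<Sum>u\<in>{u\<in>U. cube s u = B}. weight u (M u) powr q) \<le> \<eta> powr (-(1+\<bar>q\<bar>)) * measure Bern B powr q"
    if B: "B \<in> cubes s" for B
  proof -
    let ?V = "{u\<in>U. cube s u = B}"
    have V: "finite ?V" using U by simp
    have Bp: "0 < measure Bern B" by (rule cubes_pos[OF B])
    have Bs: "B \<in> sets Bern" by (rule cubes_sets[OF B])
    have w: "weight u (M u) powr q \<le> \<eta> powr (-\<bar>q\<bar>) * measure Bern B powr q" if u: "u \<in> ?V" for u
    proof (rule powr_compare)
      have uw: "u \<in> words N" using u U by auto
      have Bm: "measure Bern B = weight u (lev s u)" using u by (simp add: weight_def cube_def[symmetric])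
      show "0 < weight u (M u)" by (rule weight_pos[OF uw])
      show "\<eta> * weight u (M u) \<le> measure Bern B"
        unfolding \<eta>_def Bm by (rule weight_profile[OF uw]) (use E u in auto)
      show "\<eta> * measure Bern B \<le> weight u (M u)"
        unfolding \<eta>_def Bm by (rule weight_profile[OF uw]) (use E u in auto)
    qed (use Bp \<eta> in auto)
    have "real (card ?V) * (\<eta> * measure Bern B) \<le> (\<Sum>u\<in>?V. measure Bern (cyl u (M u) \<inter> B))"
    proof -
      have "\<eta> * measure Bern B \<le> measure Bern (cyl u (M u) \<inter> B)" if u: "u \<in> ?V" for u
      proof -
        have uw: "u \<in> words N" using u U by auto
        define M' where "M' c = max (M u c) (lev s u c)" for c
        have Bu: "B = cyl u (lev s u)" using u by (simp add: cube_def[symmetric])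
        \<comment> \<open>Both conditions together form a cylinder whose depths are still within
          \<open>E\<close> of the levels.\<close>
        have eq: "cyl u (M u) \<inter> B = cyl u M'"
          unfolding Bu by (auto simp: cyl_def M'_def less_max_iff_disj)
        have "mumin ^ (CARD('n) * E) * weight u (lev s u) \<le> weight u M'"
          by (rule weight_profile[OF uw]) (use E u in \<open>auto simp: M'_def max_def\<close>)
        then show ?thesis unfolding eq by (simp add: weight_def \<eta>_def Bu)
      qed
      then show ?thesis using sum_bounded_below[of ?V "\<eta> * measure Bern B"] by simp
    qed
    also have "\<dots> = measure Bern (\<Union>u\<in>?V. cyl u (M u) \<inter> B)"
      by (rule Bern.finite_measure_finite_Union[symmetric])
        (use V Bs disj in \<open>auto simp: disjoint_family_on_def\<close>)
    also have "\<dots> \<le> measure Bern B" by (rule Bern.finite_measure_mono) (use Bs in auto)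
    finally have card: "real (card ?V) \<le> 1 / \<eta>" using Bp \<eta> by (simp add: field_simps)
    have "(\<Sum>u\<in>?V. weight u (M u) powr q) \<le> real (card ?V) * (\<eta> powr (-\<bar>q\<bar>) * measure Bern B powr q)"
      using sum_bounded_above[of ?V "\<lambda>u. weight u (M u) powr q"] w by simp
    also have "\<dots> \<le> 1/\<eta> * (\<eta> powr (-\<bar>q\<bar>) * measure Bern B powr q)"
      using card by (intro mult_right_mono) auto
    also have "\<dots> = \<eta> powr (-(1+\<bar>q\<bar>)) * measure Bern B powr q"
      using \<eta> by (simp add: powr_minus powr_add powr_diff field_simps)
    finally show ?thesis .
  qed
  have "(\<Sum>u\<in>U. weight u (M u) powr q) = (\<Sum>B\<in>cubes s. \<Sum>u\<in>{u\<in>U. cube s u = B}. weight u (M u) powr q)"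
    by (rule sum.group[symmetric]) (use U finite_cubes[OF s] in \<open>auto simp: cubes_def\<close>)
  also have "\<dots> \<le> (\<Sum>B\<in>cubes s. \<eta> powr (-(1+\<bar>q\<bar>)) * measure Bern B powr q)"
    by (rule sum_mono) (rule fib)
  also have "\<dots> = \<eta> powr (-(1+\<bar>q\<bar>)) * cube_sum q s" by (simp add: cube_sum_def sum_distrib_left)
  finally show ?thesis by (simp add: \<eta>_def)
qed

text \<open>A representative provides a cube with a word, and with it a profile, letters and a
  box.\<close>

definition rep :: "real \<Rightarrow> (nat \<Rightarrow> nat) set \<Rightarrow> (nat \<Rightarrow> nat)" where
  "rep s B = (SOME w. w \<in> words N \<and> cube s w = B)"

lemma rep: assumes "B \<in> cubes s" shows "rep s B \<in> words N" "cube s (rep s B) = B"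
proof -
  have "\<exists>w. w \<in> words N \<and> cube s w = B" using assms by (auto simp: cubes_def)
  from someI_ex[OF this] show "rep s B \<in> words N" "cube s (rep s B) = B" by (auto simp: rep_def)
qed

definition reps :: "real \<Rightarrow> (nat \<Rightarrow> nat) set" where
  "reps s = rep s ` cubes s"

lemma reps_words: "w \<in> reps s \<Longrightarrow> w \<in> words N"
  using rep by (auto simp: reps_def)

lemma finite_reps: "0 \<le> s \<Longrightarrow> finite (reps s)"
  by (simp add: reps_def finite_cubes)

lemma cube_sum_reps: "cube_sum q s = (\<Sum>w\<in>reps s. weight w (lev s w) powr q)"
proof -
  have "inj_on (rep s) (cubes s)" by (rule inj_onI) (metis rep(2))
  then have "(\<Sum>w\<in>reps s. weight w (lev s w) powr q) = (\<Sum>B\<in>cubes s. weight (rep s B) (lev s (rep s B)) powr q)"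
    unfolding reps_def by (subst sum.reindex) auto
  also have "\<dots> = cube_sum q s" unfolding cube_sum_def
    by (rule sum.cong) (auto simp: weight_def cube_def[symmetric] rep)
  finally show ?thesis by simp
qed

lemma reps_disjoint:
  assumes "w \<in> reps s" "w' \<in> reps s" "w \<noteq> w'"
  shows "cyl w (lev s w) \<inter> cyl w' (lev s w') = {}"
proof -
  obtain B B' where B: "B \<in> cubes s" "B' \<in> cubes s" "w = rep s B" "w' = rep s B'"
    using assms by (auto simp: reps_def)
  then have "B \<noteq> B'" using assms by auto
  then have "B \<inter> B' = {}" using cubes_disjoint B by blast
  then show ?thesis using rep(2) B by (simp add: cube_def)
qed

lemma lev_scale:
  assumes "w \<in> words N" "0 \<le> s" "0 \<le> s'" "\<bar>s - s'\<bar> \<le> D"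
  shows "lev s w c \<le> lev s' w c + nat \<lceil>(D + 2 * hmax) / hmin\<rceil>"
proof -
  have "\<bar>tau w c (lev s w c) - s'\<bar> \<le> D + hmax"
    using lev_ge[OF assms(1), of s c] lev_tau_upper[OF assms(1,2), of c] assms(4) hmax_pos by linarith
  from lev_dist[OF assms(1,3) this]
  have "\<bar>real (lev s w c) - real (lev s' w c)\<bar> \<le> (D + 2 * hmax) / hmin" by (simp add: add.commute)
  then show ?thesis by linarith
qed

text \<open>A change of scale by at most \<open>D\<close> moves every level by a bounded number of
  positions, so the representatives at one scale are admissible for the other.\<close>

lemma cube_sum_scale:
  assumes "0 \<le> s" "0 \<le> s'" "\<bar>s - s'\<bar> \<le> D"
  shows "cube_sum q s \<le> (mumin ^ (CARD('n) * nat \<lceil>(D + 2 * hmax) / hmin\<rceil>)) powr (-(1+\<bar>q\<bar>)) * cube_sum q s'"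
  unfolding cube_sum_reps[of q s]
proof (rule sum_weight_le_cube_sum)
  show "cyl u (lev s u) \<inter> cyl u' (lev s u') = {}" if "u \<in> reps s" "u' \<in> reps s" "u \<noteq> u'" for u u'
    by (rule reps_disjoint[OF that])
  show "lev s u c \<le> lev s' u c + nat \<lceil>(D + 2 * hmax) / hmin\<rceil>" if "u \<in> reps s" for u c
    by (rule lev_scale[OF reps_words[OF that] assms])
  show "lev s' u c \<le> lev s u c + nat \<lceil>(D + 2 * hmax) / hmin\<rceil>" if "u \<in> reps s" for u c
    by (rule lev_scale[OF reps_words[OF that] assms(2,1)]) (use assms(3) in linarith)
qed (use assms finite_reps reps_words in auto)

section \<open>Existence of the pressure\<close>

text \<open>Chosen so that, for scales at least 1, each level has at most \<open>C1 * s\<close>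
  possible values, see \<open>profiles\<close>.\<close>

definition C1 :: real where "C1 = (1 + hmax) / hmin + 2"

lemma C1_ge: "C1 \<ge> 2"
  using hmin_pos hmax_pos by (simp add: C1_def)

lemma lev_le_C1:
  assumes "w \<in> words N" "1 \<le> s"
  shows "real (lev s w c) + 1 \<le> C1 * s"
proof -
  have "real (lev s w c) \<le> (s + hmax) / hmin" using lev_upper[of w s c] assms by simp
  also have "\<dots> \<le> (s + hmax * s) / hmin"
    using assms hmin_pos hmax_pos mult_left_mono[of 1 s hmax] by (intro divide_right_mono) auto
  also have "\<dots> = (1 + hmax) / hmin * s" by (simp add: algebra_simps)
  finally show ?thesis using assms by (simp add: C1_def algebra_simps)
qed

lemma profiles:
  assumes "1 \<le> s"
  shows "finite (lev s ` words N)" "real (card (lev s ` words N)) \<le> (C1 * s) ^ CARD('n)"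
proof -
  define n where "n = nat \<lfloor>C1 * s - 1\<rfloor>"
  have "0 \<le> C1 * s - 1" using C1_ge assms mult_mono[of 2 C1 1 s] by simp
  then have n: "real n \<le> C1 * s - 1" by (simp add: n_def)
  have "lev s w c \<le> n" if "w \<in> words N" for w c
    using lev_le_C1[OF that assms, of c] unfolding n_def by linarith
  then have sub: "lev s ` words N \<subseteq> PiE UNIV (\<lambda>_. {..n})" by auto
  then show "finite (lev s ` words N)" by (rule finite_subset) (simp add: finite_PiE)
  have "card (lev s ` words N) \<le> card (PiE (UNIV :: 'n set) (\<lambda>_. {..n}))"
    by (rule card_mono[OF _ sub]) (simp add: finite_PiE)
  also have "\<dots> = (n + 1) ^ CARD('n)" by (simp add: card_PiE)
  finally have "real (card (lev s ` words N)) \<le> real ((n + 1) ^ CARD('n))" by (rule of_nat_mono)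
  also have "\<dots> \<le> (C1 * s) ^ CARD('n)" using n by (simp add: power_mono)
  finally show "real (card (lev s ` words N)) \<le> (C1 * s) ^ CARD('n)" .
qed

text \<open>Position \<open>i * k + j\<close> has the same active coordinates for the profile \<open>k * M\<close> as position \<open>i\<close> for \<open>M\<close>.\<close>
definition interleave :: "nat \<Rightarrow> (nat \<Rightarrow> nat \<Rightarrow> nat) \<Rightarrow> nat \<Rightarrow> nat" where
  "interleave k f l = f (l mod k) (l div k)"

lemma interleave_at: "j < k \<Longrightarrow> interleave k f (i * k + j) = f j i"
  by (simp add: interleave_def)

lemma interleave_words:
  assumes "1 \<le> k" "\<And>j. j < k \<Longrightarrow> f j \<in> words N"
  shows "interleave k f \<in> words N"
  using assms unfolding words_def interleave_def by simp

lemma index_less_mult: "j < k \<Longrightarrow> i * k + j < k * m \<longleftrightarrow> i < (m::nat)"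
proof -
  assume j: "j < k"
  have "(i * k + j) div k < m \<longleftrightarrow> i * k + j < m * k"
    using j by (subst div_less_iff_less_mult) auto
  then show ?thesis using j by (simp add: mult.commute)
qed

lemma tau_interleave: "tau (interleave k f) c (k * m) = (\<Sum>j<k. tau (f j) c m)"
  unfolding tau_def by (subst mult.commute, subst sum.nat_group_mod) (simp add: interleave_at)

lemma weight_interleave: "weight (interleave k f) (\<lambda>c. k * M c) = (\<Prod>j<k. weight (f j) M)"
proof -
  define m where "m = sum M UNIV"
  have m: "M c \<le> m" for c by (simp add: m_def M_le_sum)
  have "weight (interleave k f) (\<lambda>c. k * M c) = (\<Prod>l<m * k. mass {c. l < k * M c} (interleave k f l))"
    using m by (intro weight_prod) (simp add: mult.commute)
  also have "\<dots> = (\<Prod>j<k. \<Prod>i<m. mass {c. i < M c} (f j i))"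
    by (subst prod.nat_group_mod) (simp add: interleave_at index_less_mult)
  also have "\<dots> = (\<Prod>j<k. weight (f j) M)" using weight_prod[of M m] m by simp
  finally show ?thesis .
qed

text \<open>Reading the positions of one residue class undoes the interleaving. Hence tuples that
  differ in one component, taken from disjoint cylinders, have disjoint interleaved
  cylinders.\<close>

lemma cyl_interleave:
  assumes "v \<in> cyl (interleave k f) (\<lambda>c. k * M c)" "j < k"
  shows "(\<lambda>i. v (i * k + j)) \<in> cyl (f j) M"
proof -
  have "agree c (v (i * k + j)) (f j i)" if "i < M c" for c i
  proof -
    have "i * k + j < k * M c" using that assms(2) index_less_mult by blast
    then have "agree c (v (i * k + j)) (interleave k f (i * k + j))" using assms(1) unfolding cyl_def by blast
    then show ?thesis using assms(2) by (simp add: interleave_at)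
  qed
  then show ?thesis using assms(1) by (auto simp: cyl_def words_def)
qed

definition profile_sum :: "real \<Rightarrow> real \<Rightarrow> ('n \<Rightarrow> nat) \<Rightarrow> real" where
  "profile_sum q s M = (\<Sum>w\<in>{w\<in>reps s. lev s w = M}. weight w M powr q)"

lemma cube_sum_by_profile:
  assumes "1 \<le> s"
  shows "cube_sum q s = (\<Sum>M\<in>lev s ` words N. profile_sum q s M)"
proof -
  have "cube_sum q s = (\<Sum>M\<in>lev s ` words N. \<Sum>w\<in>{w\<in>reps s. lev s w = M}. weight w (lev s w) powr q)"
    unfolding cube_sum_reps by (rule sum.group[symmetric]) (use assms finite_reps profiles reps_words in auto)
  also have "\<dots> = (\<Sum>M\<in>lev s ` words N. profile_sum q s M)"
    unfolding profile_sum_def by (intro sum.cong) auto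
  finally show ?thesis .
qed

text \<open>The error of a level per interleaved word: each \<open>tau\<close> overshoots by at most
  \<open>hmax\<close>, and the further \<open>hmax\<close> from \<open>lev_dist\<close> is absorbed
  by doubling.\<close>

definition E1 :: nat where "E1 = nat \<lceil>2 * hmax / hmin\<rceil>"

text \<open>Expanding the power gives a sum over tuples of representatives with profile
  \<open>M\<close>. The interleaved word of a tuple carries the product of the weights, so this is a
  sum over disjoint cylinders near scale \<open>k * s\<close>.\<close>

lemma profile_sum_power_le_cube_sum:
  assumes s: "0 \<le> s" and k: "1 \<le> k"
  shows "profile_sum q s M ^ k \<le> (mumin ^ (CARD('n) * (k * E1))) powr (-(1+\<bar>q\<bar>)) * cube_sum q (real k * s)"
proof -
  define R where "R = {w\<in>reps s. lev s w = M}"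
  have R: "finite R" "\<And>w. w \<in> R \<Longrightarrow> w \<in> words N" "\<And>w. w \<in> R \<Longrightarrow> lev s w = M"
    using finite_reps[OF s] reps_words by (auto simp: R_def)
  define G where "G = PiE {..<k} (\<lambda>_. R)"
  have G: "f j \<in> R" if "f \<in> G" "j < k" for f j using that by (auto simp: G_def)
  have dis: "cyl (interleave k f) (\<lambda>c. k * M c) \<inter> cyl (interleave k f') (\<lambda>c. k * M c) = {}"
    if f: "f \<in> G" "f' \<in> G" "f \<noteq> f'" for f f'
  proof (rule ccontr)
    assume "\<not> ?thesis"
    then obtain v where v: "v \<in> cyl (interleave k f) (\<lambda>c. k * M c)" "v \<in> cyl (interleave k f') (\<lambda>c. k * M c)" by blast
    obtain j where j: "j < k" "f j \<noteq> f' j"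
      using f PiE_ext[of f "{..<k}" "\<lambda>_. R" f'] by (auto simp: G_def)
    have "cyl (f j) M \<inter> cyl (f' j) M = {}"
      using reps_disjoint[of "f j" s "f' j"] G[OF f(1) j(1)] G[OF f(2) j(1)] j(2) by (auto simp: R_def)
    then show False using cyl_interleave[OF v(1) j(1)] cyl_interleave[OF v(2) j(1)] by blast
  qed
  have iw: "interleave k f \<in> words N" if "f \<in> G" for f
    using interleave_words[OF k] G[OF that] R(2) by blast
  have inj: "inj_on (interleave k) G"
  proof (rule inj_onI)
    fix f f' assume f: "f \<in> G" "f' \<in> G" and eq: "interleave k f = interleave k f'"
    show "f = f'"
    proof (rule ccontr)
      assume "f \<noteq> f'"
      from dis[OF f this] show False using cyl_refl[OF iw[OF f(1)], of "\<lambda>c. k * M c"] eq by auto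
    qed
  qed
  have E: "k * M c \<le> lev (real k * s) (interleave k f) c + k * E1"
          "lev (real k * s) (interleave k f) c \<le> k * M c + k * E1" if f: "f \<in> G" for f c
  proof -
    let ?u = "interleave k f"
    have "tau ?u c (k * M c) = (\<Sum>j<k. tau (f j) c (M c))" by (rule tau_interleave)
    moreover have "real k * s \<le> (\<Sum>j<k. tau (f j) c (M c))"
      using sum_bounded_below[of "{..<k}" s "\<lambda>j. tau (f j) c (M c)"] G[OF f] R lev_ge[of _ s c] by force
    moreover have "(\<Sum>j<k. tau (f j) c (M c)) \<le> real k * (s + hmax)"
      using sum_bounded_above[of "{..<k}" "\<lambda>j. tau (f j) c (M c)" "s + hmax"] G[OF f] R lev_tau_upper[of _ s c] s by force
    ultimately have "\<bar>tau ?u c (k * M c) - real k * s\<bar> \<le> real k * hmax" by (simp add: algebra_simps)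
    from lev_dist[OF iw[OF f] _ this] have "\<bar>real (k * M c) - real (lev (real k * s) ?u c)\<bar> \<le> (real k * hmax + hmax) / hmin"
      using s by simp
    also have "\<dots> \<le> real k * (2 * hmax / hmin)"
      using k hmin_pos hmax_pos mult_right_mono[of 1 "real k" hmax] by (simp add: field_simps)
    also have "\<dots> \<le> real k * real E1" unfolding E1_def by (intro mult_left_mono) (auto simp: real_nat_ceiling_ge)
    finally have *: "\<bar>real (k * M c) - real (lev (real k * s) ?u c)\<bar> \<le> real (k * E1)" by simp
    show "k * M c \<le> lev (real k * s) ?u c + k * E1" "lev (real k * s) ?u c \<le> k * M c + k * E1"
      using * by linarith+
  qed
  have "profile_sum q s M ^ k = (\<Prod>j<k. \<Sum>w\<in>R. weight w M powr q)" by (simp add: profile_sum_def R_def)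
  also have "\<dots> = (\<Sum>f\<in>G. \<Prod>j<k. weight (f j) M powr q)"
    unfolding G_def by (rule prod_sum_PiE) (use R in auto)
  also have "\<dots> = (\<Sum>f\<in>G. weight (interleave k f) (\<lambda>c. k * M c) powr q)"
    unfolding weight_interleave by (subst prod_powr_distrib[symmetric]) (auto simp: weight_def)
  also have "\<dots> = (\<Sum>u\<in>interleave k ` G. weight u (\<lambda>c. k * M c) powr q)"
    by (simp add: sum.reindex[OF inj])
  also have "\<dots> \<le> (mumin ^ (CARD('n) * (k * E1))) powr (-(1+\<bar>q\<bar>)) * cube_sum q (real k * s)"
  proof (rule sum_weight_le_cube_sum)
    show "0 \<le> real k * s" using s by simp
    show "finite (interleave k ` G)" using R by (simp add: G_def finite_PiE)
    show "interleave k ` G \<subseteq> words N" using iw by auto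
  qed (use dis E in auto)
  finally show ?thesis .
qed

text \<open>Some profile carries at least the average share of the sum, and the power of its share
  is bounded by interleaving. After taking logarithms the number of profiles enters only as a
  multiple of \<open>ln (C1 * s)\<close>.\<close>

lemma pressure_superadditive:
  fixes q :: real
  assumes s: "1 \<le> s" and k: "1 \<le> k"
  shows "real k * ln (cube_sum q s) \<le> ln (cube_sum q (real k * s)) +
     real k * (CARD('n) * ln (C1 * s) + (1+\<bar>q\<bar>) * (CARD('n) * E1) * (- ln mumin))"
proof -
  have Cs: "0 < C1 * s" using C1_ge s by (intro mult_pos_pos) linarith+
  have "\<exists>M. cube_sum q s \<le> (C1 * s) ^ CARD('n) * profile_sum q s M"
  proof (rule ccontr)
    assume "\<not> ?thesis"
    then have less: "profile_sum q s M < cube_sum q s / (C1 * s) ^ CARD('n)" for M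
      using Cs by (simp add: not_le pos_less_divide_eq mult.commute)
    have "cube_sum q s \<le> real (card (lev s ` words N)) * Max (profile_sum q s ` lev s ` words N)"
      unfolding cube_sum_by_profile[OF s] by (rule sum_bounded_above) (use profiles[OF s] in auto)
    moreover have "Max (profile_sum q s ` lev s ` words N) \<in> profile_sum q s ` lev s ` words N"
      by (rule Max_in) (use profiles[OF s] words_nonempty in auto)
    ultimately obtain M where M: "cube_sum q s \<le> real (card (lev s ` words N)) * profile_sum q s M" by auto
    have "real (card (lev s ` words N)) * profile_sum q s M \<le> (C1 * s) ^ CARD('n) * profile_sum q s M"
      by (intro mult_right_mono profiles[OF s]) (auto simp: profile_sum_def intro: sum_nonneg)
    also have "\<dots> < cube_sum q s" using less[of M] Cs by (simp add: pos_less_divide_eq mult.commute)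
    finally show False using M by linarith
  qed
  then obtain M where M: "cube_sum q s \<le> (C1 * s) ^ CARD('n) * profile_sum q s M" by blast
  have Sp: "0 < cube_sum q s" "0 < cube_sum q (real k * s)" using cube_sum_pos s by auto
  have Zp: "0 < profile_sum q s M" using M Sp Cs by (smt (verit) zero_less_mult_pos zero_less_power)
  have "ln (cube_sum q s) \<le> ln ((C1 * s) ^ CARD('n) * profile_sum q s M)" using M Sp by simp
  also have "\<dots> = CARD('n) * ln (C1 * s) + ln (profile_sum q s M)" using Zp Cs by (subst ln_mult) (auto simp: ln_realpow)
  finally have 1: "real k * ln (cube_sum q s) \<le> real k * (CARD('n) * ln (C1 * s)) + real k * ln (profile_sum q s M)"
    by (simp flip: distrib_left add: mult_left_mono)
  have "ln (profile_sum q s M ^ k) \<le> ln ((mumin ^ (CARD('n) * (k * E1))) powr (-(1+\<bar>q\<bar>)) * cube_sum q (real k * s))"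
  proof (subst ln_le_cancel_iff)
    show le: "profile_sum q s M ^ k \<le> (mumin ^ (CARD('n) * (k * E1))) powr (-(1+\<bar>q\<bar>)) * cube_sum q (real k * s)"
      using profile_sum_power_le_cube_sum[of s k q M] s k by simp
    show "0 < profile_sum q s M ^ k" using Zp by simp
    with le show "0 < (mumin ^ (CARD('n) * (k * E1))) powr (-(1+\<bar>q\<bar>)) * cube_sum q (real k * s)" by linarith
  qed
  also have "\<dots> = (1+\<bar>q\<bar>) * (CARD('n) * (k * E1)) * (- ln mumin) + ln (cube_sum q (real k * s))"
    using Sp mumin_pos by (simp add: ln_mult ln_powr ln_realpow algebra_simps)
  finally have "real k * ln (profile_sum q s M) \<le> (1+\<bar>q\<bar>) * (CARD('n) * (k * E1)) * (- ln mumin) + ln (cube_sum q (real k * s))"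
    using Zp by (simp add: ln_realpow)
  with 1 show ?thesis by (simp add: algebra_simps)
qed

lemma ln_cube_sum_lipschitz:
  obtains A where "\<And>s s'. 0 \<le> s \<Longrightarrow> 0 \<le> s' \<Longrightarrow> \<bar>ln (cube_sum q s) - ln (cube_sum q s')\<bar> \<le> A * (\<bar>s - s'\<bar> + 1)"
proof -
  define b where "b = (1+\<bar>q\<bar>) * CARD('n) * (- ln mumin)"
  define A where "A = b * (1 / hmin + (2 * hmax) / hmin + 1)"
  have b: "0 \<le> b" unfolding b_def using mumin_pos mumin_le_1 by (intro mult_nonneg_nonneg) auto
  have one: "ln (cube_sum q s) - ln (cube_sum q s') \<le> A * (\<bar>s - s'\<bar> + 1)" if "0 \<le> s" "0 \<le> s'" for s s'
  proof -
    define D where "D = \<bar>s - s'\<bar>"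
    define E where "E = nat \<lceil>(D + 2 * hmax) / hmin\<rceil>"
    have E: "real E \<le> (D + 2 * hmax) / hmin + 1"
      unfolding E_def using hmin_pos hmax_pos by (simp add: D_def)
    have Sp: "0 < cube_sum q s" "0 < cube_sum q s'" using cube_sum_pos that by auto
    have "cube_sum q s \<le> (mumin ^ (CARD('n) * E)) powr (-(1+\<bar>q\<bar>)) * cube_sum q s'"
      using cube_sum_scale[OF that, of D q] by (simp add: D_def E_def)
    then have "ln (cube_sum q s) \<le> ln ((mumin ^ (CARD('n) * E)) powr (-(1+\<bar>q\<bar>)) * cube_sum q s')"
      using Sp by (subst ln_le_cancel_iff) linarith+
    also have "\<dots> = b * real E + ln (cube_sum q s')"
      using Sp mumin_pos by (simp add: b_def ln_mult ln_powr ln_realpow algebra_simps)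
    finally have "ln (cube_sum q s) - ln (cube_sum q s') \<le> b * real E" by simp
    also have "\<dots> \<le> b * ((D + 2 * hmax) / hmin + 1)" using E b by (rule mult_left_mono)
    also have "\<dots> \<le> b * ((1 / hmin + (2 * hmax) / hmin + 1) * (D + 1))"
      using b hmin_pos hmax_pos by (intro mult_left_mono) (auto simp: D_def field_simps)
    finally show ?thesis by (simp add: A_def D_def mult.assoc)
  qed
  have "\<bar>ln (cube_sum q s) - ln (cube_sum q s')\<bar> \<le> A * (\<bar>s - s'\<bar> + 1)" if "0 \<le> s" "0 \<le> s'" for s s'
    using one[OF that] one[OF that(2,1)] by (auto simp: abs_le_iff abs_minus_commute)
  then show thesis by (rule that)
qed

lemma cube_sum_limit_exists: "\<exists>P. ((\<lambda>s. ln (cube_sum q s) / s) \<longlongrightarrow> P) at_top"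
proof -
  obtain A where A: "\<And>s s'. 0 \<le> s \<Longrightarrow> 0 \<le> s' \<Longrightarrow> \<bar>ln (cube_sum q s) - ln (cube_sum q s')\<bar> \<le> A * (\<bar>s - s'\<bar> + 1)"
    using ln_cube_sum_lipschitz by blast
  define H where "H s = CARD('n) * ln (C1 * s) + (1+\<bar>q\<bar>) * (CARD('n) * E1) * (- ln mumin)" for s
  show ?thesis
  proof (rule almost_superadditive_limit[where H = H])
    show "real k * ln (cube_sum q s) \<le> ln (cube_sum q (real k * s)) + real k * H s" if "1 \<le> s" "1 \<le> k" for s k
      unfolding H_def by (rule pressure_superadditive[OF that])
    have "((\<lambda>s. real CARD('n) * (ln s / s) + (real CARD('n) * ln C1 + (1+\<bar>q\<bar>) * (CARD('n) * E1) * (- ln mumin)) / s) \<longlongrightarrow> real CARD('n) * 0 + 0) at_top"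
      by (intro tendsto_add tendsto_mult tendsto_const lim_ln_over_power[of 1, simplified] tendsto_divide_0[OF tendsto_const] filterlim_at_top_imp_at_infinity filterlim_ident ln_x_over_x_tendsto_0)
    moreover have "\<forall>\<^sub>F s in at_top. real CARD('n) * (ln s / s) + (real CARD('n) * ln C1 + (1+\<bar>q\<bar>) * (CARD('n) * E1) * (- ln mumin)) / s = H s / s"
      using eventually_gt_at_top[of 0]
      by eventually_elim (use C1_ge in \<open>auto simp: H_def ln_mult add_divide_distrib diff_divide_distrib algebra_simps\<close>)
    ultimately show "((\<lambda>s. H s / s) \<longlongrightarrow> 0) at_top" using Lim_transform_eventually by fastforce
  qed (rule A)
qed

section \<open>The pressure of the statement\<close>

lemma Ldelta_lev:
  assumes "w \<in> words N" "0 < \<delta>"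
  shows "Ldelta a \<delta> w c = lev (- ln \<delta>) w c"
proof -
  have "(\<Prod>l<k. \<bar>a (w l) c\<bar>) \<le> \<delta> \<longleftrightarrow> - ln \<delta> \<le> tau w c k" for k
  proof -
    have "(\<Prod>l<k. \<bar>a (w l) c\<bar>) = exp (- tau w c k)"
      using abs_slope[OF assms(1), of c k] by (simp add: slope_def abs_prod)
    then have "(\<Prod>l<k. \<bar>a (w l) c\<bar>) \<le> \<delta> \<longleftrightarrow> exp (- tau w c k) \<le> exp (ln \<delta>)" using assms(2) by simp
    then show ?thesis by (simp only: exp_le_cancel_iff) linarith
  qed
  then show ?thesis by (simp add: Ldelta_def lev_def)
qed

text \<open>An affine map of the line is determined by its values at 0 and 1, both of which occur as
  coordinates in the cube.\<close>

lemma overlap_iff: "overlap_exactly a t \<sigma> n i j \<longleftrightarrow> (\<forall>c\<in>set (take n \<sigma>). agree c i j)"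
proof
  assume o: "overlap_exactly a t \<sigma> n i j"
  show "\<forall>c\<in>set (take n \<sigma>). agree c i j"
  proof
    fix c assume c: "c \<in> set (take n \<sigma>)"
    have eq: "a i c * x + t i $ c = a j c * x + t j $ c" if "0 \<le> x" "x \<le> 1" for x
    proof -
      have "(\<chi> c. x) \<in> unitcube" using that by (simp add: unitcube_def)
      then have "proj \<sigma> n (fmap a t i (\<chi> c. x)) $ c = proj \<sigma> n (fmap a t j (\<chi> c. x)) $ c"
        using o unfolding overlap_exactly_def by metis
      then show ?thesis using c by (simp add: proj_def Ecoords_def fmap_def)
    qed
    show "agree c i j" using eq[of 0] eq[of 1] by (simp add: agree_def)
  qed
next
  assume "\<forall>c\<in>set (take n \<sigma>). agree c i j"
  then show "overlap_exactly a t \<sigma> n i j"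
    by (auto simp: overlap_exactly_def proj_def Ecoords_def fmap_def vec_eq_iff agree_def)
qed

lemma proj_idx_eq_iff:
  assumes "i \<in> Idx N" "j \<in> Idx N"
  shows "proj_idx N a t \<sigma> n i = proj_idx N a t \<sigma> n j \<longleftrightarrow> (\<forall>c\<in>set (take n \<sigma>). agree c i j)"
proof
  have p: "overlap_exactly a t \<sigma> n (proj_idx N a t \<sigma> n i) i" if "i \<in> Idx N" for i
    unfolding proj_idx_def
    by (rule conjunct2, rule LeastI[of _ i]) (use that in \<open>auto simp: overlap_iff\<close>)
  assume "proj_idx N a t \<sigma> n i = proj_idx N a t \<sigma> n j"
  then show "\<forall>c\<in>set (take n \<sigma>). agree c i j"
    using p[OF assms(1)] p[OF assms(2)] agree_sym agree_trans unfolding overlap_iff by metis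
next
  assume ag: "\<forall>c\<in>set (take n \<sigma>). agree c i j"
  have "overlap_exactly a t \<sigma> n k i \<longleftrightarrow> overlap_exactly a t \<sigma> n k j" for k
    unfolding overlap_iff using ag agree_sym agree_trans by blast
  then show "proj_idx N a t \<sigma> n i = proj_idx N a t \<sigma> n j" by (simp add: proj_idx_def)
qed

lemma mu_proj_mass:
  assumes "i \<in> Idx N"
  shows "mu_proj N a t \<mu> \<sigma> n (proj_idx N a t \<sigma> n i) = mass (set (take n \<sigma>)) i"
  unfolding mu_proj_def mass_def by (rule sum.cong) (use assms proj_idx_eq_iff in auto)

text \<open>Weak monotonicity along the ordering, a property that survives rounding of the depths,
  see \<open>round_up_sorted\<close>.\<close>

definition sorted_profile :: "'n list \<Rightarrow> ('n \<Rightarrow> nat) \<Rightarrow> bool" where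
  "sorted_profile \<sigma> M \<longleftrightarrow> \<sigma> \<in> perms \<and> (\<forall>m k. k \<le> m \<longrightarrow> m < length \<sigma> \<longrightarrow> M (\<sigma> ! m) \<le> M (\<sigma> ! k))"

lemma Sigma_ord_sorted:
  assumes "\<sigma> \<in> perms" "w \<in> Sigma_ord N a \<sigma> \<delta>" "0 < \<delta>"
  shows "sorted_profile \<sigma> (lev (- ln \<delta>) w)"
proof -
  have w: "w \<in> words N" using assms by (simp add: Sigma_ord_def)
  have step: "lev (- ln \<delta>) w (\<sigma> ! Suc k) \<le> lev (- ln \<delta>) w (\<sigma> ! k)" if "Suc k < length \<sigma>" for k
    using assms(2) that by (simp add: Sigma_ord_def ordered_at_def Ldelta_lev[OF w assms(3)])
  have "lev (- ln \<delta>) w (\<sigma> ! m) \<le> lev (- ln \<delta>) w (\<sigma> ! k)" if "k \<le> m" "m < length \<sigma>" for k m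
    using that
  proof (induction m rule: dec_induct)
    case (step n)
    then show ?case using \<open>\<And>k. Suc k < length \<sigma> \<Longrightarrow> _\<close>[of n] by (meson Suc_lessD order.trans)
  qed simp
  then show ?thesis using assms(1) by (simp add: sorted_profile_def)
qed

text \<open>If \<open>l\<close> lies between two consecutive depths, the active coordinates form an
  initial segment of the ordering. This translates between active sets and the projections of the
  statement.\<close>

lemma sorted_profile_take:
  assumes "sorted_profile \<sigma> M" "1 \<le> n" "n \<le> length \<sigma>" "l < M (\<sigma> ! (n - 1))"
    and "n < length \<sigma> \<Longrightarrow> M (\<sigma> ! n) \<le> l"
  shows "{c. l < M c} = set (take n \<sigma>)"
proof (rule set_eqI)
  fix c
  have "c \<in> set \<sigma>" using assms(1) by (simp add: sorted_profile_def perms_def)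
  then obtain m where m: "m < length \<sigma>" "c = \<sigma> ! m" by (auto simp: in_set_conv_nth)
  have d: "distinct \<sigma>" using assms(1) by (simp add: sorted_profile_def perms_def)
  have "c \<in> set (take n \<sigma>) \<longleftrightarrow> m < n"
    using m d assms(3) by (auto simp: in_set_conv_nth nth_eq_iff_index_eq)
  moreover have "l < M c \<longleftrightarrow> m < n"
  proof
    assume "m < n"
    then have "M (\<sigma> ! (n - 1)) \<le> M (\<sigma> ! m)" using assms(1,2,3) m by (simp add: sorted_profile_def)
    then show "l < M c" using assms(4) m by simp
  next
    assume l: "l < M c"
    show "m < n"
    proof (rule ccontr)
      assume "\<not> m < n"
      then have "n < length \<sigma>" "M (\<sigma> ! m) \<le> M (\<sigma> ! n)" using assms(1) m by (auto simp: sorted_profile_def)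
      then show False using assms(5) l m by simp
    qed
  qed
  ultimately show "c \<in> {c. l < M c} \<longleftrightarrow> c \<in> set (take n \<sigma>)" by simp
qed

text \<open>Since the levels decrease along the ordering, agreement of the first \<open>n\<close>
  coordinates up to the level of the \<open>n\<close>-th one, for all \<open>n\<close>, amounts to
  agreement of each coordinate up to its own level.\<close>

lemma Bcube_cube:
  assumes "\<sigma> \<in> perms" "w \<in> Sigma_ord N a \<sigma> \<delta>" "0 < \<delta>"
  shows "Bcube N a t \<sigma> \<delta> w = cube (- ln \<delta>) w"
proof -
  have w: "w \<in> words N" using assms by (simp add: Sigma_ord_def)
  let ?L = "lev (- ln \<delta>) w"
  have sp: "sorted_profile \<sigma> ?L" by (rule Sigma_ord_sorted[OF assms])
  have "(\<forall>n\<in>{1..length \<sigma>}. \<forall>l<?L (\<sigma> ! (n - 1)). proj_idx N a t \<sigma> n (v l) = proj_idx N a t \<sigma> n (w l)) \<longleftrightarrow>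
        (\<forall>c. \<forall>l<?L c. agree c (v l) (w l))" (is "?lhs \<longleftrightarrow> ?rhs") if v: "v \<in> words N" for v
  proof
    assume l: ?lhs
    show ?rhs
    proof (intro allI impI)
      fix c l assume bmap: "l < ?L c"
      have "c \<in> set \<sigma>" using assms(1) by (simp add: perms_def)
      then obtain m where m: "m < length \<sigma>" "c = \<sigma> ! m" by (auto simp: in_set_conv_nth)
      have "proj_idx N a t \<sigma> (Suc m) (v l) = proj_idx N a t \<sigma> (Suc m) (w l)"
        using l[rule_format, of "Suc m" l] bmap m by simp
      then have "\<forall>c\<in>set (take (Suc m) \<sigma>). agree c (v l) (w l)"
        using proj_idx_eq_iff v w wordsD by blast
      moreover have "c \<in> set (take (Suc m) \<sigma>)" using m by (simp add: take_Suc_conv_app_nth)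
      ultimately show "agree c (v l) (w l)" by blast
    qed
  next
    assume r: ?rhs
    show ?lhs
    proof (intro ballI allI impI)
      fix n l assume n: "n \<in> {1..length \<sigma>}" and l: "l < ?L (\<sigma> ! (n - 1))"
      have "agree c (v l) (w l)" if c: "c \<in> set (take n \<sigma>)" for c
      proof -
        obtain m where m: "m < n" "m < length \<sigma>" "c = \<sigma> ! m"
          using c by (auto simp: in_set_conv_nth)
        then have "?L (\<sigma> ! (n - 1)) \<le> ?L c" using sp n by (auto simp: sorted_profile_def)
        then show ?thesis using r l by auto
      qed
      then show "proj_idx N a t \<sigma> n (v l) = proj_idx N a t \<sigma> n (w l)"
        using proj_idx_eq_iff v w wordsD by blast
    qed
  qed
  then show ?thesis unfolding Bcube_def cube_def cyl_def Ldelta_lev[OF w assms(3)] by blast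
qed

text \<open>The intervals in the potential tile the positions, and on the interval with index
  \<open>n\<close> exactly the first \<open>n\<close> coordinates are active. So the potential is
  \<open>q\<close> times the logarithm of the product formula for the weight.\<close>

lemma Phi_word_wt:
  assumes "\<sigma> \<in> perms" "w \<in> Sigma_ord N a \<sigma> \<delta>" "0 < \<delta>"
  shows "Phi_word N a t (psi N a t \<mu> q) \<sigma> \<delta> w = q * ln (weight w (lev (- ln \<delta>) w))"
proof -
  have w: "w \<in> words N" using assms by (simp add: Sigma_ord_def)
  let ?L = "lev (- ln \<delta>) w" let ?d = "length \<sigma>" let ?l = "Lsig a \<sigma> \<delta> w"
  have sp: "sorted_profile \<sigma> ?L" by (rule Sigma_ord_sorted[OF assms])
  have dpos: "1 \<le> ?d" using perms_length[OF assms(1)] by simp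
  have Ls: "?l n = (if n \<le> ?d then ?L (\<sigma> ! (n - 1)) else 0)" for n
    by (simp add: Lsig_def Ldelta_lev[OF w assms(3)])
  define F where "F l = q * ln (mass {c. l < ?L c} (w l))" for l
  have "Phi_word N a t (psi N a t \<mu> q) \<sigma> \<delta> w = (\<Sum>n=1..?d. \<Sum>l\<in>{?l (Suc n)..<?l n}. F l)"
    unfolding Phi_word_def
  proof (intro sum.cong refl)
    fix n l assume n: "n \<in> {1..?d}" and l: "l \<in> {?l (Suc n)..<?l n}"
    have "{c. l < ?L c} = set (take n \<sigma>)"
      by (rule sorted_profile_take[OF sp]) (use n l in \<open>auto simp: Ls split: if_splits\<close>)
    then show "psi N a t \<mu> q \<sigma> n (proj_idx N a t \<sigma> n (w l)) = F l"
      by (simp add: psi_def F_def mu_proj_mass[OF wordsD[OF w]])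
  qed
  also have "\<dots> = (\<Sum>l\<in>{?l (Suc ?d)..<?l 1}. F l)"
    by (rule conjunct1, rule sum_telescope_intervals) (use sp in \<open>auto simp: Ls sorted_profile_def\<close>)
  also have "\<dots> = (\<Sum>l<?L (\<sigma> ! 0). F l)" using dpos by (simp add: Ls atLeast0LessThan)
  also have "\<dots> = q * ln (\<Prod>l<?L (\<sigma> ! 0). mass {c. l < ?L c} (w l))"
    by (subst ln_prod) (auto simp: F_def sum_distrib_left less_imp_neq[OF mass_pos[OF wordsD[OF w]], symmetric])
  also have "(\<Prod>l<?L (\<sigma> ! 0). mass {c. l < ?L c} (w l)) = weight w ?L"
  proof (rule weight_prod[symmetric])
    fix c
    have "c \<in> set \<sigma>" using assms(1) by (simp add: perms_def)
    then show "?L c \<le> ?L (\<sigma> ! 0)" using sp by (auto simp: in_set_conv_nth sorted_profile_def)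
  qed
  finally show ?thesis .
qed

lemma ordering_exists:
  assumes "w \<in> words N"
  shows "\<exists>\<sigma>\<in>perms. w \<in> Sigma_ord N a \<sigma> \<delta>"
proof -
  define L where "L = Ldelta a \<delta> w"
  define K where "K = sum L UNIV"
  define rk where "rk c = card {c'. c' < (c::'n)}" for c
  define D where "D = Suc CARD('n)"
  \<comment> \<open>A single number that encodes the lexicographic order: larger levels first, ties
    by the order of the coordinates. Ranks stay below \<open>D\<close>, so they never outweigh a
    difference of levels.\<close>
  define f where "f c = (K - L c) * D + rk c" for c
  have LK: "L c \<le> K" for c by (simp add: K_def M_le_sum)
  have rkD: "rk c < D" for c unfolding rk_def D_def by (simp add: card_mono less_Suc_eq_le)
  have rk: "c \<le> c'" if "rk c \<le> rk c'" for c c'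
  proof (rule ccontr)
    assume "\<not> c \<le> c'"
    then have "{x. x < c'} \<subseteq> {x. x < c}" "c' \<in> {x. x < c}" "c' \<notin> {x. x < c'}" by (auto intro: less_trans)
    then have "{x. x < c'} \<subset> {x. x < c}" by blast
    then have "rk c' < rk c" unfolding rk_def by (rule psubset_card_mono[rotated]) simp
    then show False using that by simp
  qed
  obtain xs :: "'n list" where xs: "distinct xs" "set xs = UNIV" using finite_distinct_list[of "UNIV :: 'n set"] by auto
  define \<sigma> where "\<sigma> = sort_key f xs"
  have \<sigma>: "distinct \<sigma>" "set \<sigma> = UNIV" "sorted (map f \<sigma>)" using xs by (auto simp: \<sigma>_def)
  have "L (\<sigma> ! Suc k) \<le> L (\<sigma> ! k) \<and> (L (\<sigma> ! Suc k) = L (\<sigma> ! k) \<longrightarrow> \<sigma> ! Suc k > \<sigma> ! k)" if k: "Suc k < length \<sigma>" for k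
  proof -
    let ?x = "\<sigma> ! k" let ?y = "\<sigma> ! Suc k"
    have fle: "f ?x \<le> f ?y" using sorted_nth_mono[OF \<sigma>(3), of k "Suc k"] k by simp
    have ne: "?x \<noteq> ?y" using \<sigma>(1) k by (simp add: nth_eq_iff_index_eq)
    have "L ?y \<le> L ?x"
    proof (rule ccontr)
      assume "\<not> ?thesis"
      then have "Suc (K - L ?y) \<le> K - L ?x" using LK[of ?x] LK[of ?y] by linarith
      then have "Suc (K - L ?y) * D \<le> (K - L ?x) * D" by (rule mult_le_mono1)
      then show False using fle rkD[of ?y] by (simp add: f_def)
    qed
    moreover have "?y > ?x" if "L ?y = L ?x"
      using fle that ne rk[of ?x ?y] by (simp add: f_def)
    ultimately show ?thesis by blast
  qed
  then have "w \<in> Sigma_ord N a \<sigma> \<delta>" using assms by (simp add: Sigma_ord_def ordered_at_def L_def)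
  moreover have "\<sigma> \<in> perms" using \<sigma> by (simp add: perms_def)
  ultimately show ?thesis by blast
qed

lemma sorted_profile_exists:
  assumes "w \<in> words N" "0 < s"
  shows "\<exists>\<sigma>\<in>Aall N a. sorted_profile \<sigma> (lev s w)"
proof -
  define \<delta> where "\<delta> = exp (- s)"
  have \<delta>: "0 < \<delta>" "\<delta> < 1" "- ln \<delta> = s" using assms by (auto simp: \<delta>_def)
  obtain \<sigma> where \<sigma>: "\<sigma> \<in> perms" "w \<in> Sigma_ord N a \<sigma> \<delta>" using ordering_exists[OF assms(1)] by blast
  then have "\<sigma> \<in> Adelta N a \<delta>" by (auto simp: Adelta_def)
  then have "\<sigma> \<in> Aall N a" unfolding Aall_def using \<delta> by auto
  then show ?thesis using Sigma_ord_sorted[OF \<sigma> \<delta>(1)] \<delta> by auto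
qed

definition pressure_sum :: "real \<Rightarrow> real \<Rightarrow> real" where
  "pressure_sum q \<delta> = (\<Sum>\<sigma>\<in>Adelta N a \<delta>. \<Sum>B\<in>Bcubes N a t \<sigma> \<delta>. exp (Phi_cube N a t (psi N a t \<mu> q) \<sigma> \<delta> B))"

text \<open>Every cube occurs for at least one ordering and for no more orderings than there are
  permutations, so the double sum and the sum over cubes agree up to a constant factor.\<close>

lemma pressure_sum_bounds:
  assumes "0 < \<delta>" "\<delta> < 1"
  shows "cube_sum q (- ln \<delta>) \<le> pressure_sum q \<delta>"
    and "pressure_sum q \<delta> \<le> real (card (perms :: 'n list set)) * cube_sum q (- ln \<delta>)"
proof -
  let ?s = "- ln \<delta>"
  have s: "0 \<le> ?s" using assms by simp
  have summand: "exp (Phi_cube N a t (psi N a t \<mu> q) \<sigma> \<delta> B) = measure Bern B powr q"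
    if "\<sigma> \<in> perms" "B \<in> Bcubes N a t \<sigma> \<delta>" for \<sigma> B
  proof -
    \<comment> \<open>Whatever word \<open>SOME\<close> picks, the potential is \<open>q\<close>
      times the logarithm of the measure of the cube, so the choice has no influence.\<close>
    define w where "w = (SOME w. w \<in> Sigma_ord N a \<sigma> \<delta> \<and> B = Bcube N a t \<sigma> \<delta> w)"
    have "\<exists>w. w \<in> Sigma_ord N a \<sigma> \<delta> \<and> B = Bcube N a t \<sigma> \<delta> w" using that by (auto simp: Bcubes_def)
    from someI_ex[OF this] have w: "w \<in> Sigma_ord N a \<sigma> \<delta>" "B = Bcube N a t \<sigma> \<delta> w" by (auto simp: w_def)
    have "Phi_cube N a t (psi N a t \<mu> q) \<sigma> \<delta> B = q * ln (weight w (lev ?s w))"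
      unfolding Phi_cube_def w_def[symmetric] by (rule Phi_word_wt[OF that(1) w(1) assms(1)])
    moreover have "weight w (lev ?s w) = measure Bern B"
      using w Bcube_cube[OF that(1) w(1) assms(1)] by (simp add: weight_def cube_def)
    moreover have "0 < weight w (lev ?s w)" using w by (intro weight_pos) (simp add: Sigma_ord_def)
    ultimately show ?thesis by (simp add: powr_def)
  qed
  have sub: "Bcubes N a t \<sigma> \<delta> \<subseteq> cubes ?s" if "\<sigma> \<in> perms" for \<sigma>
    using Bcube_cube[OF that _ assms(1)] by (auto simp: Bcubes_def cubes_def Sigma_ord_def)
  have fA: "finite (Adelta N a \<delta>)" "Adelta N a \<delta> \<subseteq> perms"
    by (auto simp: Adelta_def intro: finite_subset[OF _ finite_perms])
  have eq: "pressure_sum q \<delta> = (\<Sum>\<sigma>\<in>Adelta N a \<delta>. \<Sum>B\<in>Bcubes N a t \<sigma> \<delta>. measure Bern B powr q)"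
    unfolding pressure_sum_def by (intro sum.cong refl) (use summand fA in auto)
  have fB: "finite (Bcubes N a t \<sigma> \<delta>)" if "\<sigma> \<in> perms" for \<sigma>
    using sub[OF that] finite_cubes[OF s] finite_subset by blast
  have cov: "cubes ?s \<subseteq> (\<Union>\<sigma>\<in>Adelta N a \<delta>. Bcubes N a t \<sigma> \<delta>)"
  proof
    fix B assume "B \<in> cubes ?s"
    then obtain w where w: "w \<in> words N" "B = cube ?s w" by (auto simp: cubes_def)
    obtain \<sigma> where \<sigma>: "\<sigma> \<in> perms" "w \<in> Sigma_ord N a \<sigma> \<delta>" using ordering_exists[OF w(1)] by blast
    then show "B \<in> (\<Union>\<sigma>\<in>Adelta N a \<delta>. Bcubes N a t \<sigma> \<delta>)"
      using Bcube_cube[OF \<sigma> assms(1)] w by (auto simp: Adelta_def Bcubes_def)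
  qed
  have "cube_sum q ?s \<le> (\<Sum>B\<in>(\<Union>\<sigma>\<in>Adelta N a \<delta>. Bcubes N a t \<sigma> \<delta>). measure Bern B powr q)"
    unfolding cube_sum_def by (rule sum_mono2) (use cov fA fB in auto)
  also have "\<dots> \<le> (\<Sum>\<sigma>\<in>Adelta N a \<delta>. \<Sum>B\<in>Bcubes N a t \<sigma> \<delta>. measure Bern B powr q)"
    by (rule sum_UN_le) (use fA fB in auto)
  finally show "cube_sum q ?s \<le> pressure_sum q \<delta>" unfolding eq .
  have "pressure_sum q \<delta> \<le> (\<Sum>\<sigma>\<in>Adelta N a \<delta>. cube_sum q ?s)"
    unfolding eq cube_sum_def by (intro sum_mono sum_mono2) (use sub fA finite_cubes[OF s] in auto)
  also have "\<dots> \<le> real (card (perms :: 'n list set)) * cube_sum q ?s"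
    using card_mono[OF finite_perms fA(2)] cube_sum_pos[OF s, of q] by (simp add: mult_right_mono)
  finally show "pressure_sum q \<delta> \<le> real (card (perms :: 'n list set)) * cube_sum q ?s" .
qed

text \<open>\<open>pressure\<close> is defined by \<open>Lim\<close>, which is meaningful only if
  the limit exists; existence is supplied by \<open>cube_sum_limit_exists\<close>.\<close>

lemma pressure_limit: "((\<lambda>s. ln (cube_sum q s) / s) \<longlongrightarrow> pressure N a t (psi N a t \<mu> q)) at_top"
proof -
  obtain P where P: "((\<lambda>s. ln (cube_sum q s) / s) \<longlongrightarrow> P) at_top" using cube_sum_limit_exists by blast
  define C where "C = real (card (perms :: 'n list set))"
  have lo: "((\<lambda>\<delta>. ln (cube_sum q (- ln \<delta>)) / (- ln \<delta>)) \<longlongrightarrow> P) (at_right 0)"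
    by (rule tendsto_neg_ln_at_right_0[OF P])
  have "((\<lambda>s. ln C / s + ln (cube_sum q s) / s) \<longlongrightarrow> 0 + P) at_top"
    by (intro tendsto_add P tendsto_divide_0[OF tendsto_const] filterlim_at_top_imp_at_infinity filterlim_ident)
  then have hi: "((\<lambda>\<delta>. ln C / (- ln \<delta>) + ln (cube_sum q (- ln \<delta>)) / (- ln \<delta>)) \<longlongrightarrow> P) (at_right 0)"
    using tendsto_neg_ln_at_right_0 by fastforce
  have ev: "\<forall>\<^sub>F \<delta> in at_right (0::real). 0 < \<delta> \<and> \<delta> < 1"
    by (auto simp: eventually_at_right_field intro: exI[of _ 1])
  have "((\<lambda>\<delta>. ln (pressure_sum q \<delta>) / (- ln \<delta>)) \<longlongrightarrow> P) (at_right 0)"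
  proof (rule tendsto_sandwich[OF _ _ lo hi])
    show "\<forall>\<^sub>F \<delta> in at_right 0. ln (cube_sum q (- ln \<delta>)) / (- ln \<delta>) \<le> ln (pressure_sum q \<delta>) / (- ln \<delta>)"
      using ev
    proof eventually_elim
      case (elim \<delta>)
      then have "0 < cube_sum q (- ln \<delta>)" by (intro cube_sum_pos) simp
      then have "ln (cube_sum q (- ln \<delta>)) \<le> ln (pressure_sum q \<delta>)" using pressure_sum_bounds(1)[of \<delta> q] elim by simp
      then show ?case using elim by (intro divide_right_mono) auto
    qed
    show "\<forall>\<^sub>F \<delta> in at_right 0. ln (pressure_sum q \<delta>) / (- ln \<delta>) \<le> ln C / (- ln \<delta>) + ln (cube_sum q (- ln \<delta>)) / (- ln \<delta>)"
      using ev
    proof eventually_elim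
      case (elim \<delta>)
      then have Sp: "0 < cube_sum q (- ln \<delta>)" by (intro cube_sum_pos) simp
      have pp: "0 < pressure_sum q \<delta>" using pressure_sum_bounds(1)[of \<delta> q] elim Sp by linarith
      have le: "pressure_sum q \<delta> \<le> C * cube_sum q (- ln \<delta>)" using pressure_sum_bounds(2)[of \<delta> q] elim by (simp add: C_def)
      then have Cp: "0 < C" using pp Sp by (smt (verit) zero_less_mult_pos2)
      have "ln (pressure_sum q \<delta>) \<le> ln (C * cube_sum q (- ln \<delta>))" using le pp by simp
      also have "\<dots> = ln C + ln (cube_sum q (- ln \<delta>))" using Cp Sp by (simp add: ln_mult)
      finally have "ln (pressure_sum q \<delta>) / (- ln \<delta>) \<le> (ln C + ln (cube_sum q (- ln \<delta>))) / (- ln \<delta>)"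
        using elim by (intro divide_right_mono) auto
      then show ?case by (simp add: add_divide_distrib)
    qed
  qed
  then have "pressure N a t (psi N a t \<mu> q) = P"
    unfolding pressure_def pressure_sum_def by (intro tendsto_Lim) auto
  with P show ?thesis by simp
qed

section \<open>The measure, its support, and separation of boxes\<close>

abbreviation cd :: "(nat \<Rightarrow> nat) \<Rightarrow> real^'n::{finite,linorder}" where "cd \<equiv> coding a t"

definition attractor :: "(real^'n::{finite,linorder}) set" where "attractor = cd ` words N"

abbreviation \<nu> :: "(real^'n::{finite,linorder}) measure" where "\<nu> \<equiv> self_affine_measure N a t \<mu>"

lemma letter_measurable:
  fixes f :: "nat \<Rightarrow> real"
  shows "(\<lambda>w. f (w k)) \<in> borel_measurable Bern"
proof -
  have 1: "(\<lambda>w. w k) \<in> measurable Bern (point_measure (Idx N) (\<lambda>i. ennreal (\<mu> i)))"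
    unfolding Bern_def by (rule measurable_component_singleton) simp
  have "f \<in> borel_measurable (point_measure (Idx N) (\<lambda>i. ennreal (\<mu> i)))" by simp
  from measurable_compose[OF 1 this] show ?thesis .
qed

lemma cmap_measurable:
  assumes "X \<in> borel_measurable Bern"
  shows "(\<lambda>w. cmap w c k (X w)) \<in> borel_measurable Bern"
  using assms
proof (induction k arbitrary: X)
  case (Suc k)
  have "(\<lambda>w. a (w k) c * X w + t (w k) $ c) \<in> borel_measurable Bern"
    using letter_measurable[of "\<lambda>i. a i c" k] letter_measurable[of "\<lambda>i. t i $ c" k] Suc.prems
    by (intro borel_measurable_add borel_measurable_times)
  from Suc.IH[OF this] show ?case by simp
qed simp

lemma coding_measurable [measurable]: "cd \<in> borel_measurable Bern"
proof (subst borel_measurable_euclidean_space, rule ballI)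
  fix b :: "real^'n::{finite,linorder}" assume "b \<in> Basis"
  then obtain c where b: "b = axis c 1" by (auto simp: Basis_vec_def)
  have "(\<lambda>w. cd w $ c) \<in> borel_measurable Bern"
    by (rule borel_measurable_LIMSEQ_metric[of "\<lambda>k w. cmap w c k 0"])
      (auto intro: cmap_measurable cmap_tendsto_coding simp: space_Bern)
  then show "(\<lambda>w. cd w \<bullet> b) \<in> borel_measurable Bern"
    by (simp add: b cart_eq_inner_axis[symmetric])
qed

lemma nu_measure: "A \<in> sets borel \<Longrightarrow> measure \<nu> A = measure Bern {w \<in> words N. cd w \<in> A}"
  unfolding self_affine_measure_def Bern_def[symmetric]
  by (subst measure_distr) (auto simp: space_Bern vimage_def Int_def conj_commute intro: coding_measurable)

lemma nu_emeasure: "A \<in> sets borel \<Longrightarrow> emeasure \<nu> A = ennreal (measure Bern {w \<in> words N. cd w \<in> A})"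
  unfolding self_affine_measure_def Bern_def[symmetric]
  by (subst emeasure_distr)
    (auto simp: space_Bern vimage_def Int_def conj_commute Bern.emeasure_eq_measure intro: coding_measurable)

lemma pre_sets: "A \<in> sets borel \<Longrightarrow> {w \<in> words N. cd w \<in> A} \<in> sets Bern"
  using measurable_sets[OF coding_measurable, of A]
  by (simp add: space_Bern vimage_def Int_def conj_commute)

lemma cube_coding_dist:
  assumes "w \<in> words N" "v \<in> cube s w"
  shows "\<bar>cd v $ c - cd w $ c\<bar> \<le> exp (- s)"
proof -
  have "\<bar>cd v $ c - cd w $ c\<bar> \<le> exp (- tau w c (lev s w c))"
    by (rule coding_dist) (use assms in \<open>auto simp: cube_def cyl_def\<close>)
  also have "\<dots> \<le> exp (- s)" using lev_ge[OF assms(1), of s c] by simp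
  finally show ?thesis .
qed

text \<open>Words in one cube are coded within \<open>exp (- s)\<close> of each other in every
  coordinate; \<open>dist_vec_le\<close> turns this into a distance at the price of the
  dimension.\<close>

lemma nu_ball_lower:
  assumes "w \<in> words N" "real CARD('n) * exp (- s) \<le> r"
  shows "weight w (lev s w) \<le> measure \<nu> (cball (cd w) r)"
proof -
  have "cube s w \<subseteq> {v \<in> words N. cd v \<in> cball (cd w) r}"
  proof
    fix v assume v: "v \<in> cube s w"
    have "dist (cd v) (cd w) \<le> real CARD('n) * exp (- s)"
      by (rule dist_vec_le) (rule cube_coding_dist[OF assms(1) v])
    then show "v \<in> {v \<in> words N. cd v \<in> cball (cd w) r}"
      using assms(2) v by (auto simp: dist_commute cube_def cyl_def)
  qed
  then show ?thesis unfolding weight_def cube_def[symmetric]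
    by (subst nu_measure) (auto intro!: Bern.finite_measure_mono pre_sets simp del: mem_cball)
qed

lemma exp_scale_exists:
  assumes "0 < e" obtains s where "0 \<le> s" "real CARD('n) * exp (- s) \<le> e"
proof -
  define s where "s = \<bar>ln (e / real CARD('n))\<bar>"
  have "exp (- s) \<le> exp (ln (e / real CARD('n)))" unfolding s_def by simp
  also have "\<dots> = e / real CARD('n)" using assms by simp
  finally have "real CARD('n) * exp (- s) \<le> e" by (simp add: field_simps)
  then show thesis using that[of s] by (simp add: s_def)
qed

section \<open>The attractor: compactness and identification with the sponge and the support\<close>

lemma compact_words: "compact (words N)"
proof -
  have "words N = PiE UNIV (\<lambda>_. Idx N)" by (auto simp: words_def)
  moreover have "compactin (product_topology (\<lambda>_::nat. euclidean :: nat topology) UNIV) (PiE UNIV (\<lambda>_. Idx N))"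
    by (subst compactin_PiE) (auto intro: finite_imp_compact)
  ultimately show ?thesis by (simp add: euclidean_product_topology)
qed

lemma coding_continuous: "continuous_on (words N) cd"
  unfolding continuous_on_topological
proof (intro ballI allI impI)
  fix w B assume w: "w \<in> words N" and B: "open B" "cd w \<in> B"
  then obtain e where e: "0 < e" "cball (cd w) e \<subseteq> B" using open_contains_cball by metis
  obtain s where s: "0 \<le> s" "real CARD('n) * exp (- s) \<le> e" using exp_scale_exists[OF e(1)] by blast
  define k where "k = sum (lev s w) UNIV"
  \<comment> \<open>Fixing finitely many letters is an open condition, and with \<open>k\<close> at
    least every level it keeps a word inside the cube of \<open>w\<close>.\<close>
  define A where "A = {v. \<forall>l\<in>{..<k}. v l \<in> {w l}}"
  have "open A" unfolding A_def
    by (rule product_topology_basis'[where x = id, simplified]) (auto intro: Topological_Spaces.open_discrete)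
  moreover have "cd v \<in> B" if "v \<in> words N" "v \<in> A" for v
  proof -
    have "l < k" if "l < lev s w c" for l c using M_le_sum[of "lev s w" c] that by (simp add: k_def)
    then have "v \<in> cube s w" unfolding cube_def cyl_def using that by (auto simp: A_def)
    then have "dist (cd v) (cd w) \<le> real CARD('n) * exp (- s)"
      by (intro dist_vec_le cube_coding_dist[OF w])
    then have "cd v \<in> cball (cd w) e" using s by (simp add: dist_commute)
    then show ?thesis using e by blast
  qed
  ultimately show "\<exists>A. open A \<and> w \<in> A \<and> (\<forall>y\<in>words N. y \<in> A \<longrightarrow> cd y \<in> B)"
    by (intro exI[of _ A]) (auto simp: A_def)
qed

lemma compact_attractor: "compact attractor"
  unfolding attractor_def by (rule compact_continuous_image[OF coding_continuous compact_words])

lemma attractor_nonempty: "attractor \<noteq> {}"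
  using words_nonempty by (simp add: attractor_def)

lemma coding_Cons:
  assumes "w \<in> words N"
  shows "cd w = fmap a t (w 0) (cd (shift 1 w))"
  using coding_shift[OF assms, of _ 1] by (simp add: vec_eq_iff fmap_def)

lemma attractor_invariant: "attractor = (\<Union>i\<in>Idx N. fmap a t i ` attractor)"
proof
  show "attractor \<subseteq> (\<Union>i\<in>Idx N. fmap a t i ` attractor)"
    unfolding attractor_def using coding_Cons shift_words wordsD by blast
  show "(\<Union>i\<in>Idx N. fmap a t i ` attractor) \<subseteq> attractor"
  proof
    fix x assume "x \<in> (\<Union>i\<in>Idx N. fmap a t i ` attractor)"
    then obtain i w where i: "i \<in> Idx N" "w \<in> words N" "x = fmap a t i (cd w)" by (auto simp: attractor_def)
    define v where "v l = (case l of 0 \<Rightarrow> i | Suc l \<Rightarrow> w l)" for l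
    have v: "v \<in> words N" using i by (auto simp: v_def words_def split: nat.split)
    have "shift 1 v = w" "v 0 = i" by (auto simp: shift_def v_def)
    then have "cd v = x" using coding_Cons[OF v] i by simp
    then show "x \<in> attractor" using v by (auto simp: attractor_def)
  qed
qed

lemma comp_first_nth_dist:
  assumes "w \<in> words N"
  shows "\<bar>comp_first a t k w x $ c - cd w $ c\<bar> \<le> exp (- (real k * hmin)) * (\<bar>x $ c\<bar> + 1)"
proof -
  have "comp_first a t k w x $ c - cd w $ c = slope w c k * (x $ c - cd (shift k w) $ c)"
    unfolding comp_first_nth coding_shift[OF assms, of c k] by (rule cmap_diff)
  then have "\<bar>comp_first a t k w x $ c - cd w $ c\<bar> = exp (- tau w c k) * \<bar>x $ c - cd (shift k w) $ c\<bar>"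
    by (simp add: abs_mult abs_slope[OF assms])
  also have "\<dots> \<le> exp (- (real k * hmin)) * (\<bar>x $ c\<bar> + 1)"
    using tau_bounds(1)[OF assms, of k c] coding_interval[OF shift_words[OF assms], of k c]
    by (intro mult_mono) auto
  finally show ?thesis .
qed

text \<open>The starting points may change with \<open>k\<close> as long as they stay bounded; this
  is what following a point of an invariant set backwards requires.\<close>

lemma comp_first_tendsto:
  assumes "w \<in> words N" "\<And>k. norm (x k) \<le> C"
  shows "(\<lambda>k. comp_first a t k w (x k)) \<longlonglongrightarrow> cd w"
proof (rule vec_tendstoI)
  fix c
  have "(\<lambda>k. exp (- (real k * hmin)) * (C + 1)) \<longlonglongrightarrow> 0 * (C + 1)"
  proof (rule tendsto_mult_right)
    have "(\<lambda>k. exp (- hmin) ^ k) \<longlonglongrightarrow> 0" using hmin_pos by (intro LIMSEQ_realpow_zero) auto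
    then show "(\<lambda>k. exp (- (real k * hmin))) \<longlonglongrightarrow> 0" by (simp add: exp_of_nat_mult[symmetric])
  qed
  then have lim: "(\<lambda>k. exp (- (real k * hmin)) * (C + 1)) \<longlonglongrightarrow> 0" by simp
  have "(\<lambda>k. comp_first a t k w (x k) $ c - cd w $ c) \<longlonglongrightarrow> 0"
  proof (rule Lim_null_comparison[OF _ lim], intro always_eventually allI)
    fix k
    have "\<bar>comp_first a t k w (x k) $ c - cd w $ c\<bar> \<le> exp (- (real k * hmin)) * (\<bar>x k $ c\<bar> + 1)"
      by (rule comp_first_nth_dist[OF assms(1)])
    also have "\<dots> \<le> exp (- (real k * hmin)) * (C + 1)"
      using assms(2)[of k] component_le_norm_cart[of "x k" c] by (intro mult_left_mono) auto
    finally show "norm (comp_first a t k w (x k) $ c - cd w $ c) \<le> exp (- (real k * hmin)) * (C + 1)" by simp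
  qed
  then show "(\<lambda>k. comp_first a t k w (x k) $ c) \<longlonglongrightarrow> cd w $ c" by (simp add: LIM_zero_iff)
qed

text \<open>Images of any point of an invariant compact set stay in it and converge to the coded
  points, which gives one inclusion of the uniqueness claim. For the other, a point is pulled back
  indefinitely; the letters used on the way form a word that codes it.\<close>

lemma sponge_eq_attractor: "Defs.sponge N a t = attractor"
  unfolding sponge_def
proof (rule the_equality)
  show "attractor \<noteq> {} \<and> compact attractor \<and> attractor = (\<Union>i\<in>Idx N. fmap a t i ` attractor)"
    using attractor_nonempty compact_attractor attractor_invariant by blast
next
  fix G :: "(real^'n::{finite,linorder}) set"
  assume G: "G \<noteq> {} \<and> compact G \<and> G = (\<Union>i\<in>Idx N. fmap a t i ` G)"
  then obtain C where C: "\<And>x. x \<in> G \<Longrightarrow> norm x \<le> C" using compact_imp_bounded bounded_iff by metis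
  show "G = attractor"
  proof
    show "attractor \<subseteq> G"
    proof
      fix x assume "x \<in> attractor"
      then obtain w where w: "w \<in> words N" "x = cd w" by (auto simp: attractor_def)
      obtain y where y: "y \<in> G" using G by blast
      have fG: "fmap a t i z \<in> G" if "i \<in> Idx N" "z \<in> G" for i z using G that by blast
      have "comp_first a t k w z \<in> G" if "z \<in> G" for k z
        using that by (induction k arbitrary: z) (auto intro: fG wordsD[OF w(1)])
      moreover have "(\<lambda>k. comp_first a t k w y) \<longlonglongrightarrow> x"
        unfolding w(2) by (rule comp_first_tendsto[OF w(1)]) (rule C[OF y])
      moreover have "closed G" using G compact_imp_closed by blast
      ultimately show "x \<in> G" using y closed_sequentially[of G "\<lambda>k. comp_first a t k w y" x] by blast
    qed
    show "G \<subseteq> attractor"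
    proof
      fix x assume x: "x \<in> G"
      have "\<forall>z\<in>G. \<exists>i z'. i \<in> Idx N \<and> z' \<in> G \<and> z = fmap a t i z'" using G by blast
      then obtain ix nx where nx: "\<And>z. z \<in> G \<Longrightarrow> ix z \<in> Idx N \<and> nx z \<in> G \<and> z = fmap a t (ix z) (nx z)" by metis
      define xs where "xs k = (nx ^^ k) x" for k
      have xsG: "xs k \<in> G" for k by (induction k) (use x nx in \<open>auto simp: xs_def\<close>)
      define w where "w k = ix (xs k)" for k
      have w: "w \<in> words N" using nx xsG by (simp add: w_def words_def)
      have xeq: "comp_first a t k w (xs k) = x" for k
      proof (induction k)
        case (Suc k)
        have "xs k = fmap a t (w k) (xs (Suc k))" using nx[OF xsG[of k]] by (simp add: w_def xs_def)
        then show ?case using Suc by simp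
      qed (simp add: xs_def)
      have "(\<lambda>k. comp_first a t k w (xs k)) \<longlonglongrightarrow> x" unfolding xeq by (rule tendsto_const)
      moreover have "(\<lambda>k. comp_first a t k w (xs k)) \<longlonglongrightarrow> cd w" by (rule comp_first_tendsto[OF w]) (rule C[OF xsG])
      ultimately show "x \<in> attractor" using w LIMSEQ_unique by (auto simp: attractor_def)
    qed
  qed
qed

lemma msupport_attractor: "msupport \<nu> = attractor"
proof
  show "attractor \<subseteq> msupport \<nu>"
  proof
    fix x assume "x \<in> attractor"
    then obtain w where w: "w \<in> words N" "x = cd w" by (auto simp: attractor_def)
    have "emeasure \<nu> (ball x e) \<noteq> 0" if e: "0 < e" for e
    proof -
      have e2: "0 < e / 2" using e by simp
      obtain s where s: "0 \<le> s" "real CARD('n) * exp (- s) \<le> e / 2" using exp_scale_exists[OF e2] by blast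
      have "0 < weight w (lev s w)" by (rule weight_pos[OF w(1)])
      also have "\<dots> \<le> measure \<nu> (cball x (e / 2))" unfolding w(2) by (rule nu_ball_lower[OF w(1) s(2)])
      also have "\<dots> \<le> measure Bern {v \<in> words N. cd v \<in> ball x e}"
        by (subst nu_measure) (use e in \<open>auto intro!: Bern.finite_measure_mono pre_sets[of "ball x e", unfolded mem_ball]\<close>)
      finally show ?thesis by (simp add: nu_emeasure ennreal_eq_0_iff)
    qed
    then show "x \<in> msupport \<nu>" by (simp add: msupport_def)
  qed
  show "msupport \<nu> \<subseteq> attractor"
  proof (rule ccontr)
    assume "\<not> ?thesis"
    then obtain x where x: "x \<in> msupport \<nu>" "x \<notin> attractor" by blast
    have "open (- attractor)" using compact_attractor compact_imp_closed by blast
    then obtain e where e: "0 < e" "ball x e \<subseteq> - attractor" using x(2) open_contains_ball by (metis ComplI)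
    have "{v \<in> words N. cd v \<in> ball x e} = {}" using e by (auto simp: attractor_def)
    then have "emeasure \<nu> (ball x e) = 0" by (subst nu_emeasure) (simp_all del: mem_ball Collect_empty_eq)
    then show False using x(1) e(1) by (simp add: msupport_def)
  qed
qed

text \<open>The image of the open unit interval under the first \<open>M c\<close> maps in each
  coordinate \<open>c\<close>. Normalising by the signed slope avoids a distinction by
  orientation.\<close>

definition open_box :: "(nat \<Rightarrow> nat) \<Rightarrow> ('n \<Rightarrow> nat) \<Rightarrow> (real^'n::{finite,linorder}) set" where
  "open_box w M = {y. \<forall>c. 0 < (y $ c - cmap w c (M c) 0) / slope w c (M c) \<and> (y $ c - cmap w c (M c) 0) / slope w c (M c) < 1}"

lemma cmap_inv: "w \<in> words N \<Longrightarrow> (cmap w c k x - cmap w c k 0) / slope w c k = x"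
  using cmap_affine[of w c k x] slope_nz[of w c k] by simp

lemma open_box_iff:
  assumes "w \<in> words N"
  shows "y \<in> open_box w M \<longleftrightarrow> (\<exists>x. \<forall>c. 0 < x c \<and> x c < 1 \<and> y $ c = cmap w c (M c) (x c))"
proof
  assume y: "y \<in> open_box w M"
  have "y $ c = cmap w c (M c) ((y $ c - cmap w c (M c) 0) / slope w c (M c))" for c
    using cmap_affine[of w c "M c" "(y $ c - cmap w c (M c) 0) / slope w c (M c)"] slope_nz[OF assms, of c "M c"] by simp
  then show "\<exists>x. \<forall>c. 0 < x c \<and> x c < 1 \<and> y $ c = cmap w c (M c) (x c)"
    using y unfolding open_box_def by (intro exI[of _ "\<lambda>c. (y $ c - cmap w c (M c) 0) / slope w c (M c)"]) auto
next
  assume "\<exists>x. \<forall>c. 0 < x c \<and> x c < 1 \<and> y $ c = cmap w c (M c) (x c)"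
  then show "y \<in> open_box w M" unfolding open_box_def using cmap_inv[OF assms] by auto
qed

text \<open>In normalised coordinates the sides have length 1, so a displacement by less than
  \<open>r\<close> sides cannot leave the box from a point at depth \<open>r\<close>.\<close>

lemma open_box_near:
  assumes w: "w \<in> words N"
    and "\<And>c. \<bar>y $ c - cmap w c (M c) (x c)\<bar> < r * exp (- tau w c (M c))" "\<And>c. r \<le> x c \<and> x c \<le> 1 - r"
  shows "y \<in> open_box w M"
proof -
  have "0 < (y $ c - cmap w c (M c) 0) / slope w c (M c) \<and> (y $ c - cmap w c (M c) 0) / slope w c (M c) < 1" for c
  proof -
    let ?s = "slope w c (M c)"
    have nz: "?s \<noteq> 0" by (rule slope_nz[OF w])
    have "(y $ c - cmap w c (M c) 0) / ?s - x c = (y $ c - cmap w c (M c) (x c)) / ?s"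
      using cmap_affine[of w c "M c" "x c"] nz by (simp add: field_simps)
    then have "\<bar>(y $ c - cmap w c (M c) 0) / ?s - x c\<bar> = \<bar>y $ c - cmap w c (M c) (x c)\<bar> / exp (- tau w c (M c))"
      by (simp add: abs_slope[OF w])
    also have "\<dots> < r" using assms(2)[of c] by (simp add: pos_divide_less_eq)
    finally show ?thesis using assms(3)[of c] by linarith
  qed
  then show ?thesis by (simp add: open_box_def)
qed

text \<open>Induction on the position. Earlier letters agree in the active coordinates and can be
  stripped; then the projections of the open images of the two letters at position \<open>l\<close>
  share a point, and the SPPC leaves only exact overlap. The ordering enters because the SPPC speaks
  of initial segments of admissible orderings.\<close>

lemma separation:
  assumes \<sigma>: "\<sigma> \<in> Aall N a" "sorted_profile \<sigma> M"
    and v: "v \<in> words N" and w: "w \<in> words N"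
    and y: "y \<in> open_box v M" "y \<in> open_box w M"
  shows "v \<in> cyl w M"
proof -
  obtain p where p: "\<And>c. 0 < p c \<and> p c < 1 \<and> y $ c = cmap v c (M c) (p c)" using y(1) open_box_iff[OF v] by metis
  obtain r where r: "\<And>c. 0 < r c \<and> r c < 1 \<and> y $ c = cmap w c (M c) (r c)" using y(2) open_box_iff[OF w] by metis
  have "\<forall>c. l < M c \<longrightarrow> agree c (v l) (w l)" for l
  proof (induction l rule: less_induct)
    case (less l)
    \<comment> \<open>The number of coordinates active at position \<open>l\<close>.\<close>
    define n where "n = (LEAST n. n = length \<sigma> \<or> M (\<sigma> ! n) \<le> l)"
    have n1: "n = length \<sigma> \<or> M (\<sigma> ! n) \<le> l" unfolding n_def by (rule LeastI[of _ "length \<sigma>"]) simp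
    have n2: "n \<le> length \<sigma>" unfolding n_def by (rule Least_le) simp
    show ?case
    proof (cases "n = 0")
      case True
      have "length \<sigma> \<noteq> 0" using \<sigma>(2) perms_length[of \<sigma>] by (auto simp: sorted_profile_def)
      then have 0: "M (\<sigma> ! 0) \<le> l" using n1 True by auto
      have "M c \<le> l" for c
      proof -
        have "c \<in> set \<sigma>" using \<sigma>(2) by (simp add: sorted_profile_def perms_def)
        then obtain m where "m < length \<sigma>" "c = \<sigma> ! m" by (auto simp: in_set_conv_nth)
        then have "M c \<le> M (\<sigma> ! 0)" using \<sigma>(2) by (simp add: sorted_profile_def)
        then show ?thesis using 0 by simp
      qed
      then show ?thesis by (metis leD)
    next
      case False
      have "l < M (\<sigma> ! (n - 1))"
        using not_less_Least[of "n - 1" "\<lambda>n. n = length \<sigma> \<or> M (\<sigma> ! n) \<le> l"] False by (simp add: n_def[symmetric])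
      then have A: "{c. l < M c} = set (take n \<sigma>)"
        by (intro sorted_profile_take[OF \<sigma>(2)]) (use False n1 n2 in auto)
      have "\<exists>x' x''. 0 < x' \<and> x' < 1 \<and> 0 < x'' \<and> x'' < 1 \<and>
          (l < M c \<longrightarrow> a (v l) c * x' + t (v l) $ c = a (w l) c * x'' + t (w l) $ c)" for c
      proof (cases "l < M c")
        case True
        then obtain j where j: "M c = Suc l + j" using less_imp_Suc_add by fastforce
        define x' where "x' = cmap (shift (Suc l) v) c j (p c)"
        define x'' where "x'' = cmap (shift (Suc l) w) c j (r c)"
        have x: "0 < x' \<and> x' < 1" "0 < x'' \<and> x'' < 1"
          unfolding x'_def x''_def
          using p[of c] r[of c] cmap_open_interval[OF shift_words[OF v]] cmap_open_interval[OF shift_words[OF w]] by blast+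
        have "y $ c = cmap v c (Suc l) x'" "y $ c = cmap w c (Suc l) x''"
          using p[of c] r[of c] unfolding j cmap_add x'_def x''_def by auto
        then have "cmap v c l (a (v l) c * x' + t (v l) $ c) = cmap w c l (a (w l) c * x'' + t (w l) $ c)" by simp
        moreover have "cmap v c l z = cmap w c l z" for z
          by (rule cmap_cong) (use less True in auto)
        ultimately have "cmap w c l (a (v l) c * x' + t (v l) $ c) = cmap w c l (a (w l) c * x'' + t (w l) $ c)" by simp
        then have "a (v l) c * x' + t (v l) $ c = a (w l) c * x'' + t (w l) $ c" using cmap_inv[OF w] by metis
        then show ?thesis using x by blast
      next
        case False
        \<comment> \<open>In an inactive coordinate any interior value serves, as the projection
          discards it.\<close>
        then show ?thesis by (intro exI[of _ "1/2"]) simp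
      qed
      then obtain X' X'' where X: "\<And>c. 0 < X' c \<and> X' c < 1 \<and> 0 < X'' c \<and> X'' c < 1 \<and>
          (l < M c \<longrightarrow> a (v l) c * X' c + t (v l) $ c = a (w l) c * X'' c + t (w l) $ c)" by metis
      have o: "(\<chi> c. X' c) \<in> open_unitcube" "(\<chi> c. X'' c) \<in> open_unitcube" using X by (auto simp: open_unitcube_def)
      have "proj \<sigma> n (fmap a t (v l) (\<chi> c. X' c)) = proj \<sigma> n (fmap a t (w l) (\<chi> c. X'' c))"
        using X A by (auto simp: proj_def Ecoords_def fmap_def vec_eq_iff)
      then have "proj \<sigma> n ` fmap a t (v l) ` open_unitcube \<inter> proj \<sigma> n ` fmap a t (w l) ` open_unitcube \<noteq> {}"
        using o by (metis disjoint_iff imageI)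
      moreover have "n \<in> {1..CARD('n)}" using False n2 perms_length[of \<sigma>] \<sigma>(2) by (auto simp: sorted_profile_def Suc_le_eq)
      ultimately have "overlap_exactly a t \<sigma> n (v l) (w l)"
        using sppc \<sigma>(1) wordsD[OF v, of l] wordsD[OF w, of l] unfolding SPPC_def by blast
      then show ?thesis using A unfolding overlap_iff by auto
    qed
  qed
  then show ?thesis using v by (simp add: cyl_def)
qed

text \<open>The coded point may lie on the boundary of the box of \<open>v\<close>, so
  \<open>separation\<close> does not apply directly. Contracting the tail towards 1/2 moves the
  point inside, and for small \<open>e\<close> it stays in the open box of \<open>w\<close>.\<close>

lemma coding_in_open_box:
  assumes \<sigma>: "\<sigma> \<in> Aall N a" "sorted_profile \<sigma> M"
    and v: "v \<in> words N" and w: "w \<in> words N"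
    and y: "cd v \<in> open_box w M"
  shows "v \<in> cyl w M"
proof -
  define z where "z c = cd (shift (M c) v) $ c" for c
  define Y :: "real \<Rightarrow> real^'n::{finite,linorder}" where "Y e = (\<chi> c. cmap v c (M c) 0 + slope v c (M c) * ((1 - e) * z c + e / 2))" for e
  have z: "0 \<le> z c \<and> z c \<le> 1" for c unfolding z_def by (rule coding_interval[OF shift_words[OF v]])
  have Yv: "Y e \<in> open_box v M" if "0 < e" "e < 1" for e
  proof -
    have "0 \<le> (1 - e) * z c \<and> (1 - e) * z c \<le> (1 - e)" for c using z[of c] that by (auto simp: mult_left_le)
    then have "0 < (1 - e) * z c + e / 2 \<and> (1 - e) * z c + e / 2 < 1" for c using that by (smt (verit) half_gt_zero field_sum_of_halves)
    then show ?thesis unfolding open_box_iff[OF v]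
      by (intro exI[of _ "\<lambda>c. (1 - e) * z c + e / 2"]) (auto simp: Y_def cmap_affine[of v _ _ "(1 - e) * z _ + e / 2"])
  qed
  have Yw: "\<forall>\<^sub>F e in at_right 0. Y e \<in> open_box w M"
    unfolding open_box_def mem_Collect_eq
  proof (rule eventually_all_finite)
    fix c
    let ?f = "\<lambda>e. (Y e $ c - cmap w c (M c) 0) / slope w c (M c)"
    have "((\<lambda>e. (cmap v c (M c) 0 + slope v c (M c) * ((1 - e) * z c + e / 2) - cmap w c (M c) 0) / slope w c (M c)) \<longlongrightarrow>
        (cmap v c (M c) 0 + slope v c (M c) * ((1 - 0) * z c + 0 / 2) - cmap w c (M c) 0) / slope w c (M c)) (at_right 0)"
      by (intro tendsto_intros slope_nz[OF w]) simp
    moreover have "cd v $ c = cmap v c (M c) 0 + slope v c (M c) * z c"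
      using coding_shift[OF v, of c "M c"] cmap_affine[of v c "M c" "z c"] by (simp add: z_def)
    ultimately have lim: "(?f \<longlongrightarrow> (cd v $ c - cmap w c (M c) 0) / slope w c (M c)) (at_right 0)"
      by (simp add: Y_def)
    have "0 < (cd v $ c - cmap w c (M c) 0) / slope w c (M c)" "(cd v $ c - cmap w c (M c) 0) / slope w c (M c) < 1"
      using y by (auto simp: open_box_def)
    from order_tendstoD(1)[OF lim this(1)] order_tendstoD(2)[OF lim this(2)]
    show "\<forall>\<^sub>F e in at_right 0. 0 < ?f e \<and> ?f e < 1" by (rule eventually_conj)
  qed
  have "\<forall>\<^sub>F e in at_right (0::real). 0 < e \<and> e < 1" by (auto simp: eventually_at_right_field intro: exI[of _ 1])
  with Yw have "\<forall>\<^sub>F e in at_right (0::real). Y e \<in> open_box w M \<and> 0 < e \<and> e < 1" by (rule eventually_conj)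
  then obtain e where "Y e \<in> open_box w M" "0 < e" "e < 1" using eventually_happens'[of "at_right (0::real)"] by auto
  then show ?thesis using separation[OF \<sigma> v w] Yv by blast
qed

section \<open>Upper bound for packing sums\<close>

text \<open>For negative \<open>q\<close> lower bounds on the mass of balls suffice. The scale is
  refined by \<open>ln (real CARD('n))\<close> so that a cube codes into the ball around each of its
  coded points; then different centres have different cubes.\<close>

lemma packing_upper_neg:
  assumes s: "0 \<le> s" and q: "q < 0" and X: "centred_packing \<nu> (exp (- s)) X"
  shows "(\<Sum>x\<in>X. measure \<nu> (cball x (exp (- s))) powr q) \<le> cube_sum q (s + ln (real CARD('n)))"
proof -
  define s' where "s' = s + ln (real CARD('n))"
  have "1 \<le> real CARD('n)" by (simp add: Suc_le_eq)
  then have s': "0 \<le> s'" using s by (simp add: s'_def)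
  have r: "real CARD('n) * exp (- s') = exp (- s)" by (simp add: s'_def exp_add exp_minus exp_diff field_simps)
  have dis: "2 * exp (- s) < dist x y" if "x \<in> X" "y \<in> X" "x \<noteq> y" for x y
    by (rule centred_packing_dist[OF X that])
  have "\<exists>w. w \<in> words N \<and> cd w = x" if "x \<in> X" for x
    using X that by (auto simp: centred_packing_def msupport_attractor attractor_def)
  then obtain w where w: "\<And>x. x \<in> X \<Longrightarrow> w x \<in> words N \<and> cd (w x) = x" by metis
  have inj: "inj_on (\<lambda>x. cube s' (w x)) X"
  proof (rule inj_onI, rule ccontr)
    fix x y assume xy: "x \<in> X" "y \<in> X" "cube s' (w x) = cube s' (w y)" "x \<noteq> y"
    have "w x \<in> cube s' (w y)" using cube_self[of "w x" s'] w[OF xy(1)] xy(3) by simp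
    then have "dist (cd (w x)) (cd (w y)) \<le> real CARD('n) * exp (- s')"
      using w[OF xy(2)] by (intro dist_vec_le cube_coding_dist) auto
    then have "dist x y \<le> exp (- s)" using w xy by (simp add: r)
    moreover have "0 < exp (- s)" by simp
    ultimately show False using dis[OF xy(1,2,4)] by linarith
  qed
  have "(\<Sum>x\<in>X. measure \<nu> (cball x (exp (- s))) powr q) \<le> (\<Sum>x\<in>X. measure Bern (cube s' (w x)) powr q)"
  proof (rule sum_mono)
    fix x assume x: "x \<in> X"
    have "weight (w x) (lev s' (w x)) \<le> measure \<nu> (cball x (exp (- s)))"
      using nu_ball_lower[of "w x" s' "exp (- s)"] w[OF x] r by simp
    moreover have "0 < weight (w x) (lev s' (w x))" using w[OF x] by (simp add: weight_pos)
    ultimately show "measure \<nu> (cball x (exp (- s))) powr q \<le> measure Bern (cube s' (w x)) powr q"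
      using q by (intro powr_mono2') (auto simp: weight_def cube_def)
  qed
  also have "\<dots> = (\<Sum>B\<in>(\<lambda>x. cube s' (w x)) ` X. measure Bern B powr q)" by (simp add: sum.reindex[OF inj])
  also have "\<dots> \<le> cube_sum q s'" unfolding cube_sum_def
    by (rule sum_mono2) (use finite_cubes[OF s'] w in \<open>auto simp: cubes_def\<close>)
  finally show ?thesis by (simp add: s'_def)
qed

definition near_cubes :: "real \<Rightarrow> real^'n::{finite,linorder} \<Rightarrow> (nat \<Rightarrow> nat) set set" where
  "near_cubes s x = {B \<in> cubes s. \<exists>v\<in>B. cd v \<in> cball x (exp (- s))}"

text \<open>\<open>8 * exp hmax\<close> is the ratio \<open>2 * R / \<epsilon>\<close> of
  \<open>grid_count\<close> for box centres within \<open>2 * exp (- s)\<close> of a point and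
  separated by \<open>exp (- s - hmax) / 2\<close>.\<close>

definition C2 :: real where "C2 = (8 * exp hmax + 2) ^ CARD('n)"

text \<open>For a fixed profile the centres of the boxes are separated: a centre within half the
  shortest possible side of another one would lie in both open boxes, and \<open>separation\<close>
  would identify the cubes. The number of profiles gives the polynomial factor.\<close>

lemma card_near_cubes:
  assumes s: "1 \<le> s"
  shows "real (card (near_cubes s x)) \<le> (C1 * s) ^ CARD('n) * C2"
proof -
  define NM where "NM M = {B \<in> near_cubes s x. lev s (rep s B) = M}" for M
  have fib: "real (card (NM M)) \<le> C2" for M
  proof -
    define f :: "(nat \<Rightarrow> nat) set \<Rightarrow> real^'n::{finite,linorder}"
      where "f B = (\<chi> c. cmap (rep s B) c (M c) (1/2))" for B
    let ?\<epsilon> = "exp (- s - hmax) / 2" let ?R = "2 * exp (- s)"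
    have B: "rep s B \<in> words N" "cyl (rep s B) M = B" "B \<in> cubes s" if "B \<in> NM M" for B
      using that rep[of B s] by (auto simp: NM_def near_cubes_def cube_def)
    have "real (card (NM M)) \<le> (2 * ?R / ?\<epsilon> + 2) ^ CARD('n)"
    proof (rule grid_count(2))
      fix B c assume b: "B \<in> NM M"
      then obtain v where v: "v \<in> B" "dist x (cd v) \<le> exp (- s)" by (auto simp: NM_def near_cubes_def)
      have w: "rep s B \<in> words N" and vc: "v \<in> cyl (rep s B) M" using B[OF b] v by auto
      have vw: "v \<in> words N" using vc cyl_words by blast
      have M: "lev s (rep s B) = M" using b by (simp add: NM_def)
      define z where "z = cd (shift (M c) v) $ c"
      have z: "0 \<le> z \<and> z \<le> 1" unfolding z_def by (rule coding_interval[OF shift_words[OF vw]])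
      have "cd v $ c = cmap (rep s B) c (M c) z"
        unfolding z_def using coding_shift[OF vw, of c "M c"] cmap_cong[of "M c" c v "rep s B"] vc by (simp add: cyl_def)
      then have "f B $ c - cd v $ c = slope (rep s B) c (M c) * (1/2 - z)" by (simp add: f_def cmap_diff)
      then have "\<bar>f B $ c - cd v $ c\<bar> = exp (- tau (rep s B) c (M c)) * \<bar>1/2 - z\<bar>" by (simp add: abs_mult abs_slope[OF w])
      also have "\<dots> \<le> exp (- s) * 1"
        using lev_ge[OF w, of s c] M z by (intro mult_mono) (auto simp: abs_if)
      finally have "\<bar>f B $ c - cd v $ c\<bar> \<le> exp (- s)" by simp
      moreover have "\<bar>cd v $ c - x $ c\<bar> \<le> exp (- s)" using nth_dist_le[of "cd v" c x] v by (simp add: dist_commute)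
      ultimately show "\<bar>f B $ c - x $ c\<bar> \<le> ?R" by linarith
    next
      fix B B' assume b: "B \<in> NM M" "B' \<in> NM M" "B \<noteq> B'"
      show "\<exists>c. ?\<epsilon> \<le> \<bar>f B $ c - f B' $ c\<bar>"
      proof (rule ccontr)
        assume "\<not> ?thesis"
        then have lt: "\<bar>f B' $ c - f B $ c\<bar> < ?\<epsilon>" for c by (simp add: not_le abs_minus_commute)
        let ?w = "rep s B" let ?w' = "rep s B'"
        have w: "?w \<in> words N" "?w' \<in> words N" using B b by auto
        have M: "lev s ?w = M" using b by (simp add: NM_def)
        obtain \<sigma> where \<sigma>: "\<sigma> \<in> Aall N a" "sorted_profile \<sigma> M"
          using sorted_profile_exists[OF w(1), of s] s M by auto
        have 1: "f B' \<in> open_box ?w M"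
        proof (rule open_box_near[OF w(1), where x = "\<lambda>_. 1/2" and r = "1/2"])
          fix c
          have "tau ?w c (M c) \<le> s + hmax" using lev_tau_upper[OF w(1), of s c] s M by simp
          then have "exp (- s - hmax) \<le> exp (- tau ?w c (M c))" by simp
          then show "\<bar>f B' $ c - cmap ?w c (M c) (1/2)\<bar> < 1 / 2 * exp (- tau ?w c (M c))"
            using lt[of c] unfolding f_def by (simp only: vec_lambda_beta)
        qed auto
        have 2: "f B' \<in> open_box ?w' M" unfolding open_box_iff[OF w(2)] by (rule exI[of _ "\<lambda>_. 1/2"]) (simp add: f_def)
        have "?w' \<in> cyl ?w M" by (rule separation[OF \<sigma> w(2,1) 2 1])
        then have "?w' \<in> B" using B(2)[OF b(1)] by simp
        moreover have "?w' \<in> B'" using B(2)[OF b(2)] w(2) by (metis cyl_refl)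
        ultimately show False using cubes_disjoint[OF B(3)[OF b(1)] B(3)[OF b(2)]] b(3) by blast
      qed
    qed auto
    also have "2 * ?R / ?\<epsilon> = 8 * exp hmax" by (simp add: exp_diff exp_minus field_simps)
    finally show ?thesis by (simp add: C2_def)
  qed
  have "near_cubes s x = (\<Union>M\<in>lev s ` words N. NM M)"
    using rep by (auto simp: NM_def near_cubes_def)
  then have "card (near_cubes s x) \<le> (\<Sum>M\<in>lev s ` words N. card (NM M))"
    using card_UN_le[OF profiles(1)[OF s], of NM] by simp
  then have "real (card (near_cubes s x)) \<le> (\<Sum>M\<in>lev s ` words N. real (card (NM M)))"
    using of_nat_mono by fastforce
  also have "\<dots> \<le> real (card (lev s ` words N)) * C2" by (rule sum_bounded_above) (rule fib)
  also have "\<dots> \<le> (C1 * s) ^ CARD('n) * C2"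
    by (intro mult_right_mono profiles[OF s]) (simp add: C2_def)
  finally show ?thesis .
qed

text \<open>The mass of a ball is at most the sum over the cubes it meets, of which there are
  polynomially many in \<open>s\<close>. After exchanging the sums, each cube is counted for
  boundedly many centres, since the centres are separated.\<close>

lemma packing_upper_pos:
  assumes s: "1 \<le> s" and q: "0 \<le> q" and X: "centred_packing \<nu> (exp (- s)) X"
  shows "(\<Sum>x\<in>X. measure \<nu> (cball x (exp (- s))) powr q)
     \<le> (2 * real CARD('n) + 2) ^ CARD('n) * ((C1 * s) ^ CARD('n) * C2) powr q * cube_sum q s"
proof -
  let ?\<delta> = "exp (- s)"
  define K where "K = (C1 * s) ^ CARD('n) * C2"
  have fc: "finite (cubes s)" using finite_cubes s by simp
  have fN: "finite (near_cubes s x)" for x by (rule finite_subset[OF _ fc]) (auto simp: near_cubes_def)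
  have fX: "finite X" using X by (simp add: centred_packing_def)
  have dis: "2 * ?\<delta> < dist x y" if "x \<in> X" "y \<in> X" "x \<noteq> y" for x y
    by (rule centred_packing_dist[OF X that])
  have one: "measure \<nu> (cball x ?\<delta>) powr q \<le> K powr q * (\<Sum>B\<in>near_cubes s x. measure Bern B powr q)" for x
  proof -
    have "measure \<nu> (cball x ?\<delta>) = measure Bern {w \<in> words N. cd w \<in> cball x ?\<delta>}" by (rule nu_measure) simp
    also have "\<dots> \<le> measure Bern (\<Union>B\<in>near_cubes s x. B)"
    proof (rule Bern.finite_measure_mono)
      show "{w \<in> words N. cd w \<in> cball x ?\<delta>} \<subseteq> (\<Union>B\<in>near_cubes s x. B)"
      proof
        fix w assume w: "w \<in> {w \<in> words N. cd w \<in> cball x ?\<delta>}"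
        then have "cube s w \<in> near_cubes s x" "w \<in> cube s w"
          using cube_self by (auto simp: near_cubes_def cubes_def)
        then show "w \<in> (\<Union>B\<in>near_cubes s x. B)" by blast
      qed
      show "(\<Union>B\<in>near_cubes s x. B) \<in> Bern.events"
        using fN cubes_sets by (intro sets.finite_UN) (auto simp: near_cubes_def)
    qed
    also have "\<dots> \<le> (\<Sum>B\<in>near_cubes s x. measure Bern B)"
      by (rule measure_UNION_le) (use fN cubes_sets in \<open>auto simp: near_cubes_def\<close>)
    finally have "measure \<nu> (cball x ?\<delta>) powr q \<le> (\<Sum>B\<in>near_cubes s x. measure Bern B) powr q"
      using q by (intro powr_mono2) auto
    also have "\<dots> \<le> real (card (near_cubes s x)) powr q * (\<Sum>B\<in>near_cubes s x. measure Bern B powr q)"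
      by (rule sum_powr_le[OF fN]) (use q in auto)
    also have "\<dots> \<le> K powr q * (\<Sum>B\<in>near_cubes s x. measure Bern B powr q)"
      using card_near_cubes[OF s, of x] q by (intro mult_right_mono powr_mono2 sum_nonneg) (auto simp: K_def)
    finally show ?thesis .
  qed
  have mult: "real (card {x\<in>X. B \<in> near_cubes s x}) \<le> (2 * real CARD('n) + 2) ^ CARD('n)" if B: "B \<in> cubes s" for B
  proof -
    let ?\<epsilon> = "2 * ?\<delta> / real CARD('n)" let ?R = "2 * ?\<delta>"
    have "real (card {x\<in>X. B \<in> near_cubes s x}) \<le> (2 * ?R / ?\<epsilon> + 2) ^ CARD('n)"
    proof (rule grid_count(2)[where f = "\<lambda>x. x" and z = "cd (rep s B)"])
      fix x c assume "x \<in> {x\<in>X. B \<in> near_cubes s x}"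
      then obtain v where v: "v \<in> B" "dist x (cd v) \<le> ?\<delta>" by (auto simp: near_cubes_def)
      have "\<bar>cd v $ c - cd (rep s B) $ c\<bar> \<le> ?\<delta>"
        by (rule cube_coding_dist) (use rep[OF B] v in auto)
      then show "\<bar>x $ c - cd (rep s B) $ c\<bar> \<le> ?R" using nth_dist_le[of x c "cd v"] v by linarith
    next
      fix x y assume xy: "x \<in> {x\<in>X. B \<in> near_cubes s x}" "y \<in> {x\<in>X. B \<in> near_cubes s x}" "x \<noteq> y"
      show "\<exists>c. ?\<epsilon> \<le> \<bar>x $ c - y $ c\<bar>"
      proof (rule ccontr)
        assume "\<not> ?thesis"
        then have "dist x y \<le> real CARD('n) * ?\<epsilon>" by (intro dist_vec_le) (simp add: not_le less_imp_le)
        then show False using dis[of x y] xy by simp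
      qed
    qed auto
    also have "2 * ?R / ?\<epsilon> = 2 * real CARD('n)" by simp
    finally show ?thesis .
  qed
  have "(\<Sum>x\<in>X. measure \<nu> (cball x ?\<delta>) powr q) \<le> (\<Sum>x\<in>X. K powr q * (\<Sum>B\<in>near_cubes s x. measure Bern B powr q))"
    by (rule sum_mono) (rule one)
  also have "\<dots> = K powr q * (\<Sum>x\<in>X. \<Sum>B\<in>{B\<in>cubes s. B \<in> near_cubes s x}. measure Bern B powr q)"
    unfolding sum_distrib_left[symmetric]
    by (intro arg_cong[where f = "\<lambda>z. K powr q * z"] sum.cong refl) (auto simp: near_cubes_def)
  also have "\<dots> = K powr q * (\<Sum>B\<in>cubes s. \<Sum>x\<in>{x\<in>X. B \<in> near_cubes s x}. measure Bern B powr q)"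
    by (simp only: sum.swap_restrict[OF fX fc])
  also have "\<dots> \<le> K powr q * (\<Sum>B\<in>cubes s. (2 * real CARD('n) + 2) ^ CARD('n) * measure Bern B powr q)"
    by (intro mult_left_mono sum_mono) (auto intro!: mult_right_mono mult)
  also have "\<dots> = (2 * real CARD('n) + 2) ^ CARD('n) * K powr q * cube_sum q s"
    by (simp add: cube_sum_def sum_distrib_left[symmetric])
  finally show ?thesis by (simp add: K_def)
qed

section \<open>Lower bound for packing sums\<close>

definition bmap :: "'n \<Rightarrow> nat list \<Rightarrow> real \<Rightarrow> real" where
  "bmap c ks x = foldr (\<lambda>i y. a i c * y + t i $ c) ks x"

lemma bmap_simps [simp]: "bmap c [] x = x" "bmap c (i # ks) x = a i c * bmap c ks x + t i $ c"
  by (simp_all add: bmap_def)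

lemma bmap_append: "bmap c (ks @ js) x = bmap c ks (bmap c js x)"
  by (simp add: bmap_def)

lemma cmap_lc: "cmap w c k x = bmap c (map w [0..<k]) x"
  by (induction k arbitrary: x) (auto simp: bmap_append)

lemma bmap_interval: "set ks \<subseteq> Idx N \<Longrightarrow> 0 \<le> x \<and> x \<le> 1 \<Longrightarrow> 0 \<le> bmap c ks x \<and> bmap c ks x \<le> 1"
  by (induction ks) (auto simp: fmap_interval)

lemma bmap_open_interval: "set ks \<subseteq> Idx N \<Longrightarrow> 0 < x \<and> x < 1 \<Longrightarrow> 0 < bmap c ks x \<and> bmap c ks x < 1"
  by (induction ks) (auto simp: fmap_open_interval)

definition interior_at :: "'n \<Rightarrow> nat list \<Rightarrow> bool" where
  "interior_at c ks \<longleftrightarrow> (\<forall>x. 0 \<le> x \<and> x \<le> 1 \<longrightarrow> 0 < bmap c ks x \<and> bmap c ks x < 1)"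

text \<open>One interior part suffices: the other part preserves the closed interval if it is
  applied first and the open interval if it is applied last. So blocks for single coordinates can be
  concatenated.\<close>

lemma interior_at_append:
  assumes "set ks \<subseteq> Idx N" "set js \<subseteq> Idx N" "interior_at c ks \<or> interior_at c js"
  shows "interior_at c (ks @ js)"
  using assms bmap_interval[OF assms(2)] bmap_open_interval[OF assms(1)] unfolding interior_at_def bmap_append by blast

text \<open>Positive distance excludes a common point with the face, and a solution \<open>x\<close>
  of the equation would yield one through the vector with all entries \<open>x\<close>.\<close>

lemma face_avoided:
  assumes "u \<in> {0, 1}"
  shows "\<exists>k\<in>Idx N. \<forall>x. 0 \<le> x \<and> x \<le> 1 \<longrightarrow> a k c * x + t k $ c \<noteq> u"
proof -
  obtain r0 where r0: "0 < r0" "\<forall>c. \<forall>u\<in>{0::real,1}. \<exists>k\<in>Idx N. setdist {x\<in>unitcube. x $ c = u} (fmap a t k ` unitcube) \<ge> r0"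
    using sponge unfolding sponge_system_def by blast
  then obtain k where k: "k \<in> Idx N" "setdist {x\<in>unitcube. x $ c = u} (fmap a t k ` unitcube) \<ge> r0" using assms by blast
  have "a k c * x + t k $ c \<noteq> u" if x: "0 \<le> x \<and> x \<le> 1" for x
  proof
    assume eq: "a k c * x + t k $ c = u"
    let ?X = "(\<chi> c. x) :: real^'n::{finite,linorder}"
    let ?z = "fmap a t k ?X"
    have X: "?X \<in> unitcube" using x by (simp add: unitcube_def)
    then have "?z \<in> unitcube" using sponge k(1) unfolding sponge_system_def by blast
    moreover have "?z $ c = u" using eq by (simp add: fmap_def)
    ultimately have "setdist {x\<in>unitcube. x $ c = u} (fmap a t k ` unitcube) \<le> dist ?z ?z"
      using X by (intro setdist_le_dist) auto
    then show False using k(2) r0(1) by simp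
  qed
  then show ?thesis using k(1) by blast
qed

text \<open>Two letters suffice, with \<open>k\<close> avoiding 0 as the outer one. If its slope is
  positive, an inner \<open>j\<close> that avoids 1 keeps the image below 1; if the slope is
  negative, an inner \<open>k\<close> does, because its image avoids 0.\<close>

lemma interior_at_exists: "\<exists>ks. set ks \<subseteq> Idx N \<and> interior_at c ks"
proof -
  obtain k where k: "k \<in> Idx N" "\<And>x. 0 \<le> x \<and> x \<le> 1 \<Longrightarrow> a k c * x + t k $ c \<noteq> 0" using face_avoided[of 0 c] by auto
  obtain j where j: "j \<in> Idx N" "\<And>x. 0 \<le> x \<and> x \<le> 1 \<Longrightarrow> a j c * x + t j $ c \<noteq> 1" using face_avoided[of 1 c] by auto
  have kp: "0 < a k c * x + t k $ c" if "0 \<le> x \<and> x \<le> 1" for x using k(2)[OF that] fmap_interval[OF k(1), of x c] that by auto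
  have k1: "a k c + t k $ c \<le> 1" "t k $ c \<le> 1" using fmap_interval[OF k(1), of 1 c] fmap_interval[OF k(1), of 0 c] by auto
  show ?thesis
  proof (cases "a k c > 0")
    case True
    have "0 < a k c * (a j c * x + t j $ c) + t k $ c \<and> a k c * (a j c * x + t j $ c) + t k $ c < 1" if x: "0 \<le> x \<and> x \<le> 1" for x
    proof -
      have y: "0 \<le> a j c * x + t j $ c" "a j c * x + t j $ c < 1" using fmap_interval[OF j(1), of x c] j(2)[OF x] x by auto
      have "a k c * (a j c * x + t j $ c) < a k c * 1" using y True by (intro mult_strict_left_mono) auto
      then show ?thesis using kp[of "a j c * x + t j $ c"] y k1 by auto
    qed
    then have "interior_at c [k, j]" by (simp add: interior_at_def)
    then show ?thesis using k j by (intro exI[of _ "[k, j]"]) auto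
  next
    case False
    then have neg: "a k c < 0" using a_nz[OF k(1), of c] by simp
    have "0 < a k c * (a k c * x + t k $ c) + t k $ c \<and> a k c * (a k c * x + t k $ c) + t k $ c < 1" if x: "0 \<le> x \<and> x \<le> 1" for x
    proof -
      have y: "0 < a k c * x + t k $ c" "a k c * x + t k $ c \<le> 1" using kp[OF x] fmap_interval[OF k(1), of x c] x by auto
      have "a k c * (a k c * x + t k $ c) < 0" using y(1) neg by (rule mult_neg_pos[rotated])
      then show ?thesis using kp[of "a k c * x + t k $ c"] y k1 by auto
    qed
    then have "interior_at c [k, k]" by (simp add: interior_at_def)
    then show ?thesis using k by (intro exI[of _ "[k, k]"]) auto
  qed
qed

lemma interior_block_exists: "\<exists>ks. set ks \<subseteq> Idx N \<and> (\<forall>c. interior_at c ks)"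
proof -
  have "\<exists>ks. set ks \<subseteq> Idx N \<and> (\<forall>c\<in>A. interior_at c ks)" if "finite A" for A
    using that
  proof (induction A rule: finite_induct)
    case empty
    then show ?case by (intro exI[of _ "[]"]) simp
  next
    case (insert c A)
    then obtain ks where ks: "set ks \<subseteq> Idx N" "\<forall>c\<in>A. interior_at c ks" by blast
    obtain js where js: "set js \<subseteq> Idx N" "interior_at c js" using interior_at_exists by blast
    show ?case by (intro exI[of _ "ks @ js"]) (use ks js interior_at_append in auto)
  qed
  from this[of UNIV] show ?thesis by simp
qed

definition inner_block :: "nat list" where
  "inner_block = (SOME ks. set ks \<subseteq> Idx N \<and> (\<forall>c. interior_at c ks))"

definition block_len :: nat where "block_len = length inner_block"

lemma inner_block: "set inner_block \<subseteq> Idx N" "interior_at c inner_block"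
  using someI_ex[OF interior_block_exists] by (auto simp: inner_block_def)

lemma block_len_pos: "0 < block_len"
proof -
  have "inner_block \<noteq> []"
  proof
    assume "inner_block = []"
    then show False using inner_block(2)[of undefined] by (auto simp: interior_at_def dest: spec[of _ 0])
  qed
  then show ?thesis by (simp add: block_len_def)
qed

lemma bmap_between:
  assumes "0 \<le> x" "x \<le> 1"
  shows "min (bmap c ks 0) (bmap c ks 1) \<le> bmap c ks x \<and> bmap c ks x \<le> max (bmap c ks 0) (bmap c ks 1)"
proof (induction ks)
  case (Cons i ks)
  show ?case
  proof (cases "a i c \<ge> 0")
    case True
    then have "a i c * min (bmap c ks 0) (bmap c ks 1) \<le> a i c * bmap c ks x" "a i c * bmap c ks x \<le> a i c * max (bmap c ks 0) (bmap c ks 1)"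
      using Cons by (auto intro: mult_left_mono)
    then show ?thesis by (auto simp: min_def max_def split: if_splits)
  next
    case False
    then have "a i c * bmap c ks x \<le> a i c * min (bmap c ks 0) (bmap c ks 1)" "a i c * max (bmap c ks 0) (bmap c ks 1) \<le> a i c * bmap c ks x"
      using Cons by (auto intro: mult_left_mono_neg)
    then show ?thesis by (auto simp: min_def max_def split: if_splits)
  qed
qed (use assms in auto)

lemma interior_radius_exists: "\<exists>r>0. \<forall>c x. 0 \<le> x \<and> x \<le> 1 \<longrightarrow> r \<le> bmap c inner_block x \<and> bmap c inner_block x \<le> 1 - r"
proof -
  \<comment> \<open>The block acts as an affine map, so its image lies between the images of 0 and
    1, and these determine the distance to the end points.\<close>
  define e where "e c = min (min (bmap c inner_block 0) (bmap c inner_block 1)) (1 - max (bmap c inner_block 0) (bmap c inner_block 1))" for c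
  define r where "r = Min (range e)"
  have "0 < e c" for c using inner_block(2)[of c] by (auto simp: e_def interior_at_def)
  then have "0 < r" unfolding r_def by simp
  moreover have "r \<le> e c" for c unfolding r_def by simp
  then have "r \<le> bmap c inner_block x \<and> bmap c inner_block x \<le> 1 - r" if "0 \<le> x \<and> x \<le> 1" for c x
    using bmap_between[of x c inner_block] that by (smt (verit) e_def min_def)
  ultimately show ?thesis by blast
qed

definition inner_radius :: real where
  "inner_radius = (SOME r. r > 0 \<and> (\<forall>c x. 0 \<le> x \<and> x \<le> 1 \<longrightarrow> r \<le> bmap c inner_block x \<and> bmap c inner_block x \<le> 1 - r))"

lemma inner_radius: "0 < inner_radius" "0 \<le> x \<Longrightarrow> x \<le> 1 \<Longrightarrow> inner_radius \<le> bmap c inner_block x \<and> bmap c inner_block x \<le> 1 - inner_radius"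
proof -
  have "\<exists>r. r > 0 \<and> (\<forall>c x. 0 \<le> x \<and> x \<le> 1 \<longrightarrow> r \<le> bmap c inner_block x \<and> bmap c inner_block x \<le> 1 - r)" using interior_radius_exists by blast
  from someI_ex[OF this] show "0 < inner_radius" "0 \<le> x \<Longrightarrow> x \<le> 1 \<Longrightarrow> inner_radius \<le> bmap c inner_block x \<and> bmap c inner_block x \<le> 1 - inner_radius"
    unfolding inner_radius_def by blast+
qed

section \<open>Overwriting words with inner blocks\<close>

text \<open>Rounding to multiples of the block length makes the blocks written for two coordinates
  either coincide or be disjoint.\<close>
definition round_up :: "('n \<Rightarrow> nat) \<Rightarrow> 'n \<Rightarrow> nat" where
  "round_up M c = block_len * ((M c + block_len - 1) div block_len)"

definition overwritten :: "('n \<Rightarrow> nat) \<Rightarrow> nat set" where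
  "overwritten M = (\<Union>c. {round_up M c..<round_up M c + block_len})"

text \<open>Blocks start at multiples of \<open>block_len\<close>, so the letter depends on
  \<open>l mod block_len\<close> alone, whichever coordinate's block covers
  \<open>l\<close>.\<close>

definition overwrite :: "('n \<Rightarrow> nat) \<Rightarrow> (nat \<Rightarrow> nat) \<Rightarrow> nat \<Rightarrow> nat" where
  "overwrite M w l = (if l \<in> overwritten M then inner_block ! (l mod block_len) else w l)"

lemma round_up_bounds: "M c \<le> round_up M c" "round_up M c \<le> M c + block_len"
proof -
  let ?n = "M c + block_len - 1"
  have "round_up M c + ?n mod block_len = ?n" unfolding round_up_def by (rule mult_div_mod_eq)
  moreover have "?n mod block_len < block_len" using block_len_pos by simp
  ultimately show "M c \<le> round_up M c" "round_up M c \<le> M c + block_len" using block_len_pos by linarith+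
qed

lemma finite_overwritten [simp]: "finite (overwritten M)"
  by (simp add: overwritten_def)

lemma card_overwritten: "card (overwritten M) \<le> CARD('n) * block_len"
proof -
  have "card (overwritten M) \<le> (\<Sum>c\<in>(UNIV::'n set). card {round_up M c..<round_up M c + block_len})" unfolding overwritten_def by (rule card_UN_le) simp
  then show ?thesis by simp
qed

lemma overwrite_words: "w \<in> words N \<Longrightarrow> overwrite M w \<in> words N"
proof -
  assume w: "w \<in> words N"
  have "inner_block ! (l mod block_len) \<in> Idx N" for l
    using inner_block(1) block_len_pos nth_mem[of "l mod block_len" inner_block] by (auto simp: block_len_def)
  then show ?thesis using w by (auto simp: words_def overwrite_def)
qed

text \<open>The rest of the word behind the rounded depth starts with the inner block; this provides
  the depth that \<open>open_box_near\<close> asks for.\<close>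

lemma overwrite_interior:
  assumes "w \<in> words N"
  shows "inner_radius \<le> cd (shift (round_up M c) (overwrite M w)) $ c \<and> cd (shift (round_up M c) (overwrite M w)) $ c \<le> 1 - inner_radius"
proof -
  let ?u = "shift (round_up M c) (overwrite M w)"
  have u: "?u \<in> words N" by (rule shift_words[OF overwrite_words[OF assms]])
  have "?u l = inner_block ! l" if "l < block_len" for l
  proof -
    have "round_up M c + l \<in> overwritten M" unfolding overwritten_def by (rule UN_I[of c]) (use that in auto)
    moreover have "(round_up M c + l) mod block_len = l" using that by (simp add: round_up_def)
    ultimately show ?thesis by (simp add: shift_def overwrite_def)
  qed
  then have "map ?u [0..<block_len] = inner_block" by (intro nth_equalityI) (auto simp: block_len_def)
  then have "cd ?u $ c = bmap c inner_block (cd (shift block_len ?u) $ c)" using coding_shift[OF u, of c block_len] by (simp add: cmap_lc)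
  then show ?thesis using inner_radius(2) coding_interval[OF shift_words[OF u], of block_len c] by simp
qed

lemma overwrite_tau:
  assumes "w \<in> words N"
  shows "\<bar>tau (overwrite M w) c k - tau w c k\<bar> \<le> real (CARD('n) * block_len) * hmax"
proof -
  let ?u = "overwrite M w"
  have "tau ?u c k - tau w c k = (\<Sum>l<k. h (?u l) c - h (w l) c)" by (simp add: tau_def sum_subtractf)
  also have "\<bar>\<dots>\<bar> \<le> (\<Sum>l<k. \<bar>h (?u l) c - h (w l) c\<bar>)" by (rule sum_abs)
  also have "\<dots> = (\<Sum>l\<in>{..<k} \<inter> overwritten M. \<bar>h (?u l) c - h (w l) c\<bar>)"
    by (rule sum.mono_neutral_right) (auto simp: overwrite_def)
  also have "\<dots> \<le> real (card ({..<k} \<inter> overwritten M)) * hmax"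
  proof (rule sum_bounded_above)
    fix l
    show "\<bar>h (?u l) c - h (w l) c\<bar> \<le> hmax"
      using h_pos[OF wordsD[OF assms], of l c] hmax_ge[OF wordsD[OF assms], of l c]
        h_pos[OF wordsD[OF overwrite_words[OF assms]], of M l c] hmax_ge[OF wordsD[OF overwrite_words[OF assms]], of M l c] by linarith
  qed
  also have "\<dots> \<le> real (CARD('n) * block_len) * hmax"
  proof (rule mult_right_mono)
    have "card ({..<k} \<inter> overwritten M) \<le> card (overwritten M)" by (rule card_mono) auto
    then show "real (card ({..<k} \<inter> overwritten M)) \<le> real (CARD('n) * block_len)" using card_overwritten[of M] by linarith
  qed (use hmax_pos in simp)
  finally show ?thesis .
qed

text \<open>Adds up what can push \<open>tau\<close> above \<open>s\<close>: overwritten letters,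
  rounding, and the overshoot of the level.\<close>

definition D0 :: real where "D0 = (real (CARD('n) * block_len) + real block_len + 1) * hmax"

lemma overwrite_tau_rnd:
  assumes "w \<in> words N" "0 \<le> s"
  shows "tau (overwrite (lev s w) w) c (round_up (lev s w) c) \<le> s + D0"
proof -
  let ?M = "lev s w"
  have "tau w c (round_up ?M c) - tau w c (?M c) \<le> real (round_up ?M c - ?M c) * hmax"
    by (rule tau_diff(2)[OF assms(1) round_up_bounds(1)])
  also have "\<dots> \<le> real block_len * hmax" using round_up_bounds(2)[of ?M c] hmax_pos by (intro mult_right_mono) auto
  finally show ?thesis using overwrite_tau[OF assms(1), of ?M c "round_up ?M c"] lev_tau_upper[OF assms, of c]
    by (simp add: D0_def algebra_simps)
qed

lemma round_up_sorted: "sorted_profile \<sigma> M \<Longrightarrow> sorted_profile \<sigma> (round_up M)"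
  unfolding sorted_profile_def round_up_def by (auto intro!: mult_le_mono2 div_le_mono diff_le_mono)

text \<open>Makes the radius \<open>exp (- (s + b0))\<close> a third of \<open>inner_radius\<close>
  times a lower bound for the sides of the boxes. The third leaves room for two radii, as
  disjointness of packed balls requires.\<close>

definition b0 :: real where "b0 = D0 - ln (inner_radius / 3)"

lemma b0: "exp (- (s + b0)) = inner_radius / 3 * exp (- (s + D0))" "0 < b0"
proof -
  have "exp (- (s + b0)) = exp (ln (inner_radius / 3)) * exp (- (s + D0))"
    unfolding b0_def exp_add[symmetric] by (rule arg_cong[where f = exp]) simp
  then show "exp (- (s + b0)) = inner_radius / 3 * exp (- (s + D0))" using inner_radius(1) by simp
  have "inner_radius \<le> 1" using inner_radius(2)[of 0] inner_radius(1) by fastforce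
  then have "ln (inner_radius / 3) < 0" using inner_radius(1) by simp
  moreover have "0 \<le> D0" unfolding D0_def using hmax_pos by simp
  ultimately show "0 < b0" by (simp add: b0_def)
qed

text \<open>The coded point of the overwritten word has relative depth \<open>inner_radius\<close>
  in its box of rounded depths, and two radii amount to less than this depth. So every point that
  close lies in the same open box, and \<open>coding_in_open_box\<close> turns this into agreement
  of words.\<close>

lemma overwrite_separated:
  assumes w: "w \<in> words N" and s: "0 < s" and v: "v \<in> words N"
    and d: "dist (cd (overwrite (lev s w) w)) (cd v) \<le> 2 * exp (- (s + b0))"
  shows "v \<in> cyl (overwrite (lev s w) w) (round_up (lev s w))"
proof -
  let ?M = "lev s w" let ?u = "overwrite ?M w" let ?p = "round_up ?M"
  have u: "?u \<in> words N" by (rule overwrite_words[OF w])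
  obtain \<sigma> where \<sigma>: "\<sigma> \<in> Aall N a" "sorted_profile \<sigma> ?M" using sorted_profile_exists[OF w s] by blast
  have "cd v \<in> open_box ?u ?p"
  proof (rule open_box_near[OF u, where r = inner_radius and x = "\<lambda>c. cd (shift (?p c) ?u) $ c"])
    fix c
    have "\<bar>cd v $ c - cd ?u $ c\<bar> \<le> 2 * exp (- (s + b0))"
      using nth_dist_le[of "cd v" c "cd ?u"] d by (simp add: dist_commute)
    also have "\<dots> < inner_radius * exp (- (s + D0))" unfolding b0(1) using inner_radius(1) by simp
    also have "\<dots> \<le> inner_radius * exp (- tau ?u c (?p c))"
      using overwrite_tau_rnd[OF w, of s c] s inner_radius(1) by (intro mult_left_mono) auto
    finally show "\<bar>cd v $ c - cmap ?u c (?p c) (cd (shift (?p c) ?u) $ c)\<bar> < inner_radius * exp (- tau ?u c (?p c))"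
      using coding_shift[OF u, of c "?p c"] by simp
  qed (rule overwrite_interior[OF w])
  then show ?thesis by (rule coding_in_open_box[OF \<sigma>(1) round_up_sorted[OF \<sigma>(2)] v u])
qed

definition J0 :: nat where
  "J0 = CARD('n) * block_len + CARD('n) * (block_len + nat \<lceil>((real (CARD('n) * block_len) + 2) * hmax + b0 + ln (real CARD('n))) / hmin\<rceil>)"

text \<open>The constant \<open>J0\<close> bounds the number of positions where a letter or the set of active coordinates changes.\<close>
lemma overwrite_ball_mass:
  assumes w: "w \<in> words N" and s: "0 < s"
  defines "B \<equiv> cball (cd (overwrite (lev s w) w)) (exp (- (s + b0)))"
  shows "mumin ^ J0 * weight w (lev s w) \<le> measure \<nu> B" "mumin ^ J0 * measure \<nu> B \<le> weight w (lev s w)"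
proof -
  let ?M = "lev s w" let ?u = "overwrite ?M w" let ?p = "round_up ?M"
  define E where "E = nat \<lceil>((real (CARD('n) * block_len) + 2) * hmax + b0 + ln (real CARD('n))) / hmin\<rceil>"
  have J0: "J0 = CARD('n) * block_len + CARD('n) * (block_len + E)" by (simp add: J0_def E_def)
  have u: "?u \<in> words N" by (rule overwrite_words[OF w])
  have card: "card (overwritten ?M \<union> profile_diff A A') \<le> J0"
    if "\<And>c. A c \<le> A' c + (block_len + E)" "\<And>c. A' c \<le> A c + (block_len + E)" for A A'
    using card_Un_le[of "overwritten ?M" "profile_diff A A'"] card_overwritten[of ?M] card_profile_diff[of A A' "block_len + E", OF that] unfolding J0 by linarith
  have pow: "mumin ^ J0 * x \<le> mumin ^ k * x" if "k \<le> J0" "0 \<le> x" for k x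
    using that mumin_pos mumin_le_1 by (intro mult_right_mono power_decreasing) auto
  have "measure \<nu> B = measure Bern {v \<in> words N. cd v \<in> B}" unfolding B_def by (rule nu_measure) simp
  \<comment> \<open>All words coded into the ball lie in one cylinder, by
    \<open>overwrite_separated\<close>.\<close>
  also have "\<dots> \<le> weight ?u ?p" unfolding weight_def
  proof (rule Bern.finite_measure_mono)
    show "{v \<in> words N. cd v \<in> B} \<subseteq> cyl ?u ?p"
    proof
      fix v assume v: "v \<in> {v \<in> words N. cd v \<in> B}"
      have "0 < exp (- (s + b0))" by simp
      then have "dist (cd ?u) (cd v) \<le> 2 * exp (- (s + b0))" using v unfolding B_def by (simp only: mem_Collect_eq mem_cball) linarith
      then show "v \<in> cyl ?u ?p" using overwrite_separated[OF w s] v by blast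
    qed
  qed simp
  finally have "mumin ^ J0 * measure \<nu> B \<le> mumin ^ J0 * weight ?u ?p" using mumin_pos by (intro mult_left_mono) auto
  also have "\<dots> \<le> mumin ^ card (overwritten ?M \<union> profile_diff ?p ?M) * weight ?u ?p"
  proof (intro pow card)
    fix c
    show "?p c \<le> ?M c + (block_len + E)" "?M c \<le> ?p c + (block_len + E)" using round_up_bounds[of ?M c] by linarith+
  qed (simp add: weight_def)
  also have "\<dots> \<le> weight w ?M"
    by (rule weight_compare) (use u w profile_diff_notin[of _ ?p ?M] in \<open>auto simp: overwrite_def\<close>)
  finally show "mumin ^ J0 * measure \<nu> B \<le> weight w ?M" .
  \<comment> \<open>At this finer scale the cube of the overwritten word codes into the ball, and
    its levels differ from those of \<open>w\<close> by at most \<open>E\<close>.\<close>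
  define s' where "s' = s + b0 + ln (real CARD('n))"
  have "1 \<le> real CARD('n)" by (simp add: Suc_le_eq)
  then have s': "0 \<le> s'" "s \<le> s'" using s b0(2) by (auto simp: s'_def)
  have r: "real CARD('n) * exp (- s') = exp (- (s + b0))"
    by (simp add: s'_def exp_add exp_minus exp_diff field_simps)
  have close: "\<bar>real (?M c) - real (lev s' ?u c)\<bar> \<le> real E" for c
  proof -
    have "\<bar>tau ?u c (?M c) - s'\<bar> \<le> (real (CARD('n) * block_len) + 1) * hmax + b0 + ln (real CARD('n))"
      using overwrite_tau[OF w, of ?M c "?M c"] lev_ge[OF w, of s c] lev_tau_upper[OF w, of s c] s s'(2)
      unfolding s'_def distrib_right by linarith
    from lev_dist[OF u s'(1) this]
    have "\<bar>real (?M c) - real (lev s' ?u c)\<bar> \<le> ((real (CARD('n) * block_len) + 2) * hmax + b0 + ln (real CARD('n))) / hmin"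
      by (simp add: algebra_simps)
    also have "\<dots> \<le> real E" unfolding E_def by (rule real_nat_ceiling_ge)
    finally show ?thesis .
  qed
  have "mumin ^ J0 * weight w ?M \<le> mumin ^ card (overwritten ?M \<union> profile_diff ?M (lev s' ?u)) * weight w ?M"
  proof (intro pow card)
    fix c
    show "?M c \<le> lev s' ?u c + (block_len + E)" "lev s' ?u c \<le> ?M c + (block_len + E)" using close[of c] by linarith+
  qed (simp add: weight_def)
  also have "\<dots> \<le> weight ?u (lev s' ?u)"
    by (rule weight_compare) (use u w profile_diff_notin[of _ ?M "lev s' ?u"] in \<open>auto simp: overwrite_def\<close>)
  also have "\<dots> \<le> measure \<nu> B" unfolding B_def by (rule nu_ball_lower[OF u]) (use r in simp)
  finally show "mumin ^ J0 * weight w ?M \<le> measure \<nu> B" .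
qed

text \<open>Among representatives with the same profile and the same overwritten letters,
  overwriting loses no information, and the coded points form a packing. The number of such classes
  accounts for the factors \<open>(C1 * s) ^ CARD('n)\<close> and
  \<open>real N ^ (CARD('n) * block_len)\<close>.\<close>

lemma packing_lower:
  assumes s: "1 \<le> s"
    and T: "\<And>X. centred_packing \<nu> (exp (- (s + b0))) X \<Longrightarrow> (\<Sum>x\<in>X. measure \<nu> (cball x (exp (- (s + b0)))) powr q) \<le> T"
  shows "cube_sum q s \<le> (C1 * s) ^ CARD('n) * (real N ^ (CARD('n) * block_len) * ((mumin ^ J0) powr (-\<bar>q\<bar>) * T))"
proof -
  let ?r = "exp (- (s + b0))" let ?\<eta> = "mumin ^ J0"
  have s0: "0 < s" using s by simp
  have "centred_packing \<nu> ?r {}" by (simp add: centred_packing_def)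
  from T[OF this] have T0: "0 \<le> T" by simp
  have fib: "(\<Sum>w\<in>{w\<in>reps s. lev s w = M \<and> restrict w (overwritten M) = f}. weight w M powr q) \<le> ?\<eta> powr (-\<bar>q\<bar>) * T" for M f
  proof -
    define V where "V = {w\<in>reps s. lev s w = M \<and> restrict w (overwritten M) = f}"
    define x where "x w = cd (overwrite M w)" for w
    have V: "w \<in> words N" "w \<in> reps s" "lev s w = M" "restrict w (overwritten M) = f" if "w \<in> V" for w
      using that reps_words by (auto simp: V_def)
    have fV: "finite V" using finite_reps[of s] s by (simp add: V_def)
    \<comment> \<open>Close points force agreement of the overwritten words within the rounded
      depths; the replaced letters agree by the choice of the class. So both words represent one
      cube.\<close>
    have far: "w = w'" if vv: "w \<in> V" "w' \<in> V" "dist (x w) (x w') \<le> 2 * ?r" for w w'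
    proof -
      have c: "overwrite M w' \<in> cyl (overwrite M w) (round_up M)"
        using overwrite_separated[OF V(1)[OF vv(1)] s0 overwrite_words[OF V(1)[OF vv(2)]], of M] vv(3) V(3)[OF vv(1)] by (simp add: x_def)
      have "agree c (w' l) (w l)" if l: "l < M c" for c l
      proof (cases "l \<in> overwritten M")
        case True
        have "restrict w' (overwritten M) l = restrict w (overwritten M) l" using V(4)[OF vv(1)] V(4)[OF vv(2)] by simp
        then show ?thesis using True by simp
      next
        case False
        have "l < round_up M c" using l round_up_bounds(1)[of M c] by simp
        then have "agree c (overwrite M w' l) (overwrite M w l)" using c by (simp add: cyl_def)
        then show ?thesis using False by (simp add: overwrite_def)
      qed
      then have "w' \<in> cyl w M" using V(1)[OF vv(2)] by (simp add: cyl_def)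
      moreover have "w' \<in> cyl w' M" using V(1)[OF vv(2)] by simp
      ultimately have "cyl w (lev s w) \<inter> cyl w' (lev s w') \<noteq> {}" using V(3) vv by auto
      then show "w = w'" using reps_disjoint[OF V(2)[OF vv(1)] V(2)[OF vv(2)]] by blast
    qed
    have inj: "inj_on x V"
    proof (rule inj_onI)
      fix w w' assume "w \<in> V" "w' \<in> V" "x w = x w'"
      then show "w = w'" by (intro far) auto
    qed
    have pack: "centred_packing \<nu> ?r (x ` V)"
      unfolding centred_packing_def
    proof (intro conjI ballI impI)
      show "finite (x ` V)" using fV by simp
      show "x ` V \<subseteq> msupport \<nu>" unfolding msupport_attractor attractor_def x_def using V(1) overwrite_words by blast
      fix y y' assume y: "y \<in> x ` V" "y' \<in> x ` V" "y \<noteq> y'"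
      then obtain w w' where ww: "w \<in> V" "w' \<in> V" "y = x w" "y' = x w'" by blast
      show "cball y ?r \<inter> cball y' ?r = {}"
      proof (rule ccontr)
        assume "\<not> ?thesis"
        then obtain z where "dist y z \<le> ?r" "dist y' z \<le> ?r" by auto
        then have "dist y y' \<le> 2 * ?r" using dist_triangle2[of y y' z] by linarith
        then show False using far[OF ww(1,2)] ww y(3) by auto
      qed
    qed
    have "(\<Sum>w\<in>V. weight w M powr q) \<le> (\<Sum>w\<in>V. ?\<eta> powr (-\<bar>q\<bar>) * measure \<nu> (cball (x w) ?r) powr q)"
    proof (rule sum_mono)
      fix w assume w: "w \<in> V"
      have m: "?\<eta> * weight w M \<le> measure \<nu> (cball (x w) ?r)" "?\<eta> * measure \<nu> (cball (x w) ?r) \<le> weight w M"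
        using overwrite_ball_mass[OF V(1)[OF w] s0] V(3)[OF w] by (auto simp: x_def)
      have \<eta>: "0 < ?\<eta>" using mumin_pos by simp
      have wp: "0 < weight w M" by (rule weight_pos[OF V(1)[OF w]])
      show "weight w M powr q \<le> ?\<eta> powr (-\<bar>q\<bar>) * measure \<nu> (cball (x w) ?r) powr q"
        by (rule powr_compare[OF wp _ \<eta> m]) (use m(1) mult_pos_pos[OF \<eta> wp] in linarith)
    qed
    also have "\<dots> = ?\<eta> powr (-\<bar>q\<bar>) * (\<Sum>y\<in>x ` V. measure \<nu> (cball y ?r) powr q)"
      by (simp add: sum.reindex[OF inj] sum_distrib_left)
    also have "\<dots> \<le> ?\<eta> powr (-\<bar>q\<bar>) * T" by (intro mult_left_mono T pack) simp
    finally show ?thesis unfolding V_def .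
  qed
  have profile_sum: "profile_sum q s M \<le> real N ^ (CARD('n) * block_len) * (?\<eta> powr (-\<bar>q\<bar>) * T)" for M
  proof -
    let ?G = "PiE (overwritten M) (\<lambda>_. Idx N)"
    have "profile_sum q s M = (\<Sum>f\<in>?G. \<Sum>w\<in>{w\<in>{w\<in>reps s. lev s w = M}. restrict w (overwritten M) = f}. weight w M powr q)"
      unfolding profile_sum_def
      by (rule sum.group[symmetric]) (use finite_reps[of s] s reps_words wordsD in \<open>auto intro: finite_PiE\<close>)
    also have "\<dots> = (\<Sum>f\<in>?G. \<Sum>w\<in>{w\<in>reps s. lev s w = M \<and> restrict w (overwritten M) = f}. weight w M powr q)"
      by (intro sum.cong) auto
    also have "\<dots> \<le> real (card ?G) * (?\<eta> powr (-\<bar>q\<bar>) * T)" by (rule sum_bounded_above) (rule fib)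
    also have "\<dots> \<le> real N ^ (CARD('n) * block_len) * (?\<eta> powr (-\<bar>q\<bar>) * T)"
    proof (rule mult_right_mono)
      have "card ?G = N ^ card (overwritten M)" by (simp add: card_PiE)
      also have "\<dots> \<le> N ^ (CARD('n) * block_len)" using card_overwritten[of M] N_pos by (intro power_increasing) auto
      finally show "real (card ?G) \<le> real N ^ (CARD('n) * block_len)" by (metis of_nat_le_iff of_nat_power)
    qed (use T0 in simp)
    finally show ?thesis .
  qed
  have "cube_sum q s \<le> real (card (lev s ` words N)) * (real N ^ (CARD('n) * block_len) * (?\<eta> powr (-\<bar>q\<bar>) * T))"
    unfolding cube_sum_by_profile[OF s] by (rule sum_bounded_above) (rule profile_sum)
  also have "\<dots> \<le> (C1 * s) ^ CARD('n) * (real N ^ (CARD('n) * block_len) * (?\<eta> powr (-\<bar>q\<bar>) * T))"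
    using T0 by (intro mult_right_mono profiles[OF s]) simp
  finally show ?thesis .
qed

section \<open>The spectrum\<close>

abbreviation TT :: "real \<Rightarrow> real \<Rightarrow> real" where "TT q s \<equiv> Tdelta \<nu> q (exp (- s))"

abbreviation psum :: "real \<Rightarrow> real \<Rightarrow> (real^'n::{finite,linorder}) set \<Rightarrow> real" where
  "psum q s X \<equiv> (\<Sum>x\<in>X. measure \<nu> (cball x (exp (- s))) powr q)"

text \<open>Both signs of \<open>q\<close> in one shape: negative \<open>q\<close> costs a shift of
  scale, the others a polynomial factor.\<close>

lemma packing_upper:
  obtains C m \<beta> where "0 < C" "0 \<le> m" "0 \<le> \<beta>"
    "\<And>s X. 1 \<le> s \<Longrightarrow> centred_packing \<nu> (exp (- s)) X \<Longrightarrow> psum q s X \<le> C * s powr m * cube_sum q (s + \<beta>)"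
proof (cases "q < 0")
  case True
  have "1 \<le> real CARD('n)" by (simp add: Suc_le_eq)
  then have "0 \<le> ln (real CARD('n))" by simp
  then show thesis using packing_upper_neg[OF _ True]
    by (intro that[of 1 0 "ln (real CARD('n))"]) auto
next
  case False
  define C where "C = (2 * real CARD('n) + 2) ^ CARD('n) * (C1 ^ CARD('n) * C2) powr q"
  have "0 < C2" unfolding C2_def by (intro zero_less_power add_nonneg_pos) auto
  then have "0 < C1 ^ CARD('n) * C2" using C1_ge by simp
  then have "0 < (C1 ^ CARD('n) * C2) powr q" by (metis less_irrefl powr_gt_zero)
  then have C: "0 < C" unfolding C_def
    by (intro mult_pos_pos zero_less_power add_nonneg_pos) auto
  show thesis
  proof (rule that[of C "real CARD('n) * q" 0])
    fix s X assume s: "1 \<le> s" and X: "centred_packing \<nu> (exp (- s)) X"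
    have "((C1 * s) ^ CARD('n) * C2) powr q = ((C1 ^ CARD('n) * C2) * s ^ CARD('n)) powr q"
      by (simp add: power_mult_distrib mult_ac)
    also have "\<dots> = (C1 ^ CARD('n) * C2) powr q * (s ^ CARD('n)) powr q"
      using \<open>0 < C1 ^ CARD('n) * C2\<close> s by (intro powr_mult)
    also have "(s ^ CARD('n)) powr q = s powr (real CARD('n) * q)"
      using s by (simp add: powr_realpow[symmetric] powr_powr)
    finally show "psum q s X \<le> C * s powr (real CARD('n) * q) * cube_sum q (s + 0)"
      using packing_upper_pos[OF s _ X, of q] False by (simp add: C_def mult_ac)
  qed (use C False in auto)
qed

text \<open>Packing sums and \<open>cube_sum\<close> bound each other up to polynomial factors and
  bounded shifts of scale; the Lipschitz bound removes the shifts. Boundedness is recorded because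
  \<open>SUP\<close> over the reals is meaningful only for bounded sets.\<close>

lemma Tdelta_bounds:
  obtains K1 K2 where "0 \<le> K2"
    "\<And>s. 1 \<le> s \<Longrightarrow> bdd_above (psum q s ` {X. centred_packing \<nu> (exp (- s)) X})"
    "\<And>s. 1 + b0 \<le> s \<Longrightarrow> 0 < TT q s"
    "\<And>s. 1 + b0 \<le> s \<Longrightarrow> \<bar>ln (TT q s) - ln (cube_sum q s)\<bar> \<le> K1 + K2 * ln s"
proof -
  obtain C m \<beta> where C: "0 < C" "0 \<le> m" "0 \<le> \<beta>" and
    up: "\<And>s X. 1 \<le> s \<Longrightarrow> centred_packing \<nu> (exp (- s)) X \<Longrightarrow> psum q s X \<le> C * s powr m * cube_sum q (s + \<beta>)"
    using packing_upper by blast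
  obtain A where A: "\<And>s s'. 0 \<le> s \<Longrightarrow> 0 \<le> s' \<Longrightarrow> \<bar>ln (cube_sum q s) - ln (cube_sum q s')\<bar> \<le> A * (\<bar>s - s'\<bar> + 1)"
    using ln_cube_sum_lipschitz by blast
  have A0: "0 \<le> A" using A[of 0 0] by simp
  have bdd: "bdd_above (psum q s ` {X. centred_packing \<nu> (exp (- s)) X})" if "1 \<le> s" for s
    using up[OF that] by (intro bdd_aboveI[of _ "C * s powr m * cube_sum q (s + \<beta>)"]) auto
  have Tle: "TT q s \<le> C * s powr m * cube_sum q (s + \<beta>)" if "1 \<le> s" for s
    unfolding Tdelta_def
  proof (rule cSUP_least)
    have "{} \<in> {X. centred_packing \<nu> (exp (- s)) X}" by (simp add: centred_packing_def)
    then show "{X. centred_packing \<nu> (exp (- s)) X} \<noteq> {}" by blast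
  qed (use up[OF that] in auto)
  define G where "G = real N ^ (CARD('n) * block_len) * (mumin ^ J0) powr (-\<bar>q\<bar>)"
  have G: "0 < G" unfolding G_def using N_pos mumin_pos by (intro mult_pos_pos) auto
  have Tge: "cube_sum q s \<le> (C1 * s) ^ CARD('n) * (G * TT q (s + b0))" if s: "1 \<le> s" for s
  proof -
    have "cube_sum q s \<le> (C1 * s) ^ CARD('n) * (real N ^ (CARD('n) * block_len) * ((mumin ^ J0) powr (-\<bar>q\<bar>) * TT q (s + b0)))"
    proof (rule packing_lower[OF s])
      fix X assume X: "centred_packing \<nu> (exp (- (s + b0))) X"
      show "psum q (s + b0) X \<le> TT q (s + b0)" unfolding Tdelta_def
        by (rule cSUP_upper[OF _ bdd]) (use X s b0(2) in auto)
    qed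
    then show ?thesis by (simp add: G_def mult_ac)
  qed
  have Tpos: "0 < TT q s" if "1 + b0 \<le> s" for s
  proof -
    have s: "1 \<le> s - b0" using that by simp
    have "0 < cube_sum q (s - b0)" using cube_sum_pos s by simp
    also have "\<dots> \<le> (C1 * (s - b0)) ^ CARD('n) * (G * TT q s)" using Tge[OF s] by simp
    finally have "0 < (C1 * (s - b0)) ^ CARD('n) * (G * TT q s)" .
    moreover have "0 < (C1 * (s - b0)) ^ CARD('n)" using C1_ge s by (intro zero_less_power mult_pos_pos) linarith+
    ultimately have "0 < G * TT q s" using zero_less_mult_pos by blast
    then show ?thesis using G zero_less_mult_pos by blast
  qed
  define kC kD kG where "kC = \<bar>ln C\<bar>" and "kD = \<bar>ln C1\<bar>" and "kG = \<bar>ln G\<bar>"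
  have k: "0 \<le> kC" "ln C \<le> kC" "0 \<le> kD" "ln C1 \<le> kD" "0 \<le> kG" "ln G \<le> kG"
    by (simp_all add: kC_def kD_def kG_def)
  define K1 where "K1 = kC + A * (\<beta> + 1) + A * (b0 + 1) + real CARD('n) * kD + kG"
  define K2 where "K2 = m + real CARD('n)"
  have "\<bar>ln (TT q s) - ln (cube_sum q s)\<bar> \<le> K1 + K2 * ln s" if s: "1 + b0 \<le> s" for s
  proof -
    have s1: "1 \<le> s" and s2: "1 \<le> s - b0" using s b0(2) by auto
    have ls: "0 \<le> ln s" using s1 by simp
    have Sp: "0 < cube_sum q s" "0 < cube_sum q (s + \<beta>)" "0 < cube_sum q (s - b0)" using cube_sum_pos s1 s2 C(3) by auto
    have Tp: "0 < TT q s" by (rule Tpos[OF s])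
    have "ln (TT q s) \<le> ln (C * s powr m * cube_sum q (s + \<beta>))"
    proof (subst ln_le_cancel_iff)
      show "0 < C * s powr m * cube_sum q (s + \<beta>)" using C(1) s1 Sp(2) by (intro mult_pos_pos) auto
    qed (use Tp Tle[OF s1] in auto)
    also have "\<dots> = ln C + m * ln s + ln (cube_sum q (s + \<beta>))"
      using C(1) s1 Sp(2) by (simp add: ln_mult ln_powr)
    also have "\<dots> \<le> ln C + m * ln s + (ln (cube_sum q s) + A * (\<beta> + 1))"
      using A[of "s + \<beta>" s] s1 C(3) by (simp add: abs_le_iff)
    finally have 1: "ln (TT q s) - ln (cube_sum q s) \<le> ln C + m * ln s + A * (\<beta> + 1)" by linarith
    have c1: "0 < C1" "0 < s - b0" using C1_ge s2 by auto
    have "ln (cube_sum q (s - b0)) \<le> ln ((C1 * (s - b0)) ^ CARD('n) * (G * TT q s))"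
    proof (subst ln_le_cancel_iff)
      show "0 < (C1 * (s - b0)) ^ CARD('n) * (G * TT q s)" using c1 G Tp by (intro mult_pos_pos zero_less_power) auto
    qed (use Sp Tge[OF s2] in auto)
    also have "\<dots> = real CARD('n) * ln (C1 * (s - b0)) + (ln G + ln (TT q s))"
      using c1 G Tp by (subst ln_mult) (auto simp: ln_realpow ln_mult)
    also have "ln (C1 * (s - b0)) = ln C1 + ln (s - b0)" using c1 by (simp add: ln_mult)
    finally have "ln (cube_sum q (s - b0)) \<le> real CARD('n) * (ln C1 + ln (s - b0)) + (ln G + ln (TT q s))" .
    moreover have "real CARD('n) * (ln C1 + ln (s - b0)) \<le> real CARD('n) * (kD + ln s)"
      using c1 b0(2) by (intro mult_left_mono add_mono k) auto
    moreover have "ln (cube_sum q s) \<le> ln (cube_sum q (s - b0)) + A * (b0 + 1)"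
      using A[of s "s - b0"] s1 s2 b0(2) by (simp add: abs_le_iff)
    ultimately have 2: "ln (cube_sum q s) - ln (TT q s) \<le> real CARD('n) * (kD + ln s) + ln G + A * (b0 + 1)" by linarith
    have nn: "0 \<le> m * ln s" "0 \<le> real CARD('n) * ln s" "0 \<le> A * (\<beta> + 1)" "0 \<le> A * (b0 + 1)" "0 \<le> real CARD('n) * kD"
      using C ls A0 b0(2) k by auto
    have e: "K1 + K2 * ln s = kC + A * (\<beta> + 1) + A * (b0 + 1) + real CARD('n) * kD + kG + m * ln s + real CARD('n) * ln s"
      by (simp add: K1_def K2_def distrib_right)
    have e2: "real CARD('n) * (kD + ln s) = real CARD('n) * kD + real CARD('n) * ln s" by (rule distrib_left)
    show ?thesis unfolding e abs_le_iff using 1 2[unfolded e2] nn k by linarith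
  qed
  then show thesis using that[of K2 K1] bdd Tpos C(2) by (simp add: K2_def)
qed

lemma Tdelta_limit: "((\<lambda>s. ln (TT q s) / s) \<longlongrightarrow> pressure N a t (psi N a t \<mu> q)) at_top"
proof -
  obtain K1 K2 where K: "\<And>s. 1 + b0 \<le> s \<Longrightarrow> \<bar>ln (TT q s) - ln (cube_sum q s)\<bar> \<le> K1 + K2 * ln s"
    by (rule Tdelta_bounds[of q]) (rule that)
  have "((\<lambda>s. ln (TT q s) / s - ln (cube_sum q s) / s) \<longlongrightarrow> 0) at_top"
  proof (rule Lim_null_comparison[OF _ tendsto_const_add_ln_over[of K1 K2]])
    show "\<forall>\<^sub>F s in at_top. norm (ln (TT q s) / s - ln (cube_sum q s) / s) \<le> (K1 + K2 * ln s) / s"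
      using eventually_ge_at_top[of "1 + b0"]
    proof eventually_elim
      case (elim s)
      have "0 < s" using elim b0(2) by linarith
      then have "norm (ln (TT q s) / s - ln (cube_sum q s) / s) = \<bar>ln (TT q s) - ln (cube_sum q s)\<bar> / s"
        by (simp add: diff_divide_distrib[symmetric])
      also have "\<dots> \<le> (K1 + K2 * ln s) / s" using K[OF elim] \<open>0 < s\<close> by (intro divide_right_mono) auto
      finally show ?case .
    qed
  qed
  from tendsto_add[OF this pressure_limit[of q]] show ?thesis by simp
qed

lemma Lq_spectrum: "Lq_spectrum_is \<nu> q (pressure N a t (psi N a t \<mu> q))"
  unfolding Lq_spectrum_is_def
proof (rule Lim_transform_eventually[OF tendsto_neg_ln_at_right_0[OF Tdelta_limit]])
  show "\<forall>\<^sub>F \<delta> in at_right 0. ln (TT q (- ln \<delta>)) / - ln \<delta> = ln (Tdelta \<nu> q \<delta>) / - ln \<delta>"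
    by (rule eventually_mono[OF eventually_at_right_less[of 0]]) simp
qed

section \<open>Box and packing dimension\<close>

text \<open>\<open>0 powr 0\<close> is 0, so the balls must be known to have positive measure before
  the sum at exponent 0 counts them.\<close>

lemma psum_0:
  assumes "packs attractor (exp (- s)) Y"
  shows "psum 0 s Y = real (card Y)"
proof -
  have "measure \<nu> (cball x (exp (- s))) \<noteq> 0" if x: "x \<in> Y" for x
  proof -
    obtain w where w: "w \<in> words N" "x = cd w" using assms x by (auto simp: packs_def attractor_def)
    have p: "0 < exp (- s)" by simp
    obtain s' where s': "real CARD('n) * exp (- s') \<le> exp (- s)" using exp_scale_exists[OF p] by blast
    show ?thesis using nu_ball_lower[OF w(1) s'] weight_pos[OF w(1), of "lev s' w"] w(2) by simp
  qed
  then have "psum 0 s Y = (\<Sum>x\<in>Y. 1)" by (intro sum.cong) auto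
  then show ?thesis by simp
qed

text \<open>Packings have at most \<open>TT 0 s\<close> points, so a packing of maximal cardinality
  exists and attains the supremum.\<close>

lemma max_packing:
  assumes s: "1 \<le> s"
  obtains X where "packs attractor (exp (- s)) X" "TT 0 s = real (card X)"
    "\<And>Y. packs attractor (exp (- s)) Y \<Longrightarrow> card Y \<le> card X"
proof -
  have bdd: "bdd_above (psum 0 s ` {X. centred_packing \<nu> (exp (- s)) X})"
    using Tdelta_bounds[of 0] s by metis
  have le: "real (card Y) \<le> TT 0 s" if Y: "packs attractor (exp (- s)) Y" for Y
  proof -
    have "psum 0 s Y \<le> TT 0 s" unfolding Tdelta_def
      by (rule cSUP_upper[OF _ bdd]) (use Y in \<open>simp add: centred_packing_packs msupport_attractor\<close>)
    then show ?thesis by (simp only: psum_0[OF Y])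
  qed
  have "packs attractor (exp (- s)) {}" by (simp add: packs_def)
  moreover have "\<forall>Y. packs attractor (exp (- s)) Y \<longrightarrow> card Y < nat \<lceil>TT 0 s\<rceil> + 1" using le by (auto simp: less_Suc_eq_le) (meson le order.trans of_nat_le_iff real_nat_ceiling_ge)
  ultimately obtain X where X: "packs attractor (exp (- s)) X" "\<And>Y. packs attractor (exp (- s)) Y \<Longrightarrow> card Y \<le> card X"
    using ex_has_greatest_nat[of "packs attractor (exp (- s))" "{}" card] by blast
  have "TT 0 s \<le> real (card X)" unfolding Tdelta_def
  proof (rule cSUP_least)
    show "{X. centred_packing \<nu> (exp (- s)) X} \<noteq> {}" using X(1) by (auto simp: centred_packing_packs msupport_attractor)
    fix Y assume "Y \<in> {X. centred_packing \<nu> (exp (- s)) X}"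
    then have Y: "packs attractor (exp (- s)) Y" by (simp add: centred_packing_packs msupport_attractor)
    show "psum 0 s Y \<le> real (card X)" using X(2)[OF Y] by (simp only: psum_0[OF Y] of_nat_le_iff)
  qed
  with le[OF X(1)] have "TT 0 s = real (card X)" by simp
  then show thesis using that X by blast
qed

text \<open>A set of diameter at most \<open>exp (- s)\<close> contains at most one centre of a
  packing of that radius. Conversely, balls of twice the radius around a maximal packing cover; at
  radius \<open>exp (- s) / 4\<close>, that is at scale \<open>s + ln 4\<close>, their diameters are
  at most \<open>exp (- s)\<close>.\<close>

lemma covnum_bounds:
  assumes s: "1 \<le> s"
  shows "TT 0 s \<le> real (covnum attractor (exp (- s)))" "real (covnum attractor (exp (- s))) \<le> TT 0 (s + ln 4)"
proof -
  let ?Q = "\<lambda>k. \<exists>C. finite C \<and> card C = k \<and> attractor \<subseteq> \<Union>C \<and> (\<forall>U\<in>C. bounded U \<and> diameter U \<le> exp (- s))"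
  have l4: "0 < ln (4::real)" by simp
  let ?\<eta> = "exp (- (s + ln 4))"
  have \<eta>: "4 * ?\<eta> = exp (- s)" by (simp add: exp_add exp_minus exp_diff)
  have s4: "1 \<le> s + ln 4" using s l4 by linarith
  obtain X where X: "packs attractor ?\<eta> X" "TT 0 (s + ln 4) = real (card X)" "\<And>Y. packs attractor ?\<eta> Y \<Longrightarrow> card Y \<le> card X"
    using max_packing[OF s4] by blast
  have fX: "finite X" using X(1) by (simp add: packs_def)
  have cov: "attractor \<subseteq> \<Union>((\<lambda>x. cball x (2 * ?\<eta>)) ` X)"
  proof (rule ccontr)
    assume "\<not> ?thesis"
    then obtain y where "y \<in> attractor" "y \<notin> \<Union>((\<lambda>x. cball x (2 * ?\<eta>)) ` X)" by blast
    then have y: "y \<in> attractor" "\<And>x. x \<in> X \<Longrightarrow> 2 * ?\<eta> < dist x y" by (auto simp: not_le)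
    have yX: "y \<notin> X" using y(2)[of y] by auto
    have dy: "cball x ?\<eta> \<inter> cball y ?\<eta> = {}" if "x \<in> X" for x by (rule cball_disjointI[OF y(2)[OF that]])
    have "packs attractor ?\<eta> (insert y X)"
      using X(1) y(1) dy unfolding packs_def by (auto simp: Int_commute)
    from X(3)[OF this] show False using yX fX by simp
  qed
  have Q: "?Q (card ((\<lambda>x. cball x (2 * ?\<eta>)) ` X))"
    by (rule exI[of _ "(\<lambda>x. cball x (2 * ?\<eta>)) ` X"]) (use fX cov \<eta> in \<open>auto\<close>)
  have "covnum attractor (exp (- s)) \<le> card ((\<lambda>x. cball x (2 * ?\<eta>)) ` X)"
    unfolding covnum_def by (rule Least_le[of ?Q, OF Q])
  also have "\<dots> \<le> card X" by (rule card_image_le[OF fX])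
  finally show "real (covnum attractor (exp (- s))) \<le> TT 0 (s + ln 4)" unfolding X(2) by (rule of_nat_mono)
  have "?Q (covnum attractor (exp (- s)))" unfolding covnum_def by (rule LeastI[of ?Q, OF Q])
  then obtain C where C: "finite C" "card C = covnum attractor (exp (- s))" "attractor \<subseteq> \<Union>C"
    "\<And>U. U \<in> C \<Longrightarrow> bounded U \<and> diameter U \<le> exp (- s)" by blast
  obtain Y where Y: "packs attractor (exp (- s)) Y" "TT 0 s = real (card Y)" using max_packing[OF s] by blast
  have "\<exists>U. U \<in> C \<and> y \<in> U" if "y \<in> Y" for y using C(3) Y(1) that by (auto simp: packs_def)
  then obtain f where f: "\<And>y. y \<in> Y \<Longrightarrow> f y \<in> C \<and> y \<in> f y" by metis
  have "inj_on f Y"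
  proof (rule inj_onI, rule ccontr)
    fix x y assume xy: "x \<in> Y" "y \<in> Y" "f x = f y" "x \<noteq> y"
    have "dist x y \<le> diameter (f x)" using f[OF xy(1)] f[OF xy(2)] xy(3) C(4) by (intro diameter_bounded_bound) auto
    also have "\<dots> \<le> exp (- s)" using C(4) f[OF xy(1)] by blast
    finally have "dist x y \<le> exp (- s)" .
    moreover have "cball x (exp (- s)) \<inter> cball y (exp (- s)) = {}" using Y(1) xy unfolding packs_def by blast
    ultimately show False by (auto simp: disjoint_iff dist_commute dest: spec[of _ y])
  qed
  then have "card Y \<le> card C" using f C(1) by (intro card_inj_on_le[of f]) auto
  then show "TT 0 s \<le> real (covnum attractor (exp (- s)))" by (simp add: Y(2) C(2))
qed

abbreviation PR :: real where "PR \<equiv> pressure N a t (psi N a t \<mu> 0)"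

lemma TT_0_ge_1: assumes "1 \<le> s" shows "1 \<le> TT 0 s"
proof -
  obtain X where X: "packs attractor (exp (- s)) X" "TT 0 s = real (card X)" "\<And>Y. packs attractor (exp (- s)) Y \<Longrightarrow> card Y \<le> card X"
    using max_packing[OF assms] by blast
  obtain x where "x \<in> attractor" using attractor_nonempty by blast
  then have "packs attractor (exp (- s)) {x}" by (simp add: packs_def)
  from X(3)[OF this] show ?thesis using X(2) by simp
qed

lemma PR_nonneg: "0 \<le> PR"
proof (rule tendsto_lowerbound[OF Tdelta_limit[of 0]])
  show "\<forall>\<^sub>F s in at_top. 0 \<le> ln (TT 0 s) / s"
    using eventually_ge_at_top[of 1] by eventually_elim (use TT_0_ge_1 in auto)
qed simp

lemma box_dim: "box_dim_is attractor PR"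
proof -
  have "((\<lambda>s. ln (real (covnum attractor (exp (- s)))) / s) \<longlongrightarrow> PR) at_top"
  proof (rule tendsto_sandwich[OF _ _ Tdelta_limit[of 0] tendsto_ratio_shift[OF Tdelta_limit[of 0], of "ln 4"]])
    show "\<forall>\<^sub>F s in at_top. ln (TT 0 s) / s \<le> ln (real (covnum attractor (exp (- s)))) / s"
      using eventually_ge_at_top[of 1]
    proof eventually_elim
      case (elim s)
      then have "ln (TT 0 s) \<le> ln (real (covnum attractor (exp (- s))))"
        using covnum_bounds(1)[OF elim] TT_0_ge_1[OF elim] by (subst ln_le_cancel_iff) linarith+
      then show ?case using elim by (intro divide_right_mono) auto
    qed
    show "\<forall>\<^sub>F s in at_top. ln (real (covnum attractor (exp (- s)))) / s \<le> ln (TT 0 (s + ln 4)) / s"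
      using eventually_ge_at_top[of 1]
    proof eventually_elim
      case (elim s)
      then have "ln (real (covnum attractor (exp (- s)))) \<le> ln (TT 0 (s + ln 4))"
        using covnum_bounds[OF elim] TT_0_ge_1[OF elim] by (subst ln_le_cancel_iff) linarith+
      then show ?case using elim by (intro divide_right_mono) auto
    qed
  qed
  from tendsto_neg_ln_at_right_0[OF this]
  show ?thesis unfolding box_dim_is_def
  proof (rule Lim_transform_eventually)
    show "\<forall>\<^sub>F \<delta> in at_right 0. ln (real (covnum attractor (exp (- (- ln \<delta>))))) / - ln \<delta> = ln (real (covnum attractor \<delta>)) / - ln \<delta>"
      by (rule eventually_mono[OF eventually_at_right_less[of 0]]) simp
  qed
qed

section \<open>Packing dimension\<close>

lemma packing_measure_above:
  assumes "PR < u"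
  shows "packing_measure u attractor = 0"
proof (rule packing_measure_zero)
  obtain v where v: "PR < v" "v < u" using dense[OF assms] by blast
  have "\<forall>\<^sub>F s in at_top. ln (TT 0 s) / s < v" by (rule order_tendstoD(2)[OF Tdelta_limit v(1)])
  then obtain s1 where s1: "\<And>s. s1 \<le> s \<Longrightarrow> ln (TT 0 s) / s < v" by (auto simp: eventually_at_top_linorder)
  show "packing_premeasure u attractor = 0"
  proof (rule packing_premeasure_zero[where t = v and ?s0.0 = "max 1 s1"])
    show "0 \<le> v" using PR_nonneg v by linarith
    fix s Y assume s: "max 1 s1 \<le> s" and Y: "packs attractor (exp (- s)) Y"
    have s': "1 \<le> s" "s1 \<le> s" using s by auto
    obtain X where "packs attractor (exp (- s)) X" and X: "TT 0 s = real (card X)" "\<And>Y. packs attractor (exp (- s)) Y \<Longrightarrow> card Y \<le> card X"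
      using max_packing[OF s'(1)] by blast
    have "ln (TT 0 s) \<le> v * s" using s1[OF s'(2)] s'(1) by (simp add: pos_divide_less_eq)
    then have "exp (ln (TT 0 s)) \<le> exp (v * s)" by simp
    then have "TT 0 s \<le> exp (v * s)" using TT_0_ge_1[OF s'(1)] by simp
    then show "real (card Y) \<le> exp (v * s)" using X(1) X(2)[OF Y] by simp
  qed (rule v(2))
qed

text \<open>A maximal packing of the attractor is transported into the affine copy, and its centres
  are moved into \<open>E\<close> by less than \<open>lam * exp (- s) / 2\<close>; enough separation
  survives for balls of this radius. The packing sums then grow at least like
  \<open>exp ((v - u) * s)\<close> with \<open>u < v\<close>.\<close>

lemma packing_sum_infinite:
  assumes u: "0 \<le> u" "u < PR" and w: "w \<in> words N"
    and cl: "comp_first a t k w ` attractor \<subseteq> closure E" and \<delta>: "0 < \<delta>"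
  shows "packing_sum_delta u \<delta> E = \<top>"
proof -
  define g where "g = comp_first a t k w"
  \<comment> \<open>A lower bound for the contraction ratios of the first \<open>k\<close> letters
    in all coordinates.\<close>
  define lam where "lam = exp (- (real k * hmax))"
  have lam: "0 < lam" by (simp add: lam_def)
  have expand: "lam * dist y y' \<le> dist (g y) (g y')" for y y'
  proof -
    have "norm (lam *\<^sub>R (y - y')) \<le> norm (g y - g y')"
    proof (rule norm_le_componentwise_cart)
      fix c
      have "(g y - g y') $ c = slope w c k * (y $ c - y' $ c)" by (simp add: g_def comp_first_nth cmap_diff)
      moreover have "lam \<le> \<bar>slope w c k\<bar>" unfolding abs_slope[OF w] lam_def using tau_bounds(2)[OF w, of c k] by simp
      ultimately show "norm ((lam *\<^sub>R (y - y')) $ c) \<le> norm ((g y - g y') $ c)"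
        using lam by (simp add: abs_mult mult_right_mono)
    qed
    then show ?thesis using lam by (simp add: dist_norm)
  qed
  \<comment> \<open>With an exponent strictly between \<open>u\<close> and \<open>PR\<close>,
    maximal packings eventually have at least \<open>exp (v * s)\<close> points.\<close>
  obtain v where v: "u < v" "v < PR" using dense[OF u(2)] by blast
  have big: "ennreal (lam powr u * exp ((v - u) * s)) \<le> packing_sum_delta u \<delta> E"
    if s: "1 \<le> s" "v < ln (TT 0 s) / s" "lam * exp (- s) / 2 \<le> \<delta>" for s
  proof -
    let ?\<eta> = "exp (- s)"
    obtain X where X: "packs attractor ?\<eta> X" "TT 0 s = real (card X)" using max_packing[OF s(1)] by blast
    have "v * s < ln (TT 0 s)" using s by (simp add: pos_less_divide_eq)
    then have "exp (v * s) < exp (ln (TT 0 s))" by simp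
    then have cX: "exp (v * s) \<le> real (card X)" using TT_0_ge_1[OF s(1)] X(2) by simp
    have "\<exists>e. e \<in> E \<and> dist e (g x) < lam * ?\<eta> / 2" if x: "x \<in> X" for x
    proof -
      have "g x \<in> closure E" using cl X(1) x by (auto simp: packs_def g_def)
      moreover have "0 < lam * ?\<eta> / 2" using lam by simp
      ultimately show ?thesis unfolding closure_approachable by blast
    qed
    then obtain e where e: "\<And>x. x \<in> X \<Longrightarrow> e x \<in> E \<and> dist (e x) (g x) < lam * ?\<eta> / 2" by metis
    have sep: "2 * (lam * ?\<eta> / 2) < dist (e x) (e y)" if xy: "x \<in> X" "y \<in> X" "x \<noteq> y" for x y
    proof -
      have "cball x ?\<eta> \<inter> cball y ?\<eta> = {}" using X(1) xy unfolding packs_def by blast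
      then have "2 * ?\<eta> < dist x y" by (rule cball_disjoint_dist)
      then have "lam * (2 * ?\<eta>) < lam * dist x y" using lam by (rule mult_strict_left_mono)
      also have "\<dots> \<le> dist (g x) (g y)" by (rule expand)
      also have "\<dots> \<le> dist (e x) (g x) + dist (e x) (e y) + dist (e y) (g y)"
        using dist_triangle[of "g x" "g y" "e x"] dist_triangle[of "e x" "g y" "e y"] by (simp add: dist_commute)
      finally show ?thesis using e[OF xy(1)] e[OF xy(2)] by linarith
    qed
    have inj: "inj_on e X"
    proof (rule inj_onI, rule ccontr)
      fix x y assume xy: "x \<in> X" "y \<in> X" "e x = e y" "x \<noteq> y"
      have "0 < lam * ?\<eta>" using lam by simp
      then show False using sep[OF xy(1,2,4)] xy(3) by simp
    qed
    have fX: "finite X" using X(1) by (simp add: packs_def)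
    have "lam powr u * exp ((v - u) * s) = (lam * ?\<eta>) powr u * exp (v * s)"
      using lam by (simp add: powr_mult exp_powr_real exp_add[symmetric] algebra_simps)
    also have "\<dots> \<le> (lam * ?\<eta>) powr u * real (card X)" using cX by (intro mult_left_mono) auto
    also have "\<dots> = (\<Sum>y\<in>e ` X. (2 * (lam * ?\<eta> / 2)) powr u)" by (simp add: card_image[OF inj])
    finally have "ennreal (lam powr u * exp ((v - u) * s)) \<le> ennreal (\<Sum>y\<in>e ` X. (2 * (lam * ?\<eta> / 2)) powr u)" by (rule ennreal_leI)
    also have "\<dots> = (\<integral>\<^sup>+ y. ennreal ((2 * (lam * ?\<eta> / 2)) powr u) \<partial>count_space (e ` X))"
      using fX by (subst nn_integral_count_space_finite) (simp, rule sum_ennreal[symmetric], simp)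
    also have "\<dots> \<le> packing_sum_delta u \<delta> E"
      unfolding packing_sum_delta_def
    proof (rule SUP_upper2[of "(e ` X, \<lambda>_. lam * ?\<eta> / 2)"])
      have "cball (e x) (lam * ?\<eta> / 2) \<inter> cball (e y) (lam * ?\<eta> / 2) = {}" if "x \<in> X" "y \<in> X" "e x \<noteq> e y" for x y
        by (rule cball_disjointI[OF sep]) (use that in auto)
      then show "(e ` X, \<lambda>_. lam * ?\<eta> / 2) \<in> {(X, r). countable X \<and> X \<subseteq> E \<and> (\<forall>x\<in>X. 0 < r x \<and> r x \<le> \<delta>) \<and>
                     (\<forall>x\<in>X. \<forall>y\<in>X. x \<noteq> y \<longrightarrow> cball x (r x) \<inter> cball y (r y) = {})}"
        using fX e lam s(3) by (simp add: countable_finite) blast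
    qed simp
    finally show ?thesis .
  qed
  have "ennreal B \<le> packing_sum_delta u \<delta> E" for B
  proof -
    have "filterlim (\<lambda>s. exp ((v - u) * s)) at_top at_top"
      using v(1) by (intro filterlim_compose[OF exp_at_top] filterlim_tendsto_pos_mult_at_top[OF tendsto_const]) (auto intro: filterlim_ident)
    then have 1: "\<forall>\<^sub>F s in at_top. B / lam powr u \<le> exp ((v - u) * s)" by (simp add: filterlim_at_top)
    have 2: "\<forall>\<^sub>F s in at_top. v < ln (TT 0 s) / s" by (rule order_tendstoD(1)[OF Tdelta_limit v(2)])
    have "((\<lambda>s::real. exp (- s)) \<longlongrightarrow> 0) at_top"
      by (rule filterlim_compose[OF exp_at_bot]) (simp add: filterlim_uminus_at_bot_at_top)
    then have 3: "\<forall>\<^sub>F s in at_top. exp (- s) < 2 * \<delta> / lam" using order_tendstoD(2) \<delta> lam by fastforce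
    from eventually_conj[OF 1 eventually_conj[OF 2 eventually_conj[OF 3 eventually_ge_at_top[of 1]]]]
    obtain s where s: "B / lam powr u \<le> exp ((v - u) * s)" "v < ln (TT 0 s) / s" "exp (- s) < 2 * \<delta> / lam" "1 \<le> s"
      using eventually_happens'[OF trivial_limit_at_top_linorder] by blast
    have lu: "0 < lam powr u" using lam by simp
    have "B \<le> lam powr u * exp ((v - u) * s)" using s(1) lu by (simp add: pos_divide_le_eq mult.commute)
    then have "ennreal B \<le> ennreal (lam powr u * exp ((v - u) * s))" by (rule ennreal_leI)
    also have "\<dots> \<le> packing_sum_delta u \<delta> E"
      using s lam by (intro big) (auto simp: pos_less_divide_eq mult.commute)
    finally show ?thesis .
  qed
  then show ?thesis using ennreal_cases[of "packing_sum_delta u \<delta> E"]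
    by (metis ennreal_le_iff2 gt_ex not_le order.strict_trans2 order_less_irrefl linorder_le_cases)
qed

text \<open>In any countable cover the closure of one piece contains a relatively open part of the
  attractor, hence an affine copy of it, and the premeasure of this piece alone is infinite.\<close>

lemma packing_measure_below:
  assumes u: "0 \<le> u" "u < PR"
  shows "packing_measure u attractor = \<top>"
proof -
  have "(\<Sum>i. packing_premeasure u (E i)) = \<top>" if E: "attractor \<subseteq> (\<Union>i. E i)" for E :: "nat \<Rightarrow> (real^'n::{finite,linorder}) set"
  proof -
    obtain i x e where x: "x \<in> attractor" "0 < e" "ball x e \<inter> attractor \<subseteq> closure (E i)"
      using Baire_cover[OF compact_imp_closed[OF compact_attractor] attractor_nonempty E] by metis
    obtain w where w: "w \<in> words N" "x = cd w" using x(1) by (auto simp: attractor_def)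
    \<comment> \<open>The number \<open>k\<close> of letters is chosen so that the copy fits into
      the ball; 2 bounds \<open>\<bar>y $ c\<bar> + 1\<close> for points \<open>y\<close> of the
      attractor.\<close>
    have "(\<lambda>k. real CARD('n) * (exp (- hmin) ^ k * 2)) \<longlonglongrightarrow> real CARD('n) * (0 * 2)"
      using hmin_pos by (intro tendsto_intros LIMSEQ_realpow_zero) auto
    then have "\<forall>\<^sub>F k in sequentially. real CARD('n) * (exp (- hmin) ^ k * 2) < e" using order_tendstoD(2) x(2) by fastforce
    then obtain k where k: "real CARD('n) * (exp (- hmin) ^ k * 2) < e" using eventually_happens'[OF sequentially_bot] by blast
    have "comp_first a t k w ` attractor \<subseteq> ball x e \<inter> attractor"
    proof
      fix z assume "z \<in> comp_first a t k w ` attractor"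
      then obtain y where y: "y \<in> attractor" "z = comp_first a t k w y" by blast
      obtain y' where y': "y' \<in> words N" "y = cd y'" using y(1) by (auto simp: attractor_def)
      have "\<bar>z $ c - cd w $ c\<bar> \<le> exp (- hmin) ^ k * 2" for c
      proof -
        have "\<bar>z $ c - cd w $ c\<bar> \<le> exp (- (real k * hmin)) * (\<bar>y $ c\<bar> + 1)"
          unfolding y(2) by (rule comp_first_nth_dist[OF w(1)])
        also have "\<dots> \<le> exp (- (real k * hmin)) * 2"
          using coding_interval[OF y'(1), of c] y'(2) by (intro mult_left_mono) auto
        also have "exp (- (real k * hmin)) = exp (- hmin) ^ k" by (simp add: exp_of_nat_mult[symmetric])
        finally show ?thesis .
      qed
      then have "dist z (cd w) \<le> real CARD('n) * (exp (- hmin) ^ k * 2)" by (rule dist_vec_le)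
      then have "z \<in> ball x e" using k w(2) by (simp add: dist_commute)
      moreover have "comp_first a t k w y \<in> attractor"
        using y(1) by (induction k arbitrary: y) (use attractor_invariant wordsD[OF w(1)] in auto)
      ultimately show "z \<in> ball x e \<inter> attractor" using y(2) by simp
    qed
    then have "comp_first a t k w ` attractor \<subseteq> closure (E i)" using x(3) by blast
    then have "packing_sum_delta u \<delta> (E i) = \<top>" if "0 < \<delta>" for \<delta>
      by (rule packing_sum_infinite[OF u w(1) _ that])
    then have top: "packing_premeasure u (E i) = \<top>" unfolding packing_premeasure_def by simp
    have "packing_premeasure u (E i) \<le> (\<Sum>i. packing_premeasure u (E i))"
      using sum_le_suminf[of "\<lambda>i. packing_premeasure u (E i)" "{i}"] by simp
    then show ?thesis unfolding top by (simp add: top_unique)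
  qed
  then show ?thesis unfolding packing_measure_def by simp
qed

lemma packing_dim_attractor: "packing_dim attractor = PR"
proof -
  let ?A = "{s. 0 \<le> s \<and> packing_measure s attractor = 0}"
  have lo: "PR \<le> u" if "u \<in> ?A" for u
  proof (rule ccontr)
    assume "\<not> PR \<le> u"
    then have "packing_measure u attractor = \<top>" using that by (intro packing_measure_below) auto
    then show False using that by simp
  qed
  have hi: "PR + e \<in> ?A" if "0 < e" for e
    using packing_measure_above[of "PR + e"] PR_nonneg that by auto
  have bdd: "bdd_below ?A" using lo by (rule bdd_belowI)
  show ?thesis unfolding packing_dim_def
  proof (rule antisym)
    show "Inf ?A \<le> PR" by (rule field_le_epsilon) (rule cInf_lower[OF hi bdd])
    show "PR \<le> Inf ?A" by (rule cInf_greatest) (use hi[of 1] lo in auto)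
  qed
qed

end

theorem theorem3p3:
  fixes N :: nat
    and a :: "nat \<Rightarrow> 'n::{finite,linorder} \<Rightarrow> real"
    and t :: "nat \<Rightarrow> real^'n::{finite,linorder}"
    and \<mu> :: "nat \<Rightarrow> real"
  assumes "sponge_system N a t"
    and "SPPC N a t"
    and "\<forall>i\<in>Idx N. \<mu> i > 0"
    and "(\<Sum>i\<in>Idx N. \<mu> i) = 1"
  shows "(\<forall>q::real. Lq_spectrum_is (self_affine_measure N a t \<mu>) q (pressure N a t (psi N a t \<mu> q)))
       \<and> box_dim_is (sponge N a t) (pressure N a t (psi N a t \<mu> 0))
       \<and> packing_dim (sponge N a t) = pressure N a t (psi N a t \<mu> 0)"
proof -
  interpret self_affine_sponge N a t \<mu>
    by unfold_locales (fact assms)+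
  show ?thesis
    using Lq_spectrum box_dim packing_dim_attractor by (simp add: sponge_eq_attractor)
qed

end
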